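(* There is an algorithm which, given a finite, simple, connected graph $G$ with $n=|V(G)|$ vertices, correctly computes an optimal matching cover of $G$ in $O(n^3)$ time.
   Context: A matching of a graph is a set of pairwise vertex-disjoint edges. A $k$-matching cover of $G$ is a union of $k$ matchings of $G$ that covers every vertex of $G$ (every vertex is an endpoint of some edge of the union). The matching cover number $mc(G)$ is the minimum $k$ such that $G$ has a $k$-matching cover, and a $k$-matching cover is optimal if $k=mc(G)$. The algorithm outputs an edge set which is the union of $mc(G)$ matchings of $G$ and covers $V(G)$. *)

theory Defs
  imports Complex_Main "HOL-Library.Landau_Symbols"
begin

definition simple_graph :: "'a set \<Rightarrow> 'a set set \<Rightarrow> bool" where
  "simple_graph V E \<longleftrightarrow> finite V \<and> (\<forall>e\<in>E. e \<subseteq> V \<and> card e = 2)"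

definition connected_graph :: "'a set \<Rightarrow> 'a set set \<Rightarrow> bool" where
  "connected_graph V E \<longleftrightarrow> V \<noteq> {} \<and> (\<forall>u\<in>V. \<forall>v\<in>V. (u, v) \<in> {(x, y). {x, y} \<in> E}\<^sup>*)"

definition matching :: "'a set set \<Rightarrow> 'a set set \<Rightarrow> bool" where
  "matching E M \<longleftrightarrow> M \<subseteq> E \<and> pairwise disjnt M"

definition matching_cover :: "'a set \<Rightarrow> 'a set set \<Rightarrow> nat \<Rightarrow> 'a set set \<Rightarrow> bool" where
  "matching_cover V E k F \<longleftrightarrow>
     (\<exists>M. (\<forall>i<k. matching E (M i)) \<and> F = (\<Union>i<k. M i)) \<and> (\<forall>v\<in>V. \<exists>e\<in>F. v \<in> e)"

text \<open>A graph with an isolated vertex, such as the one-vertex graph, has no matching cover at all;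
  for such a graph the value of \<open>mc\<close> is meaningless and no edge set is an optimal matching cover.\<close>

definition mc :: "'a set \<Rightarrow> 'a set set \<Rightarrow> nat" where
  "mc V E = (LEAST k. \<exists>F. matching_cover V E k F)"

definition optimal_matching_cover :: "'a set \<Rightarrow> 'a set set \<Rightarrow> 'a set set \<Rightarrow> bool" where
  "optimal_matching_cover V E F \<longleftrightarrow> matching_cover V E (mc V E) F"

text \<open>Among connected graphs, the one-vertex graph is the only one without a matching cover.\<close>

lemma connected_has_matching_cover:
  assumes G: "simple_graph V E" "connected_graph V E" and V: "card V \<noteq> 1"
  shows "\<exists>k F. matching_cover V E k F"
proof -
  have fin: "finite V" and "E \<subseteq> Pow V"
    using G(1) by (auto simp: simple_graph_def)
  then have "finite E"
    using finite_subset by blast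
  then obtain M :: "nat \<Rightarrow> 'a set" and k where M: "E = M ` {i. i < k}"
    using finite_imp_nat_seg_image_inj_on by metis
  have "\<exists>e\<in>E. v \<in> e" if v: "v \<in> V" for v
  proof -
    have "V \<noteq> {v}"
      using V by auto
    then obtain u where "u \<in> V" "u \<noteq> v"
      using v by auto
    then have "(v, u) \<in> {(x, y). {x, y} \<in> E}\<^sup>*" "v \<noteq> u"
      using G(2) v by (auto simp: connected_graph_def)
    then obtain w where "{v, w} \<in> E"
      by (auto elim: converse_rtranclE)
    then show ?thesis
      by blast
  qed
  then have "matching_cover V E k E"
    unfolding matching_cover_def matching_def using M
    by (intro conjI exI[of _ "\<lambda>i. {M i}"]) (auto simp: pairwise_def)
  then show ?thesis
    by blast
qed

text \<open>
  The model of computation is a word RAM programmed in a while language.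
  The memory consists of arrays of natural numbers; a program mentions only finitely many of them,
  and a scalar variable is cell 0 of an array. Every arithmetic operation, comparison, Boolean
  connective, memory access and branch costs one time unit. To keep the unit cost realistic, every
  number that a program produces must be smaller than the bound \<open>B\<close> (numbers of
  \<open>O(log n)\<close> bits when \<open>B\<close> is polynomial in \<open>n\<close>); an execution that
  violates this is stuck and has no result. Subtraction is truncated at 0.
\<close>

type_synonym aname = string
type_synonym mem = "aname \<Rightarrow> nat \<Rightarrow> nat"

datatype aexp =
    Const nat
  | Cell aname aexp
  | Plus aexp aexp
  | Minus aexp aexp
  | Times aexp aexp
  | Div aexp aexp
  | Mod aexp aexp

datatype bexp =
    Less aexp aexp
  | Equal aexp aexp
  | Neg bexp
  | Conj bexp bexp

datatype com =
    Skip
  | Assign aname aexp aexp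
  | Seq com com
  | Cond bexp com com
  | While bexp com

primrec aval :: "mem \<Rightarrow> aexp \<Rightarrow> nat" where
  "aval s (Const k) = k"
| "aval s (Cell x a) = s x (aval s a)"
| "aval s (Plus a b) = aval s a + aval s b"
| "aval s (Minus a b) = aval s a - aval s b"
| "aval s (Times a b) = aval s a * aval s b"
| "aval s (Div a b) = aval s a div aval s b"
| "aval s (Mod a b) = aval s a mod aval s b"

primrec acost :: "aexp \<Rightarrow> nat" where
  "acost (Const k) = 1"
| "acost (Cell x a) = acost a + 1"
| "acost (Plus a b) = acost a + acost b + 1"
| "acost (Minus a b) = acost a + acost b + 1"
| "acost (Times a b) = acost a + acost b + 1"
| "acost (Div a b) = acost a + acost b + 1"
| "acost (Mod a b) = acost a + acost b + 1"

text \<open>Only constants, sums and products have to be checked: the other operations do not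
  produce a number larger than their operands or the numbers already in memory.\<close>

primrec afits :: "nat \<Rightarrow> mem \<Rightarrow> aexp \<Rightarrow> bool" where
  "afits B s (Const k) \<longleftrightarrow> k < B"
| "afits B s (Cell x a) \<longleftrightarrow> afits B s a"
| "afits B s (Plus a b) \<longleftrightarrow> afits B s a \<and> afits B s b \<and> aval s a + aval s b < B"
| "afits B s (Minus a b) \<longleftrightarrow> afits B s a \<and> afits B s b"
| "afits B s (Times a b) \<longleftrightarrow> afits B s a \<and> afits B s b \<and> aval s a * aval s b < B"
| "afits B s (Div a b) \<longleftrightarrow> afits B s a \<and> afits B s b"
| "afits B s (Mod a b) \<longleftrightarrow> afits B s a \<and> afits B s b"

primrec bval :: "mem \<Rightarrow> bexp \<Rightarrow> bool" where
  "bval s (Less a b) \<longleftrightarrow> aval s a < aval s b"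
| "bval s (Equal a b) \<longleftrightarrow> aval s a = aval s b"
| "bval s (Neg b) \<longleftrightarrow> \<not> bval s b"
| "bval s (Conj b c) \<longleftrightarrow> bval s b \<and> bval s c"

primrec bcost :: "bexp \<Rightarrow> nat" where
  "bcost (Less a b) = acost a + acost b + 1"
| "bcost (Equal a b) = acost a + acost b + 1"
| "bcost (Neg b) = bcost b + 1"
| "bcost (Conj b c) = bcost b + bcost c + 1"

primrec bfits :: "nat \<Rightarrow> mem \<Rightarrow> bexp \<Rightarrow> bool" where
  "bfits B s (Less a b) \<longleftrightarrow> afits B s a \<and> afits B s b"
| "bfits B s (Equal a b) \<longleftrightarrow> afits B s a \<and> afits B s b"
| "bfits B s (Neg b) \<longleftrightarrow> bfits B s b"
| "bfits B s (Conj b c) \<longleftrightarrow> bfits B s b \<and> bfits B s c"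

text \<open>\<open>exec B p s t s'\<close>: started in memory \<open>s\<close>, program \<open>p\<close> halts after exactly
  \<open>t\<close> time units in memory \<open>s'\<close>, without exceeding the bound \<open>B\<close>.\<close>

inductive exec :: "nat \<Rightarrow> com \<Rightarrow> mem \<Rightarrow> nat \<Rightarrow> mem \<Rightarrow> bool" for B :: nat where
  Skip: "exec B Skip s 1 s"
| Assign: "afits B s i \<Longrightarrow> afits B s a \<Longrightarrow>
    exec B (Assign x i a) s (acost i + acost a + 1) (s(x := (s x)(aval s i := aval s a)))"
| Seq: "exec B c s t s' \<Longrightarrow> exec B d s' t' s'' \<Longrightarrow> exec B (Seq c d) s (t + t') s''"
| IfTrue: "bfits B s b \<Longrightarrow> bval s b \<Longrightarrow> exec B c s t s' \<Longrightarrow>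
    exec B (Cond b c d) s (bcost b + 1 + t) s'"
| IfFalse: "bfits B s b \<Longrightarrow> \<not> bval s b \<Longrightarrow> exec B d s t s' \<Longrightarrow>
    exec B (Cond b c d) s (bcost b + 1 + t) s'"
| WhileTrue: "bfits B s b \<Longrightarrow> bval s b \<Longrightarrow> exec B c s t s' \<Longrightarrow>
    exec B (While b c) s' t' s'' \<Longrightarrow> exec B (While b c) s (bcost b + 1 + t + t') s''"
| WhileFalse: "bfits B s b \<Longrightarrow> \<not> bval s b \<Longrightarrow> exec B (While b c) s (bcost b + 1) s"

inductive_cases exec_SkipE: "exec B Skip s t s'"
  and exec_AssignE: "exec B (Assign x i a) s t s'"
  and exec_SeqE: "exec B (Seq c d) s t s'"
  and exec_IfE: "exec B (Cond b c d) s t s'"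
  and exec_WhileE: "exec B (While b c) s t s'"

lemma exec_deterministic:
  "exec B p s t s' \<Longrightarrow> exec B p s u s'' \<Longrightarrow> t = u \<and> s' = s''"
proof (induction arbitrary: u s'' rule: exec.induct)
  case (Skip s)
  from Skip show ?case by (rule exec_SkipE) simp
next
  case (Assign s i a x)
  from Assign(3) show ?case by (rule exec_AssignE) simp
next
  case (Seq c s t s' d t' r)
  from Seq.prems show ?case by (rule exec_SeqE) (auto dest: Seq.IH)
next
  case (IfTrue s b c t s' d)
  from IfTrue.prems show ?case by (rule exec_IfE) (auto dest: IfTrue.IH simp: IfTrue.hyps(2))
next
  case (IfFalse s b d t s' c)
  from IfFalse.prems show ?case by (rule exec_IfE) (auto dest: IfFalse.IH simp: IfFalse.hyps(2))
next
  case (WhileTrue s b c t s' t' r)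
  from WhileTrue.prems show ?case by (rule exec_WhileE) (auto dest: WhileTrue.IH simp: WhileTrue.hyps(2))
next
  case (WhileFalse s b c)
  from WhileFalse.prems show ?case by (rule exec_WhileE) (auto simp: WhileFalse.hyps(2))
qed

text \<open>Edge sets of graphs on \<open>{..<n}\<close> are stored as row-major adjacency matrices. The output
  matrix need not be symmetric: an edge is output if either of its two entries is nonzero.\<close>

definition input_mem :: "nat \<Rightarrow> nat set set \<Rightarrow> mem" where
  "input_mem n E = (\<lambda>x i.
     if x = ''n'' \<and> i = 0 then n
     else if x = ''adj'' \<and> i < n * n \<and> {i div n, i mod n} \<in> E then 1
     else 0)"

definition output_edges :: "nat \<Rightarrow> mem \<Rightarrow> nat set set" where
  "output_edges n s = {{u, v} | u v. u < n \<and> v < n \<and> s ''cover'' (u * n + v) \<noteq> 0}"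

end

theory Submission
  imports Defs
begin

text \<open>
  An edge cover can be thinned out to a spanning star forest, and a star with at most \<open>k\<close> leaves
  splits into \<open>k\<close> matchings. Hence \<open>mc\<close> is the least \<open>k\<close> for which there is a spanning star forest
  whose stars have at most \<open>k\<close> leaves.

  For \<open>k = 1\<close> this asks for a perfect matching. Edmonds' search is started once from every vertex that
  is still unmatched. It keeps an explicit alternating path to every outer vertex, so that a
  contraction writes the path of a new outer vertex by concatenating an old path with a reversed one.
  A search either augments or stops with a Tutte set of inner vertices that excludes perfect matchings.

  For \<open>k \<ge> 2\<close> no blossoms are needed. An uncovered vertex \<open>x\<close> with a neighbour \<open>w\<close> that is not a
  centre with \<open>k\<close> leaves can be covered directly; otherwise \<open>x\<close> takes the place of a leaf of \<open>w\<close>, which becomes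
  uncovered in turn. If all vertices that can be uncovered in this way have only full centres as
  neighbours, then they outnumber \<open>k\<close> times these centres by one, so there is no cover by \<open>k\<close> matchings
  and \<open>k\<close> is increased.

  There are \<open>O(n)\<close> searches in both parts. A search takes time \<open>O(n\<^sup>2)\<close>, since its steps cost \<open>O(n)\<close> plus
  \<open>O(n)\<close> per new outer vertex, and each of them makes a vertex outer, finishes a vertex, or ends the search.
\<close>


section \<open>Graphs\<close>

text \<open>A search stays within O(n^2) because each outer vertex has its path written once. The
  path is copied into a row of its own when the vertex becomes outer and never changes, although the
  base may change with every later contraction. So augmenting needs no expansion of nested blossoms,
  and a contraction may spend O(n) on relabelling, since it turns at least one inner vertex outer.
  The price is an invariant that makes stored paths comparable: bases cut a path into prefixes that
  are stored paths themselves, so two paths agree up to their last common base.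

  One search per vertex suffices because a failure is never local. In the matching part it refutes
  every perfect matching, not only an augmentation from this root. In the star part it proves that
  \<open>k\<close> matchings are too few; after the increase the neighbours of the uncovered vertex
  have spare capacity, so the same search ends at once. Hence \<open>k\<close> starts at 2 with a
  proof that 1 is impossible, is never reset, and is a lower bound for the number of matchings at
  every moment.\<close>

lemma even_card_involution:
  assumes "finite A" "\<And>x. x \<in> A \<Longrightarrow> f x \<in> A \<and> f (f x) = x \<and> f x \<noteq> x"
  shows "even (card A)"
  using assms
proof (induction A rule: finite_psubset_induct)
  case (psubset A)
  show ?case
  proof (cases "A = {}")
    case False
    then obtain x where x: "x \<in> A" by blast
    let ?B = "A - {x, f x}"
    have fx: "f x \<in> A" "f (f x) = x" "f x \<noteq> x" using psubset.prems[OF x] by auto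
    have "even (card ?B)"
    proof (rule psubset.IH)
      show "?B \<subset> A" using x by blast
      fix y assume y: "y \<in> ?B"
      then have "f y \<in> A" "f (f y) = y" "f y \<noteq> y" using psubset.prems by blast+
      moreover have "f y \<noteq> x" "f y \<noteq> f x" using y fx \<open>f (f y) = y\<close> by auto
      ultimately show "f y \<in> ?B \<and> f (f y) = y \<and> f y \<noteq> y" by blast
    qed
    moreover have "card A = card ?B + card {x, f x}"
      using card_Diff_subset[of "{x, f x}" A] card_mono[of A "{x, f x}"] psubset.hyps fx x by simp
    moreover have "card {x, f x} = 2" using fx by simp
    ultimately show ?thesis by simp
  qed simp
qed

locale graph =
  fixes n :: nat and E :: "nat set set"
  assumes simple: "simple_graph {..<n} E"
begin

abbreviation adj :: "nat \<Rightarrow> nat \<Rightarrow> bool" where "adj u w \<equiv> {u, w} \<in> E"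

lemma adjD: assumes "adj u w" shows "u < n" "w < n" "u \<noteq> w"
proof -
  have "{u, w} \<subseteq> {..<n}" "card {u, w} = 2" using simple assms unfolding simple_graph_def by blast+
  then show "u < n" "w < n" "u \<noteq> w" by auto
qed

lemma adj_commute: "adj u w \<longleftrightarrow> adj w u" by (simp add: insert_commute)

text \<open>A matching is encoded as an involution; its fixed points are the unmatched vertices.\<close>

definition mating :: "(nat \<Rightarrow> nat) \<Rightarrow> bool" where
  "mating m \<longleftrightarrow> (\<forall>v<n. m v < n \<and> m (m v) = v \<and> (m v \<noteq> v \<longrightarrow> adj v (m v)))"

text \<open>An odd number of vertices means an even number of edges. Edges leaving odd positions are
  matching edges, so a path with more than one vertex reaches its end by the matching edge of that
  end: this is what makes the end outer.\<close>

definition altpath :: "(nat \<Rightarrow> nat) \<Rightarrow> nat \<Rightarrow> nat list \<Rightarrow> bool" where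
  "altpath m r p \<longleftrightarrow> odd (length p) \<and> p ! 0 = r \<and> distinct p \<and> set p \<subseteq> {..<n}
     \<and> (\<forall>i. Suc i < length p \<longrightarrow> adj (p ! i) (p ! Suc i))
     \<and> (\<forall>i. odd i \<longrightarrow> Suc i < length p \<longrightarrow> m (p ! i) = p ! Suc i)"

text \<open>The outer vertices are grouped into blossoms by their base, the vertices of \<open>Inn\<close> are the inner
  ones outside all blossoms, and \<open>P v\<close> enters the blossom of \<open>v\<close> at its base.\<close>

definition search :: "(nat \<Rightarrow> nat) \<Rightarrow> nat \<Rightarrow> nat set \<Rightarrow> nat set \<Rightarrow> (nat \<Rightarrow> nat) \<Rightarrow> (nat \<Rightarrow> nat list) \<Rightarrow> bool" where
  "search m r Out Inn base P \<longleftrightarrow>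
     mating m \<and> m r = r \<and> r \<in> Out \<and> base r = r \<and> P r = [r] \<and>
     Out \<union> Inn \<subseteq> {..<n} \<and> Out \<inter> Inn = {} \<and>
     (\<forall>v\<in>Out. base v \<in> Out \<and> base (base v) = base v \<and> altpath m r (P v) \<and> last (P v) = v \<and>
        (\<exists>Q. P v = P (base v) @ Q \<and> (\<forall>q\<in>set Q. q \<in> Out \<and> base q = base v))) \<and>
     (\<forall>v\<in>Out. base v \<noteq> v \<longrightarrow> m v \<in> Out \<and> base (m v) = base v) \<and>
     (\<forall>b\<in>Out. base b = b \<longrightarrow> b \<noteq> r \<longrightarrow> m b \<in> Inn \<and> (\<exists>u\<in>Out. P b = P u @ [m b, b])) \<and>
     (\<forall>v\<in>Inn. m v \<in> Out \<and> base (m v) = m v)"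

lemma searchI:
  assumes "mating m" "m r = r" "r \<in> Out" "base r = r" "P r = [r]" "Out \<union> Inn \<subseteq> {..<n}" "Out \<inter> Inn = {}"
    "\<And>v. v \<in> Out \<Longrightarrow> base v \<in> Out" "\<And>v. v \<in> Out \<Longrightarrow> base (base v) = base v"
    "\<And>v. v \<in> Out \<Longrightarrow> altpath m r (P v)" "\<And>v. v \<in> Out \<Longrightarrow> last (P v) = v"
    "\<And>v. v \<in> Out \<Longrightarrow> \<exists>Q. P v = P (base v) @ Q \<and> (\<forall>q\<in>set Q. q \<in> Out \<and> base q = base v)"
    "\<And>v. v \<in> Out \<Longrightarrow> base v \<noteq> v \<Longrightarrow> m v \<in> Out"
    "\<And>v. v \<in> Out \<Longrightarrow> base v \<noteq> v \<Longrightarrow> base (m v) = base v"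
    "\<And>b. b \<in> Out \<Longrightarrow> base b = b \<Longrightarrow> b \<noteq> r \<Longrightarrow> m b \<in> Inn"
    "\<And>b. b \<in> Out \<Longrightarrow> base b = b \<Longrightarrow> b \<noteq> r \<Longrightarrow> \<exists>u\<in>Out. P b = P u @ [m b, b]"
    "\<And>v. v \<in> Inn \<Longrightarrow> m v \<in> Out" "\<And>v. v \<in> Inn \<Longrightarrow> base (m v) = m v"
  shows "search m r Out Inn base P"
  unfolding search_def using assms by (intro conjI ballI impI) (assumption | blast)+

lemma searchD:
  assumes "search m r Out Inn base P"
  shows "mating m" "m r = r" "r \<in> Out" "base r = r" "P r = [r]" "Out \<union> Inn \<subseteq> {..<n}" "Out \<inter> Inn = {}"
    "\<And>v. v \<in> Out \<Longrightarrow> base v \<in> Out" "\<And>v. v \<in> Out \<Longrightarrow> base (base v) = base v"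
    "\<And>v. v \<in> Out \<Longrightarrow> altpath m r (P v)" "\<And>v. v \<in> Out \<Longrightarrow> last (P v) = v"
    "\<And>v. v \<in> Out \<Longrightarrow> \<exists>Q. P v = P (base v) @ Q \<and> (\<forall>q\<in>set Q. q \<in> Out \<and> base q = base v)"
    "\<And>v. v \<in> Out \<Longrightarrow> base v \<noteq> v \<Longrightarrow> m v \<in> Out"
    "\<And>v. v \<in> Out \<Longrightarrow> base v \<noteq> v \<Longrightarrow> base (m v) = base v"
    "\<And>b. b \<in> Out \<Longrightarrow> base b = b \<Longrightarrow> b \<noteq> r \<Longrightarrow> m b \<in> Inn"
    "\<And>b. b \<in> Out \<Longrightarrow> base b = b \<Longrightarrow> b \<noteq> r \<Longrightarrow> \<exists>u\<in>Out. P b = P u @ [m b, b]"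
    "\<And>v. v \<in> Inn \<Longrightarrow> m v \<in> Out" "\<And>v. v \<in> Inn \<Longrightarrow> base (m v) = m v"
  using assms unfolding search_def by blast+

lemma search_nonempty:
  assumes "search m r Out Inn base P" "v \<in> Out"
  shows "P v \<noteq> []" "length (P v) > 0"
  using searchD(10)[OF assms] by (auto simp: altpath_def)

lemma matingD:
  assumes "mating m" "v < n"
  shows "m v < n" "m (m v) = v" "m v \<noteq> v \<Longrightarrow> adj v (m v)"
  using assms by (auto simp: mating_def)

section \<open>How a stored path runs through blossoms and inner vertices\<close>

text \<open>Induction on the length: the path of a vertex extends that of its base inside one
  blossom, and the path of a base other than \<open>r\<close> extends an earlier path by its mate
  and itself. Hence a position is either inner, at an odd index and followed by its mate, or lies in
  a blossom that the path entered at the base and has not left since. The two prefix equations are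
  the means of comparing two stored paths later.\<close>

lemma path_structure:
  assumes S: "search m r Out Inn base P"
  shows "v \<in> Out \<Longrightarrow> k < length (P v) \<Longrightarrow>
    (P v ! k \<in> Out \<and> (\<exists>l\<le>k. P (base (P v ! k)) = take (Suc l) (P v) \<and>
       (\<forall>q. l \<le> q \<longrightarrow> q \<le> k \<longrightarrow> P v ! q \<in> Out \<and> base (P v ! q) = base (P v ! k)))) \<or>
    (P v ! k \<in> Inn \<and> odd k \<and> Suc k < length (P v) \<and> P (m (P v ! k)) = take (k + 2) (P v))"
proof (induction "length (P v)" arbitrary: v k rule: less_induct)
  case less
  note D = searchD[OF S]
  \<comment> \<open>Both alternatives concern only an initial segment, so they pass from a stored
    path that is a proper prefix to \<open>P v\<close> itself.\<close>
  have lift: ?case if w: "w \<in> Out" "k < length (P w)" "P v = P w @ Q" "Q \<noteq> []" for w Q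
  proof -
    have lt: "length (P w) < length (P v)" using w by simp
    have eq: "q \<le> k \<Longrightarrow> P v ! q = P w ! q" for q using w by (simp add: nth_append)
    have tk: "q < length (P w) \<Longrightarrow> take (Suc q) (P v) = take (Suc q) (P w)" for q using w by simp
    from less.hyps[OF lt w(1,2)] show ?thesis
    proof
      assume "P w ! k \<in> Out \<and> (\<exists>l\<le>k. P (base (P w ! k)) = take (Suc l) (P w) \<and>
       (\<forall>q. l \<le> q \<longrightarrow> q \<le> k \<longrightarrow> P w ! q \<in> Out \<and> base (P w ! q) = base (P w ! k)))"
      then show ?thesis using eq tk w(2) by (metis le_eq_less_or_eq order.strict_trans2)
    next
      assume "P w ! k \<in> Inn \<and> odd k \<and> Suc k < length (P w) \<and> P (m (P w ! k)) = take (k + 2) (P w)"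
      then show ?thesis using eq[of k] tk[of "Suc k"] w(3) by auto
    qed
  qed
  show ?case
  proof (cases "base v = v")
    case False
    let ?b = "base v"
    obtain Q where Q: "P v = P ?b @ Q" "\<And>q. q \<in> set Q \<Longrightarrow> q \<in> Out \<and> base q = ?b"
      using D(12)[OF less.prems(1)] by blast
    have b: "?b \<in> Out" "base ?b = ?b" using D(8,9) less.prems(1) by auto
    have "Q \<noteq> []" using D(11)[OF b(1)] D(11)[OF less.prems(1)] Q(1) False by (metis append_Nil2)
    show ?thesis
    proof (cases "k < length (P ?b)")
      case True then show ?thesis using lift b Q \<open>Q \<noteq> []\<close> by blast
    next
      case k: False
      let ?l = "length (P ?b) - 1"
      have ne: "length (P ?b) > 0" using search_nonempty[OF S b(1)] by simp
      have at: "P v ! q \<in> Out \<and> base (P v ! q) = ?b" if "?l \<le> q" "q \<le> k" for q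
      proof (cases "q < length (P ?b)")
        case True
        then have "q = ?l" using that by simp
        then have "P v ! q = last (P ?b)" using Q(1) True ne by (simp add: nth_append last_conv_nth)
        then show ?thesis using D(11) b by simp
      next
        case False
        then have "P v ! q \<in> set Q" using Q(1) that less.prems(2) by (simp add: nth_append)
        then show ?thesis using Q(2) by blast
      qed
      have "?l \<le> k" using k by simp
      moreover have "P ?b = take (Suc ?l) (P v)" using ne Q(1) by simp
      ultimately show ?thesis using at[of k] at by auto
    qed
  next
    case base: True
    show ?thesis
    proof (cases "v = r")
      case True then show ?thesis using D(3,4,5) less.prems by auto
    next
      case False
      obtain u where u: "u \<in> Out" "P v = P u @ [m v, v]" using D(16)[OF less.prems(1) base False] by blast
      have mi: "m v \<in> Inn" using D(15)[OF less.prems(1) base False] .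
      have mm: "m (m v) = v" using D(1,6) less.prems(1) matingD by blast
      have od: "odd (length (P u))" using D(10)[OF u(1)] by (simp add: altpath_def)
      consider "k < length (P u)" | "k = length (P u)" | "k = Suc (length (P u))"
        using u(2) less.prems(2) by fastforce
      then show ?thesis
      proof cases
        case 1 then show ?thesis using lift u by blast
      next
        case 2
        then have "P v ! k = m v" using u(2) by simp
        then show ?thesis using 2 mi mm od u(2) by simp
      next
        case 3
        then have v: "P v ! k = v" using u(2) by (simp add: nth_append)
        show ?thesis using 3 v base less.prems u(2) by (intro disjI1 conjI exI[of _ k]) (auto simp: le_antisym)
      qed
    qed
  qed
qed

lemma path_outer:
  assumes "search m r Out Inn base P" "v \<in> Out" "k < length (P v)" "P v ! k = y" "y \<in> Out"
  obtains l where "l \<le> k" "P (base y) = take (Suc l) (P v)"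
    "\<And>q. l \<le> q \<Longrightarrow> q \<le> k \<Longrightarrow> P v ! q \<in> Out" "\<And>q. l \<le> q \<Longrightarrow> q \<le> k \<Longrightarrow> base (P v ! q) = base y"
proof -
  have "y \<notin> Inn" using searchD(7)[OF assms(1)] assms(5) by blast
  then obtain l where l: "l \<le> k \<and> P (base y) = take (Suc l) (P v) \<and>
       (\<forall>q. l \<le> q \<longrightarrow> q \<le> k \<longrightarrow> P v ! q \<in> Out \<and> base (P v ! q) = base y)"
    using path_structure[OF assms(1-3), unfolded assms(4)] by (elim disjE conjE exE) (simp_all only: conj_ac, simp)
  then show ?thesis using that[of l] by simp
qed

lemma path_inner:
  assumes "search m r Out Inn base P" "v \<in> Out" "k < length (P v)" "P v ! k = y" "y \<notin> Out"
  shows "y \<in> Inn" "odd k" "Suc k < length (P v)" "P (m y) = take (Suc (Suc k)) (P v)"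
  using path_structure[OF assms(1-3)] assms(5) unfolding assms(4) by auto

text \<open>By \<open>path_outer\<close> the path of the base is some prefix; that prefix ends in
  the base, and a simple path visits the base only at index \<open>k\<close>.\<close>

lemma path_base_prefix:
  assumes S: "search m r Out Inn base P" and "v \<in> Out" "k < length (P v)" "P v ! k \<in> Out" "base (P v ! k) = P v ! k"
  shows "P (P v ! k) = take (Suc k) (P v)"
proof -
  note D = searchD[OF S]
  obtain l where l: "l \<le> k" "P (base (P v ! k)) = take (Suc l) (P v)"
    by (rule path_outer[OF S assms(2,3) refl assms(4)])
  note l = l(1) l(2)[unfolded assms(5)]
  have "last (P (P v ! k)) = P v ! k" using D(11) assms by blast
  then have "P v ! l = P v ! k" using l assms(3) by (simp add: take_Suc_conv_app_nth)
  moreover have "distinct (P v)" using D(10)[OF assms(2)] by (simp add: altpath_def)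
  ultimately have "l = k" using l(1) assms(3) nth_eq_iff_index_eq by fastforce
  then show ?thesis using l by simp
qed

lemma path_subset:
  assumes "search m r Out Inn base P" "v \<in> Out"
  shows "set (P v) \<subseteq> Out \<union> Inn"
proof
  fix x assume "x \<in> set (P v)"
  then obtain k where "k < length (P v)" "x = P v ! k" by (metis in_set_conv_nth)
  then show "x \<in> Out \<union> Inn" using path_structure[OF assms, of k] by blast
qed

lemma visited_mate:
  assumes "search m r Out Inn base P" "v \<in> Out \<union> Inn"
  shows "m v \<in> Out \<union> Inn"
  using searchD[OF assms(1)] assms(2) by (metis UnE UnI1 UnI2)

lemma search_init:
  assumes "mating m" "m r = r" "r < n" "base r = r" "P r = [r]"
  shows "search m r {r} {} base P"
  using assms by (auto simp: search_def altpath_def)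

lemma altpath_extend:
  assumes "altpath m r p" "adj (last p) w" "w \<notin> set p" "m w \<notin> set p" "mating m" "m w \<noteq> w"
  shows "altpath m r (p @ [w, m w])"
proof -
  have w: "w < n" "m w < n" "adj w (m w)" using assms matingD adjD by blast+
  have ne: "p \<noteq> []" using assms(1) by (auto simp: altpath_def)
  have "adj ((p @ [w, m w]) ! i) ((p @ [w, m w]) ! Suc i)" if i: "Suc i < length (p @ [w, m w])" for i
  proof -
    consider "Suc i < length p" | "Suc i = length p" | "i = length p" using i by fastforce
    then show ?thesis
    proof cases
      case 1 then show ?thesis using assms(1) by (simp add: altpath_def nth_append)
    next
      case 2 then have "i = length p - 1" by simp
      then show ?thesis using 2 assms(2) ne by (simp add: nth_append last_conv_nth)
    next
      case 3 then show ?thesis using w by (simp add: nth_append)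
    qed
  qed
  moreover have "m ((p @ [w, m w]) ! i) = (p @ [w, m w]) ! Suc i" if i: "odd i" "Suc i < length (p @ [w, m w])" for i
  proof -
    have "Suc i \<noteq> length p" using i(1) assms(1) unfolding altpath_def by (metis even_Suc)
    then consider "Suc i < length p" | "i = length p" using i by fastforce
    then show ?thesis
      using i assms(1) by cases (auto simp: altpath_def nth_append)
  qed
  ultimately show ?thesis using assms ne w by (auto simp: altpath_def nth_append)
qed

text \<open>The visited set is closed under \<open>m\<close>, so the mate of an unvisited vertex is
  unvisited and the extended path stays simple. \<open>base'\<close> and \<open>P'\<close> are
  constrained on the new outer set only, because the arrays that implement them hold arbitrary old
  values elsewhere.\<close>

lemma search_grow:
  assumes S: "search m r Out Inn base P" and u: "u \<in> Out" "adj u w" and w: "w \<notin> Out \<union> Inn" "m w \<noteq> w"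
    and base': "\<And>y. y \<in> Out \<Longrightarrow> base' y = base y" "base' (m w) = m w"
    and P': "\<And>y. y \<in> Out \<Longrightarrow> P' y = P y" "P' (m w) = P u @ [w, m w]"
  shows "search m r (insert (m w) Out) (insert w Inn) base' P'"
proof -
  note D = searchD[OF S]
  have wn: "w < n" using u adjD by blast
  have mm: "m (m w) = w" "m w < n" using wn D(1) matingD by blast+
  have mw: "m w \<notin> Out \<union> Inn" using visited_mate[OF S, of "m w"] mm w by auto
  have path: "altpath m r (P u @ [w, m w])"
    using altpath_extend[OF D(10)[OF u(1)]] D(11)[OF u(1)] u(2) path_subset[OF S u(1)] w mw D(1)
    by (metis subsetD)
  have Q: "\<exists>Q. P' v = P' (base' v) @ Q \<and> (\<forall>q\<in>set Q. q \<in> insert (m w) Out \<and> base' q = base' v)"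
    if v: "v \<in> Out" for v
  proof -
    obtain Q where Q: "P v = P (base v) @ Q" "\<And>q. q \<in> set Q \<Longrightarrow> q \<in> Out \<and> base q = base v"
      using D(12)[OF v] by blast
    then show ?thesis using v base' P' D(8) by auto
  qed
  show ?thesis
  proof (rule searchI)
    show "\<exists>Q. P' v = P' (base' v) @ Q \<and> (\<forall>q\<in>set Q. q \<in> insert (m w) Out \<and> base' q = base' v)"
      if "v \<in> insert (m w) Out" for v using that Q base' by auto
    show "m b \<in> insert w Inn" if b: "b \<in> insert (m w) Out" "base' b = b" "b \<noteq> r" for b
      using b mm(1) D(15)[of b] base'(1)[of b] by auto
    show "\<exists>u\<in>insert (m w) Out. P' b = P' u @ [m b, b]"
      if b: "b \<in> insert (m w) Out" "base' b = b" "b \<noteq> r" for b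
    proof (cases "b = m w")
      case True then show ?thesis using u P' mm by auto
    next
      case False
      then obtain u where "u \<in> Out" "P b = P u @ [m b, b]" using D(16)[of b] b base'(1)[of b] by auto
      then show ?thesis using False b P' by auto
    qed
    show "base' v \<in> insert (m w) Out" "base' (base' v) = base' v"
      "altpath m r (P' v)" "last (P' v) = v" if "v \<in> insert (m w) Out" for v
      using that base' P' D(8)[of v] D(9)[of v] D(10)[of v] D(11)[of v] path by auto
    show "m v \<in> insert (m w) Out" "base' (m v) = base' v"
      if "v \<in> insert (m w) Out" "base' v \<noteq> v" for v
      using that base'(1)[of v] base'(1)[of "m v"] base'(2) D(13)[of v] D(14)[of v] by auto
    show "m v \<in> insert (m w) Out" "base' (m v) = m v" if "v \<in> insert w Inn" for v
      using that base'(1)[of "m v"] base'(2) D(17)[of v] D(18)[of v] by auto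
    show "insert (m w) Out \<inter> insert w Inn = {}" using D(7) w mw by auto
    show "insert (m w) Out \<union> insert w Inn \<subseteq> {..<n}" using D(6) mm wn by auto
  qed (use D(1-5) base' P' in auto)
qed


section \<open>The graph theory of a contraction\<close>

text \<open>Walking \<open>q\<close> backwards to an odd position \<open>j\<close> ends with the
  matching edge between positions \<open>j + 1\<close> and \<open>j\<close>. So a vertex at an odd
  position of \<open>q\<close> becomes the end of an alternating path of even length that goes round
  the other side.\<close>

lemma altpath_join:
  assumes p: "altpath m r p" and q: "altpath m r q" and m: "mating m" and e: "adj (last p) (last q)"
    and j: "odd j" "j < length q" and dis: "set p \<inter> set (drop j q) = {}"
  shows "altpath m r (p @ rev (drop j q))"
proof -
  let ?d = "rev (drop j q)" and ?L = "length q"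
  have op: "odd (length p)" "p \<noteq> []" and oq: "odd ?L" "q \<noteq> []" using p q by (auto simp: altpath_def)
  have len: "length ?d = ?L - j" by simp
  have nd: "?d ! a = q ! (?L - Suc a)" if "a < ?L - j" for a
    using that by (simp add: rev_nth)
  have "adj ((p @ ?d) ! a) ((p @ ?d) ! Suc a)" if a: "Suc a < length (p @ ?d)" for a
  proof -
    consider "Suc a < length p" | "Suc a = length p" | "length p \<le> a" by linarith
    then show ?thesis
    proof cases
      case 1 then show ?thesis using p by (simp add: altpath_def nth_append)
    next
      case 2
      then have "a = length p - 1" by simp
      then have "p ! a = last p" using op by (simp add: last_conv_nth)
      moreover have "?d ! 0 = last q" using nd[of 0] j oq by (simp add: last_conv_nth)
      ultimately show ?thesis using 2 e by (simp add: nth_append)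
    next
      case 3
      define c where "c = a - length p"
      have c: "Suc c < ?L - j" "a = length p + c" using 3 a len by (auto simp: c_def)
      have "adj (q ! (?L - Suc (Suc c))) (q ! Suc (?L - Suc (Suc c)))"
        using q c by (simp add: altpath_def)
      moreover have "Suc (?L - Suc (Suc c)) = ?L - Suc c" using c by simp
      ultimately have "adj (?d ! c) (?d ! Suc c)" using nd[of c] nd[of "Suc c"] c adj_commute by simp
      then show ?thesis using c by (simp add: nth_append)
    qed
  qed
  moreover have "m ((p @ ?d) ! a) = (p @ ?d) ! Suc a" if a: "odd a" "Suc a < length (p @ ?d)" for a
  proof -
    have "Suc a \<noteq> length p" using a(1) op by (metis even_Suc)
    then consider "Suc a < length p" | "length p \<le> a" by linarith
    then show ?thesis
    proof cases
      case 1 then show ?thesis using p a by (simp add: altpath_def nth_append)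
    next
      case 2
      define c where "c = a - length p"
      have c: "Suc c < ?L - j" "a = length p + c" using 2 a len by (auto simp: c_def)
      let ?k = "?L - Suc (Suc c)"
      \<comment> \<open>The length of \<open>p\<close> is odd, so an odd index of the joined list is
        an even offset into the reversed part; since \<open>q\<close> has odd length too, it meets a
        matching edge of \<open>q\<close> read backwards.\<close>
      have "even c" using c(2) a(1) op(1) by simp
      then have "odd ?k" using oq c(1) by simp
      moreover have k: "Suc ?k = ?L - Suc c" using c by simp
      ultimately have "m (q ! ?k) = q ! Suc ?k" using q c by (simp add: altpath_def)
      moreover have "q ! ?k < n" using q c unfolding altpath_def
        by (metis Suc_lessD diff_less less_le_trans lessThan_iff nth_mem oq(2) length_greater_0_conv subsetD zero_less_Suc)
      ultimately have "m (q ! Suc ?k) = q ! ?k" using m matingD(2) by metis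
      then have "m (?d ! c) = ?d ! Suc c" using nd[of c] nd[of "Suc c"] c k by simp
      then show ?thesis using c by (simp add: nth_append)
    qed
  qed
  moreover have "odd (length (p @ ?d))" using op oq j by simp
  moreover have "distinct (p @ ?d)" using p q dis by (auto simp: altpath_def)
  moreover have "set (p @ ?d) \<subseteq> {..<n}" using p q set_drop_subset[of j q] by (auto simp: altpath_def)
  moreover have "(p @ ?d) ! 0 = r" using p op by (simp add: altpath_def nth_append)
  ultimately show ?thesis by (simp add: altpath_def)
qed

lemma in_drop_iff: "x \<in> set (drop i xs) \<longleftrightarrow> (\<exists>k. i \<le> k \<and> k < length xs \<and> x = xs ! k)"
proof
  assume "x \<in> set (drop i xs)"
  then obtain a where "a < length (drop i xs)" "x = drop i xs ! a" by (metis in_set_conv_nth)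
  then show "\<exists>k. i \<le> k \<and> k < length xs \<and> x = xs ! k" by (intro exI[of _ "i + a"]) auto
next
  assume "\<exists>k. i \<le> k \<and> k < length xs \<and> x = xs ! k"
  then obtain k where k: "i \<le> k" "k < length xs" "x = xs ! k" by blast
  then have "x = drop i xs ! (k - i)" "k - i < length (drop i xs)" by auto
  then show "x \<in> set (drop i xs)" by (metis nth_mem)
qed

lemma path_prefix_member:
  assumes S: "search m r Out Inn base P" and c: "c \<in> Out" "P c = take (Suc k) (P w)" "k < length (P w)"
  shows "c = P w ! k"
proof -
  have "last (P c) = c" using searchD(11)[OF S c(1)] .
  then show ?thesis using c by (simp add: take_Suc_conv_app_nth)
qed

section \<open>The tail of a stored path behind a base \<open>b\<close>\<close>

context
  fixes m r Out Inn base P b w i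
  assumes S: "search m r Out Inn base P"
    and b: "b \<in> Out" "base b = b" and w: "w \<in> Out" and i: "i < length (P w)" "P b = take (Suc i) (P w)"
begin

lemma tail_start: "P w ! i = b"
  using path_prefix_member[OF S b(1) i(2,1)] by simp

text \<open>If the base of \<open>q\<close> came no later than \<open>b\<close> on the path, the
  stretch from it to \<open>q\<close>, which stays in one class, would pass through
  \<open>b\<close>; as \<open>b\<close> is its own base, the base of \<open>q\<close> is then
  \<open>b\<close>.\<close>

lemma tail_base:
  assumes "q \<in> set (drop i (P w))" "q \<in> Out"
  shows "base q \<in> set (drop i (P w))"
proof -
  obtain k where k: "i \<le> k" "k < length (P w)" "q = P w ! k" using assms(1) by (auto simp: in_drop_iff)
  obtain l where l: "l \<le> k" "P (base q) = take (Suc l) (P w)"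
    "\<And>a. l \<le> a \<Longrightarrow> a \<le> k \<Longrightarrow> base (P w ! a) = base q"
    by (rule path_outer[OF S w k(2) k(3)[symmetric] assms(2)]) blast
  show ?thesis
  proof (cases "l \<le> i")
    case True
    then have "base q = b" using l(3)[of i] k tail_start b by simp
    then show ?thesis using tail_start i by (auto simp: in_drop_iff)
  next
    case False
    have "base q = P w ! l" using path_prefix_member[OF S _ l(2)] l(1) k searchD(8)[OF S assms(2)] by simp
    then show ?thesis using False l(1) k by (auto simp: in_drop_iff intro!: exI[of _ l])
  qed
qed

text \<open>A base beyond \<open>b\<close> is not the start of the path, and its own path, a prefix,
  ends with its mate and itself. So the mate sits one position earlier, which is still in the
  tail.\<close>

lemma tail_base_mate:
  assumes c: "c \<in> Out" "base c = c" "c \<in> set (drop i (P w))" "c \<noteq> b"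
  shows "c \<noteq> r" "m c \<in> Inn" "m c \<in> set (drop i (P w))"
proof -
  obtain k where k: "i \<le> k" "k < length (P w)" "c = P w ! k" using c by (auto simp: in_drop_iff)
  have ik: "i < k" using k c(4) tail_start by (cases "i = k") auto
  have "P w ! 0 = r" "distinct (P w)" using searchD(10)[OF S w] by (auto simp: altpath_def)
  then show cr: "c \<noteq> r" using ik k by (metis gr_implies_not0 length_greater_0_conv list.size(3) nth_eq_iff_index_eq)
  show "m c \<in> Inn" using searchD(15)[OF S c(1,2) cr] .
  obtain u where u: "P c = P u @ [m c, c]" using searchD(16)[OF S c(1,2) cr] by blast
  have Pc: "P c = take (Suc k) (P w)" using path_base_prefix[OF S w k(2)] c k by simp
  then have "length (P c) = Suc k" using k by simp
  then have "k - 1 = length (P u)" "0 < k" using u by auto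
  then have "P c ! (k - 1) = m c" using u by simp
  then have "m c = P w ! (k - 1)" using Pc \<open>0 < k\<close> by simp
  then show "m c \<in> set (drop i (P w))" using ik k by (auto simp: in_drop_iff intro!: exI[of _ "k - 1"])
qed

lemma tail_inner_mate:
  assumes y: "y \<in> Inn" "y \<in> set (drop i (P w))"
  shows "m y \<in> set (drop i (P w))" "m y \<noteq> b"
proof -
  obtain k where k: "i \<le> k" "k < length (P w)" "y = P w ! k" using y by (auto simp: in_drop_iff)
  have "y \<notin> Out" using y(1) searchD(7)[OF S] by blast
  then have P: "Suc k < length (P w)" "P (m y) = take (Suc (Suc k)) (P w)"
    using path_inner[OF S w k(2) k(3)[symmetric]] by blast+
  then have my: "m y = P w ! Suc k" using path_prefix_member[OF S searchD(17)[OF S y(1)]] by blast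
  then show "m y \<in> set (drop i (P w))" using k P(1) by (auto simp: in_drop_iff intro!: exI[of _ "Suc k"])
  have "distinct (P w)" using searchD(10)[OF S w] by (auto simp: altpath_def)
  then have "P w ! Suc k \<noteq> P w ! i" using k P(1) i by (simp add: nth_eq_iff_index_eq)
  then show "m y \<noteq> b" using my tail_start by simp
qed

lemma tail_path:
  assumes c: "c \<in> Out" "base c = c" "c \<in> set (drop i (P w))"
  shows "\<exists>R. P c = P b @ R \<and> set R \<subseteq> set (drop i (P w))"
proof -
  obtain k where k: "i \<le> k" "k < length (P w)" "c = P w ! k" using c by (auto simp: in_drop_iff)
  have "P c = take (Suc k) (P w)" using path_base_prefix[OF S w k(2)] c k by simp
  also have "\<dots> = take (Suc i) (P w) @ take (k - i) (drop (Suc i) (P w))"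
    using k take_add[of "Suc i" "k - i" "P w"] by simp
  finally show ?thesis using i(2) set_take_subset set_drop_subset_set_drop[of i "Suc i" "P w"]
    by (metis (no_types, lifting) le_SucI order.trans order_refl)
qed

text \<open>If \<open>w\<close> is outside the class of \<open>b\<close>, its base is a further base
  in the tail, and the mate of that base is inner.\<close>

lemma tail_inner_exists:
  assumes "base w \<noteq> b"
  shows "\<exists>x\<in>Inn. x \<in> set (drop i (P w))"
proof -
  have ne: "length (P w) > 0" using i(1) by linarith
  have lastw: "P w ! (length (P w) - 1) = w" using searchD(11)[OF S w] ne last_conv_nth[of "P w"] by force
  have "w \<in> set (drop i (P w))" using lastw i by (auto simp: in_drop_iff intro!: exI[of _ "length (P w) - 1"])
  then have "base w \<in> set (drop i (P w))" using tail_base w by blast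
  then show ?thesis using tail_base_mate[of "base w"] searchD(8,9)[OF S w] assms by blast
qed

end

text \<open>A vertex common to \<open>P v\<close> and to \<open>P u\<close> from \<open>j\<close> on
  would yield a common base: its own base if it is outer, its mate if it is inner. By
  \<open>max\<close> this base lies at position \<open>i\<close> or earlier. An inner vertex has its
  mate behind it, which is too late; an outer one would have the inner position \<open>j\<close>
  inside its blossom.\<close>

lemma contract_disjoint:
  assumes S: "search m r Out Inn base P"
    and uv: "u \<in> Out" "v \<in> Out" and j: "i < j" "j < length (P u)" "P u ! j \<in> Inn"
    and max: "\<And>y. y \<in> Out \<Longrightarrow> base y = y \<Longrightarrow> y \<in> set (P u) \<Longrightarrow> y \<in> set (P v) \<Longrightarrow> length (P y) \<le> Suc i"
  shows "set (P v) \<inter> set (drop j (P u)) = {}" "odd j"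
proof -
  note D = searchD[OF S]
  have jo: "P u ! j \<notin> Out" using j D(7) by blast
  then show "odd j" using path_structure[OF S uv(1) j(2)] by blast
  have "False" if yv: "y \<in> set (P v)" and yu: "y \<in> set (drop j (P u))" for y
  proof -
    obtain k where k: "j \<le> k" "k < length (P u)" "y = P u ! k" using yu by (auto simp: in_drop_iff)
    obtain k' where k': "k' < length (P v)" "y = P v ! k'" using yv by (metis in_set_conv_nth)
    show False
    proof (cases "y \<in> Out")
      case True
      then have y: "y \<notin> Inn" "base y \<in> Out" "base (base y) = base y" using D(7,8,9) by auto
      obtain l where l: "l \<le> k" "P (base y) = take (Suc l) (P u)"
        "\<And>a. l \<le> a \<Longrightarrow> a \<le> k \<Longrightarrow> P u ! a \<in> Out"
        by (rule path_outer[OF S uv(1) k(2) k(3)[symmetric] True]) blast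
      obtain l' where l': "l' \<le> k'" "P (base y) = take (Suc l') (P v)"
        by (rule path_outer[OF S uv(2) k'(1) k'(2)[symmetric] True])
      have "base y = P u ! l" "base y = P v ! l'"
        using path_prefix_member[OF S y(2) l(2)] path_prefix_member[OF S y(2) l'(2)] l(1) l'(1) k k' by auto
      then have "base y \<in> set (P u)" "base y \<in> set (P v)" using l(1) l'(1) k k' by (metis le_less_trans nth_mem)+
      then have "length (P (base y)) \<le> Suc i" using max y by blast
      then have "l \<le> i" using l(1,2) k by simp
      \<comment> \<open>Position \<open>j\<close> lies between the entry \<open>l\<close> into the
        blossom and \<open>k\<close>, so it would be outer.\<close>
      then show False using l(3)[of j] j(1) k(1) jo by simp
    next
      case False
      then have "y \<in> Inn" using path_subset[OF S uv(2)] yv by blast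
      then have c: "m y \<in> Out" "base (m y) = m y" using D(17,18) by auto
      have p: "Suc k < length (P u)" "P (m y) = take (Suc (Suc k)) (P u)"
        "Suc k' < length (P v)" "P (m y) = take (Suc (Suc k')) (P v)"
        using path_inner[OF S uv(1) k(2) k(3)[symmetric] False]
          path_inner[OF S uv(2) k'(1) k'(2)[symmetric] False] by blast+
      then have "m y = P u ! Suc k" "m y = P v ! Suc k'" using path_prefix_member[OF S c(1)] by blast+
      then have "length (P (m y)) \<le> Suc i" using max c p(1,3) by (metis nth_mem)
      then show False using p(1,2) k(1) j(1) by simp
    qed
  qed
  then show "set (P v) \<inter> set (drop j (P u)) = {}" by blast
qed

text \<open>\<open>b\<close> is the last base common to both paths and \<open>H\<close> consists of
  the two tails from \<open>b\<close> on. Whole classes are merged, including outer vertices off the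
  two paths, which is why \<open>base'\<close> tests the old base for membership in
  \<open>H\<close>. An inner vertex of a tail receives the path along the opposite side of the edge
  and back down its own side; it enters the new class at \<open>b\<close> because \<open>P b\<close>
  is a prefix of both paths.\<close>

lemma search_contract:
  assumes S: "search m r Out Inn base P"
    and uv: "u \<in> Out" "v \<in> Out" "adj u v"
    and b: "b \<in> Out" "base b = b"
    and iu: "i < length (P u)" "P b = take (Suc i) (P u)"
    and iv: "i < length (P v)" "P b = take (Suc i) (P v)"
    and max: "\<And>y. y \<in> Out \<Longrightarrow> base y = y \<Longrightarrow> y \<in> set (P u) \<Longrightarrow> y \<in> set (P v) \<Longrightarrow> length (P y) \<le> Suc i"
    and H: "H = set (drop i (P u)) \<union> set (drop i (P v))"
    and base': "\<And>y. y \<in> Out \<union> Inn \<inter> H \<Longrightarrow> base' y = (if y \<in> Inn \<or> base y \<in> H then b else base y)"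
    and P': "\<And>y. y \<in> Out \<Longrightarrow> P' y = P y"
      "\<And>j. i < j \<Longrightarrow> j < length (P u) \<Longrightarrow> P u ! j \<in> Inn \<Longrightarrow> P' (P u ! j) = P v @ rev (drop j (P u))"
      "\<And>j. i < j \<Longrightarrow> j < length (P v) \<Longrightarrow> P v ! j \<in> Inn \<Longrightarrow> P' (P v ! j) = P u @ rev (drop j (P v))"
  shows "search m r (Out \<union> Inn \<inter> H) (Inn - H) base' P'"
proof -
  note D = searchD[OF S]
  let ?O = "Out \<union> Inn \<inter> H"
  note disj = contract_disjoint[OF S]
  have max': "\<And>y. y \<in> Out \<Longrightarrow> base y = y \<Longrightarrow> y \<in> set (P v) \<Longrightarrow> y \<in> set (P u) \<Longrightarrow> length (P y) \<le> Suc i"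
    using max by blast
  have bH: "b \<in> H" using tail_start[OF S b uv(1) iu] iu(1) H by (auto simp: in_drop_iff)
  have "P u ! i = b" "P v ! i = b" using tail_start[OF S b _ iu] tail_start[OF S b _ iv] uv by auto
  have bI: "b \<notin> Inn" using b D(7) by blast
  have Hsub: "H \<subseteq> Out \<union> Inn"
    using path_subset[OF S uv(1)] path_subset[OF S uv(2)] set_drop_subset H by (metis Un_least subset_trans)
  have Hbase: "base q \<in> H" if "q \<in> H" "q \<in> Out" for q
    using that tail_base[OF S b uv(1) iu] tail_base[OF S b uv(2) iv] unfolding H by blast
  have Hmate: "c \<noteq> r" "m c \<in> Inn" "m c \<in> H" if "c \<in> Out" "base c = c" "c \<in> H" "c \<noteq> b" for c
    using that tail_base_mate[OF S b uv(1) iu] tail_base_mate[OF S b uv(2) iv] unfolding H by blast+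
  have Hinner: "m y \<in> H" "m y \<noteq> b" if "y \<in> Inn" "y \<in> H" for y
    using that tail_inner_mate[OF S b uv(1) iu] tail_inner_mate[OF S b uv(2) iv] unfolding H by blast+
  have Hpath: "\<exists>R. P c = P b @ R \<and> set R \<subseteq> H" if "c \<in> Out" "base c = c" "c \<in> H" for c
    using that tail_path[OF S b uv(1) iu] tail_path[OF S b uv(2) iv] unfolding H by blast
  have HB: "q \<in> ?O" "base' q = b" if "q \<in> H" for q
    using that Hsub Hbase base' by auto
  have base'b: "base' b = b" using HB bH by blast
  have mm: "m (m v) = v" if "v \<in> Out \<union> Inn" for v using D(1,6) that matingD(2) by blast
  have new: "altpath m r (P' x)" "last (P' x) = x" "\<exists>Q. P' x = P b @ Q \<and> set Q \<subseteq> H"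
    if x: "x \<in> Inn" "x \<in> H" for x
  proof -
    \<comment> \<open>Stated for local \<open>u\<close> and \<open>v\<close> so that it serves both
      orientations of the joining edge.\<close>
    have gen: "altpath m r p" "last p = x" "\<exists>Q. p = P b @ Q \<and> set Q \<subseteq> H"
      if uv: "u \<in> Out" "v \<in> Out" "adj v u" and iv: "P b = take (Suc i) (P v)" "set (drop i (P u)) \<subseteq> H" "set (drop i (P v)) \<subseteq> H"
        and j: "i < j" "j < length (P u)" "P u ! j = x" 
        and max: "\<And>y. y \<in> Out \<Longrightarrow> base y = y \<Longrightarrow> y \<in> set (P u) \<Longrightarrow> y \<in> set (P v) \<Longrightarrow> length (P y) \<le> Suc i"
        and p: "p = P v @ rev (drop j (P u))" for u v j p
    proof -
      have xi: "P u ! j \<in> Inn" using j x by simp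
      note dj = disj[OF uv(1,2) j(1,2) xi max]
      show "altpath m r p" unfolding p
        by (rule altpath_join[OF D(10)[OF uv(2)] D(10)[OF uv(1)] D(1) _ dj(2) j(2) dj(1)])
          (use D(11) uv in simp)
      show "last p = x" unfolding p using j by (simp add: last_rev hd_drop_conv_nth)
      have "p = take (Suc i) (P v) @ (drop (Suc i) (P v) @ rev (drop j (P u)))" using p by simp
      moreover have "set (drop (Suc i) (P v) @ rev (drop j (P u))) \<subseteq> H"
        using set_drop_subset_set_drop[of i "Suc i" "P v"] set_drop_subset_set_drop[of i j "P u"] j(1) iv(2,3) by auto
      ultimately show "\<exists>Q. p = P b @ Q \<and> set Q \<subseteq> H" using iv(1) by metis
    qed
    have xb: "x \<noteq> b" using x bI by blast
    have "(\<exists>j. i < j \<and> j < length (P u) \<and> P u ! j = x) \<or> (\<exists>j. i < j \<and> j < length (P v) \<and> P v ! j = x)"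
      using x(2) xb \<open>P u ! i = b\<close> \<open>P v ! i = b\<close> unfolding H by (auto simp: in_drop_iff) (metis le_eq_less_or_eq)+
    then have "altpath m r (P' x) \<and> last (P' x) = x \<and> (\<exists>Q. P' x = P b @ Q \<and> set Q \<subseteq> H)"
    proof
      assume "\<exists>j. i < j \<and> j < length (P u) \<and> P u ! j = x"
      then obtain j where j: "i < j" "j < length (P u)" "P u ! j = x" by blast
      have vu: "adj v u" using uv adj_commute by blast
      have sub: "set (drop i (P u)) \<subseteq> H" "set (drop i (P v)) \<subseteq> H" using H by auto
      have "P' x = P v @ rev (drop j (P u))" using P'(2) j x by blast
      from gen[OF uv(1,2) vu iv(2) sub j max this] show ?thesis by blast
    next
      assume "\<exists>j. i < j \<and> j < length (P v) \<and> P v ! j = x"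
      then obtain j where j: "i < j" "j < length (P v)" "P v ! j = x" by blast
      have sub: "set (drop i (P u)) \<subseteq> H" "set (drop i (P v)) \<subseteq> H" using H by auto
      have "P' x = P u @ rev (drop j (P v))" using P'(3) j x by blast
      from gen[OF uv(2,1,3) iu(2) sub(2,1) j max' this] show ?thesis by blast
    qed
    then show "altpath m r (P' x)" "last (P' x) = x" "\<exists>Q. P' x = P b @ Q \<and> set Q \<subseteq> H" by blast+
  qed
  show ?thesis
  proof (rule searchI)
    show "base' r = r" using D(3,4) Hmate(1)[of r] base'[of r] D(7) by auto
    show "P' r = [r]" using D(3,5) P'(1) by simp
    show "r \<in> ?O" using D(3) by blast
    show "?O \<union> (Inn - H) \<subseteq> {..<n}" "?O \<inter> (Inn - H) = {}" using D(6,7) by auto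
    show "base' v \<in> ?O" "base' (base' v) = base' v" if v: "v \<in> ?O" for v
    proof -
      have "base' v = b \<or> (v \<in> Out \<and> base' v = base v \<and> base v \<notin> H)" using v base'[OF v] D(7) by auto
      then show "base' v \<in> ?O" "base' (base' v) = base' v"
        using b base'b D(8)[of v] D(9)[of v] base'[of "base v"] D(7) by auto
    qed
    show "altpath m r (P' v)" "last (P' v) = v" if v: "v \<in> ?O" for v
      using v new D(10,11) P'(1) by auto
    show "\<exists>Q. P' v = P' (base' v) @ Q \<and> (\<forall>q\<in>set Q. q \<in> ?O \<and> base' q = base' v)" if v: "v \<in> ?O" for v
    proof (cases "v \<in> Out")
      case False
      then have "v \<in> Inn" "v \<in> H" using v by auto
      then show ?thesis using new(3)[of v] HB P'(1)[OF b(1)] by (metis subsetD)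
    next
      case True
      obtain Q where Q: "P v = P (base v) @ Q" "\<And>q. q \<in> set Q \<Longrightarrow> q \<in> Out \<and> base q = base v"
        using D(12)[OF True] by blast
      have vI: "v \<notin> Inn" "base v \<in> Out" "base (base v) = base v" using True D(7,8,9) by auto
      have QI: "q \<notin> Inn" if "q \<in> set Q" for q using that Q(2) D(7) by blast
      show ?thesis
      proof (cases "base v \<in> H")
        case False
        then have "base' v = base v" using base'[OF v] vI by simp
        then show ?thesis using Q False P'(1) True vI base' QI by (intro exI[of _ Q]) auto
      next
        case hb: True
        then have bv: "base' v = b" using base'[OF v] vI by simp
        obtain R where R: "P (base v) = P b @ R" "set R \<subseteq> H" using Hpath vI hb by blast
        show ?thesis unfolding bv
        proof (intro exI conjI ballI)
          show "P' v = P' b @ (R @ Q)" using Q R P'(1) True b by simp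
          fix q assume "q \<in> set (R @ Q)"
          then show "q \<in> ?O" "base' q = b" using R(2) HB Q(2) base'[of q] hb by auto
        qed
      qed
    qed
    \<comment> \<open>Outer vertices that are no bases after the contraction are of three kinds:
      former inner vertices, whose mate follows in the tail; former bases in \<open>H\<close> other
      than \<open>b\<close>, whose mate precedes them; and old non-bases, whose mate shares the old
      base.\<close>
    have mate: "m v \<in> ?O \<and> base' (m v) = base' v" if v: "v \<in> ?O" "base' v \<noteq> v" for v
    proof (cases "v \<in> Inn")
      case True
      then show ?thesis using v(1) Hinner(1)[of v] HB[of "m v"] HB[of v] D(7) by auto
    next
      case vI: False
      then have vO: "v \<in> Out" using v by blast
      show ?thesis
      proof (cases "base v = v")
        case True
        then have "v \<in> H" "v \<noteq> b" using v(2) base'[OF v(1)] vI by (auto split: if_splits)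
        then show ?thesis using Hmate(3)[OF vO True] HB by metis
      next
        case False
        then have "m v \<in> Out" "base (m v) = base v" using D(13,14) vO by auto
        then show ?thesis using base'[of "m v"] base'[OF v(1)] vI D(7) by auto
      qed
    qed
    show "m v \<in> ?O" "base' (m v) = base' v" if "v \<in> ?O" "base' v \<noteq> v" for v
      using mate[OF that] by auto
    fix c
    { assume c: "c \<in> ?O" "base' c = c" "c \<noteq> r"
      have cO: "c \<in> Out" using c HB(2)[of c] b(1) by auto
      then have cI: "c \<notin> Inn" using D(7) by blast
      have bc: "base c = c" using base'[OF c(1)] cI c(2) b by (auto split: if_splits)
      have cH: "c \<notin> H \<or> c = b" using base'[OF c(1)] cI c(2) bc by (auto split: if_splits)
      have mc: "m c \<in> Inn" using D(15)[OF cO bc c(3)] .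
      then show "m c \<in> Inn - H" using Hinner[of "m c"] mm[of c] cO cH by auto
      show "\<exists>u\<in>?O. P' c = P' u @ [m c, c]" using D(16)[OF cO bc c(3)] P'(1) cO by (metis UnI1) }
    { assume c: "c \<in> Inn - H"
      then have "m c \<in> Out" "base (m c) = m c" "m (m c) = c" using D(17,18) mm by auto
      \<comment> \<open>Only \<open>b\<close> can be a vertex of \<open>H\<close> matched to a
        remaining inner vertex: the mate of any other base in \<open>H\<close> is in
        \<open>H\<close> as well.\<close>
      moreover have "m c \<in> H \<Longrightarrow> m c = b" using Hmate(3)[of "m c"] calculation c by auto
      ultimately show "m c \<in> ?O" "base' (m c) = m c" using base'[of "m c"] D(7) by auto }
  qed (use D(1,2) in auto)
qed

text \<open>The ends of the joining edge lie in different classes, so at least one is outside the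
  class of \<open>b\<close>. Hence every contraction makes an inner vertex outer, which bounds the
  number of contractions.\<close>

lemma contract_inner_exists:
  assumes S: "search m r Out Inn base P"
    and uv: "u \<in> Out" "v \<in> Out" "base u \<noteq> base v"
    and b: "b \<in> Out" "base b = b"
    and iu: "i < length (P u)" "P b = take (Suc i) (P u)"
    and iv: "i < length (P v)" "P b = take (Suc i) (P v)"
  shows "\<exists>x\<in>Inn. x \<in> set (drop i (P u)) \<union> set (drop i (P v))"
  using tail_inner_exists[OF S b uv(1) iu] tail_inner_exists[OF S b uv(2) iv] uv(3) by fastforce

section \<open>Augmentation along a path to an exposed vertex\<close>

text \<open>Every even position of \<open>q\<close> is paired with its successor, which exchanges
  matching and other edges along \<open>q\<close>. The second conclusion says that no matched vertex
  becomes exposed again; this is why one search per root is enough.\<close>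

lemma augment:
  assumes m: "mating m" "m r = r" and p: "altpath m r p" and w: "adj (last p) w" "w \<notin> set p" "m w = w"
    and q: "q = p @ [w]"
    and m': "\<And>a. even a \<Longrightarrow> a < length p \<Longrightarrow> m' (q ! a) = q ! Suc a"
      "\<And>a. even a \<Longrightarrow> a < length p \<Longrightarrow> m' (q ! Suc a) = q ! a"
      "\<And>x. x \<notin> set q \<Longrightarrow> m' x = m x"
  shows "mating m'" "\<And>x. x < n \<Longrightarrow> m x \<noteq> x \<or> x = r \<Longrightarrow> m' x \<noteq> x"
proof -
  have op: "odd (length p)" "p \<noteq> []" "p ! 0 = r" "distinct p" "set p \<subseteq> {..<n}" using p by (auto simp: altpath_def)
  have adjq: "adj (q ! a) (q ! Suc a)" if "a < length p" for a
  proof (cases "Suc a < length p")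
    case True then show ?thesis using p q by (simp add: altpath_def nth_append)
  next
    case False
    then have "a = length p - 1" using that by simp
    then show ?thesis using w(1) q op(2) by (simp add: nth_append last_conv_nth)
  qed
  have on: "m' x < n \<and> m' (m' x) = x \<and> adj x (m' x)" if x: "x \<in> set q" for x
  proof -
    obtain c where c: "c < length q" "x = q ! c" using x by (metis in_set_conv_nth)
    have lq: "length q = Suc (length p)" using q by simp
    show ?thesis
    proof (cases "even c")
      case True
      then have "c \<noteq> length p" using op by blast
      then have "c < length p" using c lq by simp
      then show ?thesis using True m'(1,2) c(2) adjq[of c] adjD(2) by simp
    next
      case False
      then obtain a where a: "c = Suc a" "even a" by (metis even_Suc odd_pos Suc_pred)
      then have "a < length p" using c lq by simp
      then show ?thesis using a m'(1,2) c(2) adjq[of a] adjD(1) adj_commute by simp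
    qed
  qed
  \<comment> \<open>The old matching pairs each odd position of \<open>p\<close> with the next one
    and fixes the two ends \<open>r\<close> and \<open>w\<close>, so the vertices of
    \<open>q\<close> are mapped among themselves and nothing outside is disturbed.\<close>
  have closed: "m x \<in> set q" if x: "x \<in> set q" for x
  proof (cases "x \<in> set p")
    case False then show ?thesis using x q w by auto
  next
    case True
    then obtain c where c: "c < length p" "x = p ! c" by (metis in_set_conv_nth)
    have odd_case: "m (p ! a) = p ! Suc a" "m (p ! Suc a) = p ! a" "Suc a < length p" if "odd a" "a < length p" for a
    proof -
      have "Suc a \<noteq> length p" using op(1) that(1) by (metis even_Suc)
      then show "Suc a < length p" using that by simp
      then show 1: "m (p ! a) = p ! Suc a" using p that by (simp add: altpath_def)
      have "p ! a < n" using op(5) that(2) nth_mem by blast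
      then show "m (p ! Suc a) = p ! a" using 1 m(1) matingD(2) by metis
    qed
    show ?thesis
    proof (cases "odd c")
      case True
      then have "m x = p ! Suc c" "Suc c < length p" using odd_case c by auto
      then show ?thesis using q by simp
    next
      case False
      show ?thesis
      proof (cases c)
        case 0 then show ?thesis using c q op(3) m(2) True by simp
      next
        case (Suc a)
        then have "m x = p ! a" "a < length p" using odd_case(2)[of a] c False by auto
        then show ?thesis using q by simp
      qed
    qed
  qed
  have off: "m' x < n \<and> m' (m' x) = x \<and> (m' x \<noteq> x \<longrightarrow> adj x (m' x))" if x: "x < n" "x \<notin> set q" for x
  proof -
    have "m x \<notin> set q" using closed[of "m x"] matingD(2)[OF m(1) x(1)] x(2) by auto
    then show ?thesis using matingD[OF m(1) x(1)] m'(3) x(2) by auto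
  qed
  show "mating m'" using on off unfolding mating_def by blast
  show "m' x \<noteq> x" if "x < n" "m x \<noteq> x \<or> x = r" for x
  proof (cases "x \<in> set q")
    case True then show ?thesis using on adjD(3) by metis
  next
    case False
    have "r \<in> set q" using op q by (metis Un_iff length_greater_0_conv nth_mem set_append)
    then show ?thesis using False that m'(3) by auto
  qed
qed

subsection \<open>Perfect matchings\<close>

text \<open>A path that ends elsewhere than at the root has at least three vertices, and its last
  edge is a matching edge.\<close>

lemma outer_matched:
  assumes S: "search m r Out Inn base P" and v: "v \<in> Out" "v \<noteq> r"
  shows "m v \<noteq> v"
proof -
  have p: "altpath m r (P v)" "last (P v) = v" using searchD(10,11)[OF S v(1)] by auto
  define L where "L = length (P v)"
  have L: "odd L" "P v \<noteq> []" "distinct (P v)" "P v ! 0 = r" using p by (auto simp: altpath_def L_def)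
  have lv: "P v ! (L - 1) = v" using p(2) L(2) by (simp add: last_conv_nth L_def)
  then have "L \<noteq> 1" using v(2) L(4) by auto
  then obtain a where a: "L = Suc (Suc a)" using L(1) by (cases L; cases "L - 1") auto
  then have a: "L = Suc (Suc a)" "odd a" using L(1) by auto
  then have "m (P v ! a) = v" using p(1) lv by (simp add: altpath_def L_def)
  moreover have "P v ! a \<in> set (P v)" using a by (simp add: L_def)
  moreover have "P v ! a \<noteq> P v ! (L - 1)" using L(3) a by (simp add: nth_eq_iff_index_eq L_def)
  ultimately show ?thesis
    using lv p(1) matingD(2)[OF searchD(1)[OF S], of "P v ! a"] by (auto simp: altpath_def)
qed

lemma perfect_partner:
  assumes "matching_cover {..<n} E 1 F"
  obtains g where "\<And>v. v < n \<Longrightarrow> adj v (g v) \<and> g (g v) = v"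
proof -
  obtain M :: "nat \<Rightarrow> nat set set" where M: "matching E (M 0)" "F = M 0"
    and cov: "\<And>v. v < n \<Longrightarrow> \<exists>e\<in>F. v \<in> e"
    using assms unfolding matching_cover_def by (elim conjE exE) (force simp: lessThan_Suc)
  have ex: "\<exists>w. {v, w} \<in> F" if v: "v < n" for v
  proof -
    obtain e where e: "e \<in> F" "v \<in> e" using cov v by blast
    then have "card e = 2" using M simple unfolding matching_def simple_graph_def by blast
    then obtain x y where "e = {x, y}" by (meson card_2_iff)
    then show ?thesis using e by (metis insertE insert_commute singletonD)
  qed
  have FE: "F \<subseteq> E" using M by (simp add: matching_def)
  have uniq: "a = b" if "{v, a} \<in> F" "{v, b} \<in> F" for v a b
  proof -
    have "{v, a} = {v, b}"
      using that M pairwiseD[of disjnt "M 0" "{v, a}" "{v, b}"] by (auto simp: matching_def disjnt_def)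
    then show ?thesis by (metis doubleton_eq_iff)
  qed
  define g where "g v = (SOME w. {v, w} \<in> F)" for v
  have g: "{v, g v} \<in> F" if "v < n" for v using someI_ex[OF ex[OF that]] by (simp add: g_def)
  have "adj v (g v) \<and> g (g v) = v" if v: "v < n" for v
  proof -
    have a: "adj v (g v)" using g[OF v] FE by blast
    then have "{g v, g (g v)} \<in> F" "{g v, v} \<in> F" using g adjD(2) v g[OF v] by (auto simp: insert_commute)
    then show ?thesis using a uniq by blast
  qed
  then show ?thesis using that by blast
qed

text \<open>The outer classes are odd and can be matched only into the inner vertices, of which there is
  one fewer (the easy half of Tutte's theorem).\<close>

lemma no_perfect_matching:
  assumes S: "search m r Out Inn base P"
    and fin: "\<And>u w. u \<in> Out \<Longrightarrow> adj u w \<Longrightarrow> w \<in> Out \<union> Inn \<and> (w \<in> Out \<longrightarrow> base w = base u)"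
  shows "\<not> matching_cover {..<n} E 1 F"
proof
  assume "matching_cover {..<n} E 1 F"
  then obtain g where g: "\<And>v. v < n \<Longrightarrow> adj v (g v) \<and> g (g v) = v" by (rule perfect_partner) blast
  note D = searchD[OF S]
  define Bs where "Bs = {b \<in> Out. base b = b}"
  define C where "C b = {v \<in> Out. base v = b}" for b
  have finO: "finite Out" "finite Inn" using D(6) finite_subset by auto
  have lt: "v < n" if "v \<in> Out \<union> Inn" for v using D(6) that by blast
  have mm: "m (m v) = v" if "v \<in> Out \<union> Inn" for v using D(1) lt that matingD(2) by blast
  have "m y \<noteq> r" if "y \<in> Inn" for y using D(2,3,7) mm[of y] that by auto
  \<comment> \<open>Every base except the exposed root is matched to an inner vertex, so there is
    exactly one class more than there are inner vertices.\<close>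
  then have "bij_betw m Inn (Bs - {r})"
    using D(15,17,18) mm by (intro bij_betw_byWitness[where f' = m]) (auto simp: Bs_def)
  then have "card Inn = card (Bs - {r})" by (rule bij_betw_same_card)
  moreover have "r \<in> Bs" "finite Bs" using D(3,4) finO by (auto simp: Bs_def)
  ultimately have cardBs: "card Bs = Suc (card Inn)" using card_Suc_Diff1[of Bs r] by simp
  \<comment> \<open>Otherwise \<open>g\<close> would pair off the whole class, by the closure
    hypothesis, while \<open>m\<close> pairs off the class without its base: the two parities
    contradict each other.\<close>
  have "\<exists>v\<in>C b. g v \<in> Inn" if b: "b \<in> Bs" for b
  proof (rule ccontr)
    assume no: "\<not> (\<exists>v\<in>C b. g v \<in> Inn)"
    have "even (card (C b))"
    proof (rule even_card_involution)
      show "finite (C b)" using finO by (simp add: C_def)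
      fix v assume v: "v \<in> C b"
      then have vO: "v \<in> Out" "base v = b" "v < n" using lt by (auto simp: C_def)
      then have "adj v (g v)" "g (g v) = v" using g by auto
      moreover have "g v \<notin> Inn" using no v by blast
      ultimately show "g v \<in> C b \<and> g (g v) = v \<and> g v \<noteq> v"
        using fin[OF vO(1), of "g v"] vO(2) adjD(3)[of v "g v"] by (auto simp: C_def)
    qed
    moreover have "even (card (C b - {b}))"
    proof (rule even_card_involution)
      show "finite (C b - {b})" using finO by (simp add: C_def)
      fix v assume v: "v \<in> C b - {b}"
      then have vO: "v \<in> Out" "base v = b" "base v \<noteq> v" "v \<noteq> r" using D(4) by (auto simp: C_def)
      then have "m v \<in> Out" "base (m v) = b" "m (m v) = v" "m v \<noteq> v"
        using D(13,14) mm outer_matched[OF S] by auto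
      moreover have "m v \<noteq> b"
      proof
        assume "m v = b"
        then have "m b = v" using calculation by simp
        then show False using D(15)[of b] b vO D(2,7) by (auto simp: Bs_def)
      qed
      ultimately show "m v \<in> C b - {b} \<and> m (m v) = v \<and> m v \<noteq> v" by (simp add: C_def)
    qed
    moreover have "b \<in> C b" "finite (C b)" using b finO by (auto simp: C_def Bs_def)
    then have "card (C b) = Suc (card (C b - {b}))" using card_Suc_Diff1[of "C b" b] by simp
    ultimately show False by simp
  qed
  then obtain h where h: "\<And>b. b \<in> Bs \<Longrightarrow> h b \<in> C b \<and> g (h b) \<in> Inn" by metis
  have "inj_on (\<lambda>b. g (h b)) Bs"
  proof (rule inj_onI)
    fix b b' assume bb: "b \<in> Bs" "b' \<in> Bs" "g (h b) = g (h b')"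
    have "h b < n" "h b' < n" using h bb lt by (auto simp: C_def)
    then have "h b = h b'" using g bb(3) by metis
    then show "b = b'" using h[OF bb(1)] h[OF bb(2)] by (simp add: C_def)
  qed
  then have "card Bs \<le> card Inn" using h finO(2) by (intro card_inj_on_le[of "\<lambda>b. g (h b)"]) auto
  then show False using cardBs by simp
qed

lemma perfect_matching_cover:
  assumes m: "mating m" "\<And>v. v < n \<Longrightarrow> m v \<noteq> v"
  shows "matching_cover {..<n} E 1 {{v, m v} | v. v < n}"
proof -
  have "matching E {{v, m v} | v. v < n}"
    unfolding matching_def pairwise_def disjnt_def
  proof (intro conjI ballI impI)
    show "{{v, m v} |v. v < n} \<subseteq> E" using m matingD(3) by blast
    fix e f assume "e \<in> {{v, m v} |v. v < n}" "f \<in> {{v, m v} |v. v < n}" "e \<noteq> f"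
    then obtain v w where vw: "v < n" "w < n" "e = {v, m v}" "f = {w, m w}" "e \<noteq> f" by blast
    then have "v \<noteq> w" "v \<noteq> m w" "m v \<noteq> w" "m v \<noteq> m w"
      using matingD(2)[OF m(1)] by (auto simp: insert_commute) metis+
    then show "e \<inter> f = {}" using vw by auto
  qed
  then show ?thesis unfolding matching_cover_def by (auto intro!: exI[of _ "\<lambda>_. {{v, m v} | v. v < n}"])
qed

subsection \<open>Partial star forests\<close>

text \<open>A star forest is encoded by mapping every leaf to its centre; \<open>l\<close> counts the leaves of each centre.\<close>

definition leaves :: "(nat \<Rightarrow> nat) \<Rightarrow> nat \<Rightarrow> nat set" where
  "leaves c y = {z. z < n \<and> z \<noteq> y \<and> c z = y}"

text \<open>Fixed points of \<open>c\<close> are centres and isolated vertices alike; the latter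
  have \<open>l\<close> equal to 0 and are the uncovered ones. The counts are determined by
  \<open>c\<close> but carried along because the program stores them.\<close>

definition star :: "(nat \<Rightarrow> nat) \<Rightarrow> (nat \<Rightarrow> nat) \<Rightarrow> nat \<Rightarrow> bool" where
  "star c l K \<longleftrightarrow> (\<forall>y<n. c y < n \<and> (c y \<noteq> y \<longrightarrow> adj y (c y) \<and> c (c y) = c y) \<and> l y = card (leaves c y) \<and> l y \<le> K)"

lemma starD:
  assumes "star c l K" "y < n"
  shows "c y < n" "c y \<noteq> y \<Longrightarrow> adj y (c y)" "c (c y) = c y" "l y = card (leaves c y)" "l y \<le> K"
  using assms unfolding star_def by (cases "c y = y"; auto)+

lemma finite_leaves: "finite (leaves c y)" by (simp add: leaves_def)

lemma star_leaf:
  assumes "star c l K" "z < n" "c z \<noteq> z"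
  shows "l z = 0" "l (c z) > 0" "z \<in> leaves c (c z)"
proof -
  show z: "z \<in> leaves c (c z)" using assms by (simp add: leaves_def)
  then show "l (c z) > 0" using starD(4)[OF assms(1) starD(1)[OF assms(1,2)]] finite_leaves
    by (metis card_gt_0_iff empty_iff)
  have "leaves c z = {}" using starD(3)[OF assms(1)] assms(3) by (auto simp: leaves_def)
  then show "l z = 0" using starD(4)[OF assms(1,2)] by simp
qed

lemma star_remove:
  assumes s: "star c l K" and z: "z < n" "c z \<noteq> z"
  shows "star (c(z := z)) (l(c z := l (c z) - 1)) K"
proof -
  have lv: "leaves (c(z := z)) y = (if y = c z then leaves c y - {z} else leaves c y)" for y
    using z by (auto simp: leaves_def)
  have "z \<in> leaves c (c z)" using star_leaf(3)[OF s z] .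
  then have cd: "card (leaves c (c z) - {z}) = l (c z) - 1"
    using starD(4)[OF s starD(1)[OF s z(1)]] finite_leaves by simp
  show ?thesis unfolding star_def
  proof (intro allI impI)
    fix y assume y: "y < n"
    have "c y \<noteq> z" if "y \<noteq> z" using starD(3)[OF s y] z that by auto
    then show "(c(z := z)) y < n \<and> ((c(z := z)) y \<noteq> y \<longrightarrow> adj y ((c(z := z)) y) \<and> (c(z := z)) ((c(z := z)) y) = (c(z := z)) y)
      \<and> (l(c z := l (c z) - 1)) y = card (leaves (c(z := z)) y) \<and> (l(c z := l (c z) - 1)) y \<le> K"
      using starD[OF s y] lv[of y] cd z by auto
  qed
qed

lemma star_add:
  assumes s: "star c l K" and z: "z < n" "c z = z" "l z = 0" and y: "c y = y" "adj z y" "l y < K"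
  shows "star (c(z := y)) (l(y := Suc (l y))) K"
proof -
  have zy: "z \<noteq> y" "y < n" using adjD y by auto
  have lv: "leaves (c(z := y)) a = (if a = y then insert z (leaves c a) else leaves c a)" for a
    using z zy by (auto simp: leaves_def)
  have zn: "z \<notin> leaves c y" using z zy by (simp add: leaves_def)
  have lz: "leaves c z = {}" using starD(4)[OF s z(1)] z(3) finite_leaves by simp
  show ?thesis unfolding star_def
  proof (intro allI impI)
    fix a assume a: "a < n"
    have "c a \<noteq> z" if "a \<noteq> z" using lz a that by (auto simp: leaves_def)
    then show "(c(z := y)) a < n \<and> ((c(z := y)) a \<noteq> a \<longrightarrow> adj a ((c(z := y)) a) \<and> (c(z := y)) ((c(z := y)) a) = (c(z := y)) a)
      \<and> (l(y := Suc (l y))) a = card (leaves (c(z := y)) a) \<and> (l(y := Suc (l y))) a \<le> K"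
      using starD[OF s a] lv[of a] z zy y zn finite_leaves[of c y] by auto
  qed
qed

lemma star_mono: "star c l K \<Longrightarrow> K \<le> K' \<Longrightarrow> star c l K'"
  unfolding star_def by fastforce

definition covered :: "(nat \<Rightarrow> nat) \<Rightarrow> (nat \<Rightarrow> nat) \<Rightarrow> nat \<Rightarrow> bool" where
  "covered c l v \<longleftrightarrow> c v \<noteq> v \<or> l v \<noteq> 0"

text \<open>Numbering the leaves of each star in increasing order colours its edges with fewer than
  \<open>K + 1\<close> colours. Edges of the same colour belong to different stars, which share no
  vertex, so each colour class is a matching.\<close>

lemma star_cover:
  assumes s: "star c l K" and cov: "\<And>v. v < n \<Longrightarrow> covered c l v"
  shows "matching_cover {..<n} E K {{v, c v} | v. v < n \<and> c v \<noteq> v}"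
proof -
  define rk where "rk y = card {z \<in> leaves c (c y). z < y}" for y
  have rklt: "rk y < K" if y: "y < n" "c y \<noteq> y" for y
  proof -
    have "{z \<in> leaves c (c y). z < y} \<subset> leaves c (c y)" using star_leaf(3)[OF s y] by blast
    then have "rk y < card (leaves c (c y))" unfolding rk_def by (rule psubset_card_mono[OF finite_leaves])
    then show ?thesis using starD(4,5)[OF s starD(1)[OF s y(1)]] by simp
  qed
  have rkinj: "y = z" if yz: "y < n" "c y \<noteq> y" "z < n" "c z \<noteq> z" "c y = c z" "rk y = rk z" for y z
  proof -
    have *: "rk y < rk z" if yz: "y < n" "c y \<noteq> y" "z < n" "c z \<noteq> z" "c y = c z" "y < z" for y z
      unfolding rk_def
    proof (rule psubset_card_mono)
      have "y \<in> leaves c (c z)" using yz by (simp add: leaves_def)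
      then show "{x \<in> leaves c (c y). x < y} \<subset> {x \<in> leaves c (c z). x < z}" using yz by auto
    qed (simp add: finite_leaves)
    show ?thesis using *[of y z] *[of z y] yz by (metis less_irrefl linorder_neqE_nat)
  qed
  define M where "M i = {{v, c v} | v. v < n \<and> c v \<noteq> v \<and> rk v = i}" for i
  have "matching E (M i)" for i
    unfolding matching_def pairwise_def disjnt_def
  proof (intro conjI ballI impI)
    show "M i \<subseteq> E" using starD(2)[OF s] by (auto simp: M_def)
    fix e f assume "e \<in> M i" "f \<in> M i" "e \<noteq> f"
    then obtain v w where vw: "v < n" "c v \<noteq> v" "rk v = i" "e = {v, c v}" "w < n" "c w \<noteq> w" "rk w = i" "f = {w, c w}"
      unfolding M_def by blast
    note vw = vw \<open>e \<noteq> f\<close>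
    have "v \<noteq> w" "c v \<noteq> c w" using rkinj[of v w] vw by auto
    moreover have "v \<noteq> c w" "c v \<noteq> w" using starD(3)[OF s] vw by metis+
    ultimately show "e \<inter> f = {}" using vw by auto
  qed
  moreover have "{{v, c v} | v. v < n \<and> c v \<noteq> v} = (\<Union>i<K. M i)" using rklt by (fastforce simp: M_def)
  moreover have "\<exists>e\<in>{{v, c v} | v. v < n \<and> c v \<noteq> v}. v \<in> e" if v: "v \<in> {..<n}" for v
  proof (cases "c v = v")
    case False then show ?thesis using v by blast
  next
    case True
    then have "leaves c v \<noteq> {}" using cov[of v] v starD(4)[OF s, of v] by (auto simp: covered_def)
    then obtain z where z: "z < n" "z \<noteq> v" "c z = v" by (auto simp: leaves_def)
    then have "{z, c z} \<in> {{v, c v} | v. v < n \<and> c v \<noteq> v}" by auto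
    then show ?thesis using z(3) by (intro bexI[of _ "{z, c z}"]) auto
  qed
  ultimately show ?thesis unfolding matching_cover_def by (intro conjI ballI exI[of _ M] allI impI)
qed

text \<open>Counting: \<open>v\<close> and the leaves of the full centres in \<open>Y\<close> are
  \<open>K * card Y + 1\<close> vertices with all neighbours in \<open>Y\<close>, but
  \<open>K\<close> matchings contain at most \<open>K * card Y\<close> edges at \<open>Y\<close>,
  and each of these vertices needs an edge of its own.\<close>

lemma star_no_cover:
  assumes s: "star c l K" and v: "v < n" "\<not> covered c l v"
    and Y: "\<And>y. y \<in> Y \<Longrightarrow> y < n \<and> l y = K"
    and nb: "\<And>x w. x < n \<Longrightarrow> x = v \<or> (c x \<noteq> x \<and> c x \<in> Y) \<Longrightarrow> adj x w \<Longrightarrow> w \<in> Y"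
  shows "\<not> matching_cover {..<n} E K F"
proof
  assume "matching_cover {..<n} E K F"
  then obtain M where M: "\<And>i. i < K \<Longrightarrow> matching E (M i)" "\<And>x. x < n \<Longrightarrow> \<exists>i<K. \<exists>e\<in>M i. x \<in> e"
    unfolding matching_cover_def by (elim conjE exE) (auto; fail | (simp add: Bex_def; blast))
  define X where "X = {x. x < n \<and> (x = v \<or> (c x \<noteq> x \<and> c x \<in> Y))}"
  have finY: "finite Y" using Y by (auto intro: finite_subset[of _ "{..<n}"])
  have "X = insert v (\<Union>y\<in>Y. leaves c y)" using v by (auto simp: X_def leaves_def)
  moreover have "v \<notin> (\<Union>y\<in>Y. leaves c y)" using v by (auto simp: leaves_def covered_def)
  moreover have "card (\<Union>y\<in>Y. leaves c y) = (\<Sum>y\<in>Y. card (leaves c y))"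
    by (rule card_UN_disjoint) (use finY finite_leaves in \<open>auto simp: leaves_def\<close>)
  moreover have "(\<Sum>y\<in>Y. card (leaves c y)) = (\<Sum>y\<in>Y. K)"
    by (rule sum.cong[OF refl]) (use Y starD(4)[OF s] in metis)
  ultimately have cX: "card X = Suc (card Y * K)"
    using finY finite_leaves by (simp add: card_insert_disjoint)
  \<comment> \<open>Each vertex of \<open>X\<close> is sent to its partner in \<open>Y\<close>
    together with the index of the matching; a matching has at most one edge at a given partner, so
    this map is injective.\<close>
  have "\<exists>q. snd q < K \<and> fst q \<in> Y \<and> {x, fst q} \<in> M (snd q)" if x: "x \<in> X" for x
  proof -
    have xn: "x < n" using x by (simp add: X_def)
    obtain i e where ie: "i < K" "e \<in> M i" "x \<in> e" using M(2)[OF xn] by blast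
    then have eE: "e \<in> E" using M(1) by (auto simp: matching_def)
    then have "card e = 2" using simple by (simp add: simple_graph_def)
    then obtain y where y: "e = {x, y}" using ie(3) by (metis card_2_iff insertE insert_commute singletonD)
    then have "y \<in> Y" using nb[OF xn] x eE by (auto simp: X_def)
    then show ?thesis using y ie by (intro exI[of _ "(y, i)"]) simp
  qed
  then obtain h where h: "\<And>x. x \<in> X \<Longrightarrow> snd (h x) < K \<and> fst (h x) \<in> Y \<and> {x, fst (h x)} \<in> M (snd (h x))" by metis
  have "inj_on h X"
  proof (rule inj_onI)
    fix x y assume xy: "x \<in> X" "y \<in> X" "h x = h y"
    then have "{x, fst (h x)} \<in> M (snd (h x))" "{y, fst (h x)} \<in> M (snd (h x))" using h by metis+
    then have "{x, fst (h x)} = {y, fst (h x)}"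
      using M(1)[of "snd (h x)"] h[OF xy(1)] pairwiseD[of disjnt "M (snd (h x))" "{x, fst (h x)}" "{y, fst (h x)}"]
      by (auto simp: matching_def disjnt_def)
    then show "x = y" by (metis doubleton_eq_iff)
  qed
  then have "card X \<le> card (Y \<times> {..<K})"
  proof (rule card_inj_on_le)
    show "h ` X \<subseteq> Y \<times> {..<K}" using h by (intro image_subsetI) (simp add: mem_Times_iff)
    show "finite (Y \<times> {..<K})" using finY by simp
  qed
  then show False using cX by (simp add: card_cartesian_product)
qed

end

section \<open>Time-bounded total correctness\<close>

text \<open>Existence of an execution covers termination and respect for the number bound at once;
  the postcondition sees the exact running time, so bounds compose.\<close>

definition run :: "nat \<Rightarrow> com \<Rightarrow> mem \<Rightarrow> (nat \<Rightarrow> mem \<Rightarrow> bool) \<Rightarrow> bool" where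
  "run B c s Q \<longleftrightarrow> (\<exists>t s'. exec B c s t s' \<and> Q t s')"

lemma runI: "exec B c s t s' \<Longrightarrow> Q t s' \<Longrightarrow> run B c s Q"
  unfolding run_def by blast

lemma runE:
  assumes "run B c s Q"
  obtains t s' where "exec B c s t s'" "Q t s'"
  using assms unfolding run_def by blast

lemma run_mono: "run B c s Q \<Longrightarrow> (\<And>t s'. Q t s' \<Longrightarrow> Q' t s') \<Longrightarrow> run B c s Q'"
  unfolding run_def by blast

lemma run_Skip [simp]: "run B Skip s Q \<longleftrightarrow> Q 1 s"
  unfolding run_def using exec.Skip exec_SkipE by metis

lemma run_Assign [simp]:
  "run B (Assign x i a) s Q \<longleftrightarrow>
     afits B s i \<and> afits B s a \<and> Q (acost i + acost a + 1) (s(x := (s x)(aval s i := aval s a)))"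
  (is "?L \<longleftrightarrow> ?R")
proof
  assume ?L
  then obtain t s' where "exec B (Assign x i a) s t s'" "Q t s'" unfolding run_def by blast
  then show ?R by (elim exec_AssignE) simp
next
  assume ?R
  then show ?L unfolding run_def using exec.Assign[of B s i a x] by blast
qed

lemma run_Seq: "run B (Seq c d) s Q \<longleftrightarrow> run B c s (\<lambda>t s'. run B d s' (\<lambda>t'. Q (t + t')))"
proof
  assume "run B (Seq c d) s Q"
  then show "run B c s (\<lambda>t s'. run B d s' (\<lambda>t'. Q (t + t')))"
    unfolding run_def by (auto elim!: exec_SeqE)
next
  assume "run B c s (\<lambda>t s'. run B d s' (\<lambda>t'. Q (t + t')))"
  then show "run B (Seq c d) s Q" unfolding run_def using exec.Seq by blast
qed

lemma run_Cond:
  "run B (Cond b c d) s Q \<longleftrightarrow> bfits B s b \<and>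
     (if bval s b then run B c s (\<lambda>t. Q (bcost b + 1 + t)) else run B d s (\<lambda>t. Q (bcost b + 1 + t)))"
proof
  assume "run B (Cond b c d) s Q"
  then show "bfits B s b \<and>
     (if bval s b then run B c s (\<lambda>t. Q (bcost b + 1 + t)) else run B d s (\<lambda>t. Q (bcost b + 1 + t)))"
    unfolding run_def by (auto elim!: exec_IfE)
next
  assume "bfits B s b \<and>
     (if bval s b then run B c s (\<lambda>t. Q (bcost b + 1 + t)) else run B d s (\<lambda>t. Q (bcost b + 1 + t)))"
  then show "run B (Cond b c d) s Q"
    unfolding run_def using exec.IfTrue exec.IfFalse by (metis (no_types, lifting))
qed

lemma run_SeqI:
  assumes "run B c s Q1" "\<And>t s'. Q1 t s' \<Longrightarrow> run B d s' (\<lambda>t'. Q (t + t'))"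
  shows "run B (Seq c d) s Q"
  unfolding run_Seq by (rule run_mono[OF assms])

lemma run_then:
  assumes "run B c s (\<lambda>t s'. t \<le> T1 \<and> R s')" "\<And>s'. R s' \<Longrightarrow> run B d s' (\<lambda>t s''. t \<le> T2 \<and> Q s'')" "T1 + T2 \<le> T"
  shows "run B (Seq c d) s (\<lambda>t s''. t \<le> T \<and> Q s'')"
proof (rule run_SeqI[OF assms(1)], elim conjE)
  fix t s' assume "t \<le> T1" "R s'"
  with assms(2)[OF \<open>R s'\<close>] assms(3) show "run B d s' (\<lambda>t' s''. t + t' \<le> T \<and> Q s'')"
    by (auto elim!: run_mono)
qed

text \<open>The amortised form of sequencing: the changes of the potential telescope and only the
  surcharges \<open>T1\<close> and \<open>T2\<close> add up.\<close>

lemma run_then_potential: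
  assumes "run B c s (\<lambda>t s'. t + \<phi> s' \<le> T1 + \<phi> s \<and> R s')"
    "\<And>s'. R s' \<Longrightarrow> run B d s' (\<lambda>t s''. t + \<phi> s'' \<le> T2 + \<phi> s' \<and> Q s'')" "T1 + T2 \<le> T"
  shows "run B (Seq c d) s (\<lambda>t s''. t + \<phi> s'' \<le> T + \<phi> s \<and> Q s'')"
proof (rule run_SeqI[OF assms(1)], elim conjE)
  fix t s' assume "t + \<phi> s' \<le> T1 + \<phi> s" "R s'"
  with assms(2)[OF \<open>R s'\<close>] assms(3) show "run B d s' (\<lambda>t' s''. t + t' + \<phi> s'' \<le> T + \<phi> s \<and> Q s'')"
    by (auto elim!: run_mono)
qed

lemma run_assign_then:
  assumes "afits B s i" "afits B s a" "run B d (s(x := (s x)(aval s i := aval s a))) (\<lambda>t s''. t \<le> T' \<and> Q s'')"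
    "acost i + acost a + 1 + T' \<le> T"
  shows "run B (Seq (Assign x i a) d) s (\<lambda>t s''. t \<le> T \<and> Q s'')"
  using assms(1-2) assms(4) by (auto simp: run_Seq intro: run_mono[OF assms(3)])

lemma run_weaken:
  assumes "run B c s (\<lambda>t s'. t \<le> T' \<and> Q' s')" "\<And>s'. Q' s' \<Longrightarrow> Q s'" "T' \<le> T"
  shows "run B c s (\<lambda>t s'. t \<le> T \<and> Q s')"
  by (rule run_mono[OF assms(1)]) (use assms(2,3) in auto)

text \<open>The potential \<open>\<phi>\<close> pays for the remaining running time, so it is the variant as well.\<close>

lemma run_While:
  assumes "I s" "\<And>s. I s \<Longrightarrow> bfits B s b"
    and "\<And>s. I s \<Longrightarrow> bval s b \<Longrightarrow> run B c s (\<lambda>t s'. I s' \<and> t + bcost b + 1 + \<phi> s' \<le> \<phi> s)"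
  shows "run B (While b c) s (\<lambda>t s'. I s' \<and> \<not> bval s' b \<and> t \<le> \<phi> s + bcost b + 1)"
  using assms(1)
proof (induction "\<phi> s" arbitrary: s rule: less_induct)
  case less
  note fits = assms(2)[OF less.prems]
  show ?case
  proof (cases "bval s b")
    case False
    show ?thesis by (rule runI[OF exec.WhileFalse[OF fits False]]) (simp add: False less.prems)
  next
    case True
    from assms(3)[OF less.prems True] obtain t s1 where
      1: "exec B c s t s1" "I s1 \<and> t + bcost b + 1 + \<phi> s1 \<le> \<phi> s" by (rule runE)
    then have "\<phi> s1 < \<phi> s" "I s1" by auto
    from less.hyps[OF this] obtain t' s2 where
      2: "exec B (While b c) s1 t' s2" "I s2 \<and> \<not> bval s2 b \<and> t' \<le> \<phi> s1 + bcost b + 1" by (rule runE)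
    show ?thesis by (rule runI[OF exec.WhileTrue[OF fits True 1(1) 2(1)]]) (use 1 2 in auto)
  qed
qed

abbreviation Then :: "com \<Rightarrow> com \<Rightarrow> com" (infixr \<open>;;\<close> 60) where "c ;; d \<equiv> Seq c d"

abbreviation V :: "aname \<Rightarrow> aexp" where "V x \<equiv> Cell x (Const 0)"

abbreviation assign :: "aname \<Rightarrow> aexp \<Rightarrow> com" (infix \<open>::=\<close> 65) where "x ::= a \<equiv> Assign x (Const 0) a"

abbreviation put :: "mem \<Rightarrow> aname \<Rightarrow> nat \<Rightarrow> mem" where "put s x v \<equiv> s(x := (s x)(0 := v))"

definition For :: "aname \<Rightarrow> aname \<Rightarrow> com \<Rightarrow> com" where
  "For i l c = Seq (Assign i (Const 0) (Const 0))
     (While (Less (V i) (V l)) (Seq c (Assign i (Const 0) (Plus (V i) (Const 1)))))"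

text \<open>The 12 units per round are 6 for the test and 6 for the increment; 9 is 3 for the
  initial assignment and 6 for the last test. The invariant is stated for the memory after the
  increment, so that the loop body may ignore its counter.\<close>

lemma run_For_potential:
  assumes N: "s l 0 = N" "N < B" "1 < B" "i \<noteq> l"
    and I: "I 0 (put s i 0)"
    and step: "\<And>k s'. k < N \<Longrightarrow> I k s' \<Longrightarrow> s' i 0 = k \<Longrightarrow> s' l 0 = N \<Longrightarrow>
       run B c s' (\<lambda>t s''. s'' i 0 = k \<and> s'' l 0 = N \<and> I (Suc k) (put s'' i (Suc k)) \<and>
          t + \<phi> (put s'' i (Suc k)) \<le> \<tau> + \<phi> s')"
  shows "run B (For i l c) s (\<lambda>t s'. I N s' \<and> s' i 0 = N \<and> s' l 0 = N \<and>
     t + \<phi> s' \<le> N * (\<tau> + 12) + 9 + \<phi> (put s i 0))"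
proof -
  let ?w = "While (Less (V i) (V l)) (Seq c (Assign i (Const 0) (Plus (V i) (Const 1))))"
  have loop: "run B ?w s' (\<lambda>t s''. I N s'' \<and> s'' i 0 = N \<and> s'' l 0 = N \<and> t + \<phi> s'' \<le> (N - k) * (\<tau> + 12) + 6 + \<phi> s')"
    if "I k s'" "s' i 0 = k" "s' l 0 = N" "k \<le> N" for k s'
    using that
  proof (induction "N - k" arbitrary: k s')
    case 0
    then have k: "k = N" by simp
    have "exec B ?w s' (bcost (Less (V i) (V l)) + 1) s'" using 0 k N by (intro exec.WhileFalse) auto
    then show ?case unfolding run_def using 0 k by fastforce
  next
    case (Suc d)
    then have kN: "k < N" by simp
    obtain t s1 where 1: "exec B c s' t s1" "s1 i 0 = k" "s1 l 0 = N" "I (Suc k) (put s1 i (Suc k))"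
        "t + \<phi> (put s1 i (Suc k)) \<le> \<tau> + \<phi> s'"
      using step[OF kN Suc.prems(1,2,3)] unfolding run_def by blast
    let ?s2 = "put s1 i (Suc k)"
    have "exec B (Assign i (Const 0) (Plus (V i) (Const 1))) s1 6 ?s2"
      using exec.Assign[of B s1 "Const 0" "Plus (V i) (Const 1)" i] 1 kN N by (simp add: eval_nat_numeral)
    then have 2: "exec B (Seq c (Assign i (Const 0) (Plus (V i) (Const 1)))) s' (t + 6) ?s2"
      using exec.Seq 1(1) by blast
    obtain t' s3 where 3: "exec B ?w ?s2 t' s3" "I N s3" "s3 i 0 = N" "s3 l 0 = N"
        "t' + \<phi> s3 \<le> (N - Suc k) * (\<tau> + 12) + 6 + \<phi> ?s2"
      using Suc.hyps(1)[of "Suc k" ?s2] Suc.hyps(2) 1 kN N(4) unfolding run_def by fastforce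
    have 4: "exec B ?w s' (bcost (Less (V i) (V l)) + 1 + (t + 6) + t') s3"
      by (rule exec.WhileTrue[OF _ _ 2 3(1)]) (use Suc.prems kN N in auto)
    have "N - k = Suc (N - Suc k)" using kN by simp
    then have "(bcost (Less (V i) (V l)) + 1 + (t + 6) + t') + \<phi> s3 \<le> (N - k) * (\<tau> + 12) + 6 + \<phi> s'"
      using 1(5) 3(5) by simp
    then show ?case unfolding run_def using 4 3 by blast
  qed
  have "run B ?w (put s i 0) (\<lambda>t s''. I N s'' \<and> s'' i 0 = N \<and> s'' l 0 = N \<and>
     t + \<phi> s'' \<le> (N - 0) * (\<tau> + 12) + 6 + \<phi> (put s i 0))"
    by (rule loop) (use I N in auto)
  then show ?thesis unfolding For_def
    using N by (auto simp: run_Seq elim!: run_mono)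
qed

lemma run_For:
  assumes N: "s l 0 = N" "N < B" "1 < B" "i \<noteq> l"
    and I: "I 0 (put s i 0)"
    and step: "\<And>k s'. k < N \<Longrightarrow> I k s' \<Longrightarrow> s' i 0 = k \<Longrightarrow> s' l 0 = N \<Longrightarrow>
       run B c s' (\<lambda>t s''. s'' i 0 = k \<and> s'' l 0 = N \<and> I (Suc k) (put s'' i (Suc k)) \<and> t \<le> \<tau>)"
  shows "run B (For i l c) s (\<lambda>t s'. I N s' \<and> s' i 0 = N \<and> s' l 0 = N \<and> t \<le> N * (\<tau> + 12) + 9)"
  using run_For_potential[of s l N B i I c "\<lambda>_. 0" \<tau>, OF assms(1-5)] step by simp

definition agree :: "aname set \<Rightarrow> mem \<Rightarrow> mem \<Rightarrow> bool" where
  "agree X s s' \<longleftrightarrow> (\<forall>x. x \<notin> X \<longrightarrow> s' x = s x)"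

lemma agreeD: "agree X s s' \<Longrightarrow> x \<notin> X \<Longrightarrow> s' x = s x"
  by (simp add: agree_def)

lemma agree_refl [simp]: "agree X s s"
  by (simp add: agree_def)

lemma agree_upd [simp]: "x \<in> X \<Longrightarrow> agree X s (s'(x := f)) \<longleftrightarrow> agree X s s'"
  by (auto simp: agree_def)

text \<open>The largest index below the limit that satisfies the test; the limit itself if there is none.\<close>

definition Find :: "aname \<Rightarrow> aname \<Rightarrow> aname \<Rightarrow> bexp \<Rightarrow> com" where
  "Find f i l b = Seq (Assign f (Const 0) (V l)) (For i l (Cond b (Assign f (Const 0) (V i)) Skip))"

lemma run_Find:
  assumes N: "s l 0 = N" "N < B" "1 < B" "i \<noteq> l" "f \<noteq> i" "f \<noteq> l"
    and b: "\<And>k s'. k < N \<Longrightarrow> agree {f, i} s s' \<Longrightarrow> s' i 0 = k \<Longrightarrow> bfits B s' b \<and> (bval s' b \<longleftrightarrow> Q k)"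
  shows "run B (Find f i l b) s (\<lambda>t s'. agree {f, i} s s' \<and> t \<le> N * (bcost b + 20) + 20 \<and>
     (s' f 0 = N \<and> (\<forall>k<N. \<not> Q k) \<or> s' f 0 < N \<and> Q (s' f 0) \<and> (\<forall>k<N. s' f 0 < k \<longrightarrow> \<not> Q k)))"
proof -
  define I where "I k s' \<longleftrightarrow> agree {f, i} s s' \<and>
     (s' f 0 = N \<and> (\<forall>j<k. \<not> Q j) \<or> s' f 0 < k \<and> Q (s' f 0) \<and> (\<forall>j<k. s' f 0 < j \<longrightarrow> \<not> Q j))" for k s'
  let ?s = "put s f N"
  have "run B (For i l (Cond b (Assign f (Const 0) (V i)) Skip)) ?s
     (\<lambda>t s'. I N s' \<and> s' i 0 = N \<and> s' l 0 = N \<and> t \<le> N * ((bcost b + 5) + 12) + 9)"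
  proof (rule run_For)
    show "I 0 (put ?s i 0)" using N by (simp add: I_def agree_def)
    fix k s' assume k: "k < N" "I k s'" "s' i 0 = k" "s' l 0 = N"
    have bb: "bfits B s' b" "bval s' b \<longleftrightarrow> Q k" using b[OF k(1), of s'] k by (auto simp: I_def)
    show "run B (Cond b (Assign f (Const 0) (V i)) Skip) s' (\<lambda>t s''. s'' i 0 = k \<and> s'' l 0 = N \<and>
        I (Suc k) (put s'' i (Suc k)) \<and> t \<le> bcost b + 5)"
      using bb k N by (auto simp: run_Cond I_def agree_def less_Suc_eq)
  qed (use N in auto)
  then show ?thesis unfolding Find_def run_Seq using N
    by (auto simp: I_def algebra_simps elim!: run_mono)
qed

definition Fill :: "aname \<Rightarrow> aname \<Rightarrow> aname \<Rightarrow> bexp \<Rightarrow> aexp \<Rightarrow> com" where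
  "Fill A i l b e = For i l (Cond b (Assign A (V i) e) Skip)"

text \<open>The test and the value may read the entry of \<open>A\<close> about to be overwritten,
  since earlier rounds have not touched it. The relabelling of bases depends on this.\<close>

lemma run_Fill:
  assumes N: "s l 0 = N" "N < B" "1 < B" "i \<noteq> l" "A \<noteq> i" "A \<noteq> l"
    and b: "\<And>k s'. k < N \<Longrightarrow> agree {A, i} s s' \<Longrightarrow> s' i 0 = k \<Longrightarrow> s' A k = s A k \<Longrightarrow>
      bfits B s' b \<and> (bval s' b \<longleftrightarrow> Q k) \<and> (Q k \<longrightarrow> afits B s' e \<and> aval s' e = g k)"
  shows "run B (Fill A i l b e) s (\<lambda>t s'. agree {A, i} s s' \<and> t \<le> N * (bcost b + acost e + 20) + 10 \<and>
     s' A = (\<lambda>y. if y < N \<and> Q y then g y else s A y))"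
proof -
  define I where "I k s' \<longleftrightarrow> agree {A, i} s s' \<and> (\<forall>y. s' A y = (if y < k \<and> Q y then g y else s A y))" for k s'
  have "run B (For i l (Cond b (Assign A (V i) e) Skip)) s
     (\<lambda>t s'. I N s' \<and> s' i 0 = N \<and> s' l 0 = N \<and> t \<le> N * ((bcost b + acost e + 5) + 12) + 9)"
  proof (rule run_For)
    show "I 0 (put s i 0)" using N by (simp add: I_def agree_def)
    fix k s' assume k: "k < N" "I k s'" "s' i 0 = k" "s' l 0 = N"
    have bb: "bfits B s' b" "bval s' b \<longleftrightarrow> Q k" "Q k \<longrightarrow> afits B s' e \<and> aval s' e = g k"
      using b[OF k(1), of s'] k by (auto simp: I_def)
    show "run B (Cond b (Assign A (V i) e) Skip) s' (\<lambda>t s''. s'' i 0 = k \<and> s'' l 0 = N \<and>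
        I (Suc k) (put s'' i (Suc k)) \<and> t \<le> bcost b + acost e + 5)"
      using bb k N by (auto simp: run_Cond I_def agree_def less_Suc_eq)
  qed (use N in auto)
  then show ?thesis unfolding Fill_def using N
    by (auto simp: I_def algebra_simps fun_eq_iff elim!: run_mono)
qed

section \<open>The program\<close>

declare One_nat_def [simp del]

text \<open>
  The matching part uses the following memory: \<open>m\<close> holds the mates, \<open>r\<close> the root of the search, and
  \<open>o\<close> is 0 once a perfect matching is known not to exist; \<open>g\<close> is 1 while the search runs. A vertex has
  status \<open>t\<close> 0 (unvisited), 1 (inner) or 2 (outer). An outer vertex \<open>v\<close> has the base \<open>b\<close>, the path stored
  in the first \<open>L\<close> cells of row \<open>v\<close> of \<open>P\<close>, and \<open>d\<close> set once no neighbour calls for action. In a contraction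
  \<open>u\<close> and \<open>v\<close> are the joined vertices, \<open>z\<close> is the new base, \<open>c\<close> is its position on both paths, and
  \<open>h\<close> marks the vertices of the new blossom that lie on the paths.
\<close>

locale ram_graph = graph +
  fixes B :: nat
  assumes n_pos: "n \<ge> 1" and B_large: "n * n + 4 * n + 4 \<le> B"
begin

definition row :: "mem \<Rightarrow> nat \<Rightarrow> nat \<Rightarrow> nat" where
  "row s x k = s ''P'' (x * n + k)"

definition path :: "mem \<Rightarrow> nat \<Rightarrow> nat list" where
  "path s v = map (row s v) [0..<s ''L'' v]"

lemma row_upd [simp]: "x \<noteq> ''P'' \<Longrightarrow> row (s(x := f)) = row s"
  by (simp add: row_def fun_eq_iff)

lemma path_upd [simp]: "x \<noteq> ''P'' \<Longrightarrow> x \<noteq> ''L'' \<Longrightarrow> path (s(x := f)) = path s"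
  by (simp add: path_def fun_eq_iff)

lemma length_path [simp]: "length (path s v) = s ''L'' v"
  by (simp add: path_def)

lemma nth_path [simp]: "k < s ''L'' v \<Longrightarrow> path s v ! k = row s v k"
  by (simp add: path_def)

lemma path_joinI:
  assumes "s' ''L'' x = s ''L'' w + (s ''L'' u - j)"
    and "\<And>a. a < s ''L'' w \<Longrightarrow> row s' x a = row s w a"
    and "\<And>a. a < s ''L'' u - j \<Longrightarrow> row s' x (s ''L'' w + a) = row s u (s ''L'' u - Suc a)"
  shows "path s' x = path s w @ rev (drop j (path s u))"
proof (rule nth_equalityI)
  fix k assume k: "k < length (path s' x)"
  show "path s' x ! k = (path s w @ rev (drop j (path s u))) ! k"
  proof (cases "k < s ''L'' w")
    case True then show ?thesis using assms k by (simp add: nth_append)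
  next
    case False
    define a where "a = k - s ''L'' w"
    have a: "k = s ''L'' w + a" "a < s ''L'' u - j" using False k assms(1) by (auto simp: a_def)
    then show ?thesis using assms(3)[OF a(2)] k by (simp add: nth_append rev_nth)
  qed
qed (use assms in simp)

lemma row_bound: "x < n \<Longrightarrow> x * n + n \<le> n * n"
  by (metis Suc_leI mult_Suc mult_le_mono1 add.commute)

lemma row_index_inj:
  assumes "a < n" "a' < n" "x * n + a = y * n + a'"
  shows "x = y \<and> a = a'"
  using assms by (metis add.commute div_mult_self3 div_less mod_less mod_mult_self3 add_cancel_right_left less_nat_zero_code)

abbreviation "at_row A x k \<equiv> Cell A (Plus (Times x (V ''n'')) k)"

definition write_row :: "aexp \<Rightarrow> com" where
  "write_row e = For ''a'' ''q'' (Assign ''P'' (Plus (Times (V ''y'') (V ''n'')) (Plus (V ''e'') (V ''a''))) e)"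

text \<open>Source and target lie in the same array \<open>P\<close>. Therefore the source
  expression is evaluated under the assurance that the rows other than \<open>x\<close> still have
  their old contents.\<close>

lemma run_write_row:
  assumes s: "s ''n'' 0 = n" "s ''y'' 0 = x" "x < n" "s ''q'' 0 = N" "s ''e'' 0 = off" "off + N \<le> n"
    and e: "\<And>k s'. k < N \<Longrightarrow> agree {''P'', ''a''} s s' \<Longrightarrow> s' ''a'' 0 = k \<Longrightarrow>
      (\<And>y a. y \<noteq> x \<Longrightarrow> a < n \<Longrightarrow> row s' y a = row s y a) \<Longrightarrow> afits B s' e \<and> aval s' e = g k"
  shows "run B (write_row e) s (\<lambda>t s'. agree {''P'', ''a''} s s' \<and> t \<le> N * (acost e + 24) + 9 \<and>
     (\<forall>y a. a < n \<longrightarrow> row s' y a = (if y = x \<and> off \<le> a \<and> a < off + N then g (a - off) else row s y a)))"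
proof -
  define I where "I k s' \<longleftrightarrow> agree {''P'', ''a''} s s' \<and>
     (\<forall>y a. a < n \<longrightarrow> row s' y a = (if y = x \<and> off \<le> a \<and> a < off + k then g (a - off) else row s y a))" for k s'
  have "run B (write_row e) s (\<lambda>t s'. I N s' \<and> s' ''a'' 0 = N \<and> s' ''q'' 0 = N \<and> t \<le> N * ((acost e + 12) + 12) + 9)"
    unfolding write_row_def
  proof (rule run_For)
    show "I 0 (put s ''a'' 0)" by (simp add: I_def agree_def row_def)
    fix k s' assume k: "k < N" "I k s'" "s' ''a'' 0 = k" "s' ''q'' 0 = N"
    have ag: "agree {''P'', ''a''} s s'" using k by (simp add: I_def)
    have [simp]: "s' ''n'' 0 = n" "s' ''y'' 0 = x" "s' ''e'' 0 = off"
      using agreeD[OF ag] s by auto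
    have r: "\<And>y a. a < n \<Longrightarrow> row s' y a = (if y = x \<and> off \<le> a \<and> a < off + k then g (a - off) else row s y a)"
      using k by (simp add: I_def)
    have ee: "afits B s' e" "aval s' e = g k"
      using e[OF k(1) ag k(3)] r by auto
    let ?s = "s'(''P'' := (s' ''P'')(x * n + (off + k) := g k))"
    have "row ?s y a = (if y = x \<and> off \<le> a \<and> a < off + Suc k then g (a - off) else row s y a)" if a: "a < n" for y a
    proof -
      have "off + k < n" using k s by simp
      then have "y * n + a = x * n + (off + k) \<longleftrightarrow> y = x \<and> a = off + k"
        using row_index_inj[OF a, of "off + k" y x] by auto
      then have "row ?s y a = (if y = x \<and> a = off + k then g k else row s' y a)" by (simp add: row_def)
      then show ?thesis using r[OF a, of y] by auto
    qed
    then have "I (Suc k) (put ?s ''a'' (Suc k))" using ag by (auto simp: I_def agree_def row_def)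
    then show "run B (Assign ''P'' (Plus (Times (V ''y'') (V ''n'')) (Plus (V ''e'') (V ''a''))) e) s'
        (\<lambda>t s''. s'' ''a'' 0 = k \<and> s'' ''q'' 0 = N \<and> I (Suc k) (put s'' ''a'' (Suc k)) \<and> t \<le> acost e + 12)"
      using row_bound[OF s(3)] B_large k s ee by simp
  qed (use s B_large in auto)
  then show ?thesis by (auto simp: I_def add.commute elim!: run_mono)
qed

subsection \<open>Contraction\<close>

text \<open>\<open>U\<close> names the end of the joining edge whose path contains the new outer
  vertex \<open>y\<close>, at position \<open>j\<close>; \<open>W\<close> names the opposite end.
  The first copy writes the path of \<open>W\<close>, the second the tail of the path of
  \<open>U\<close> in reverse order.\<close>

definition new_outer :: "aname \<Rightarrow> aname \<Rightarrow> com" where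
  "new_outer U W =
    Assign ''t'' (V ''y'') (Const 2);;
    Assign ''b'' (V ''y'') (V ''z'');;
    ''e'' ::= (Const 0);;
    ''q'' ::= (Cell ''L'' (V W));;
    write_row (at_row ''P'' (V W) (V ''a''));;
    ''e'' ::= (Cell ''L'' (V W));;
    ''q'' ::= (Minus (Cell ''L'' (V U)) (V ''j''));;
    write_row (at_row ''P'' (V U) (Minus (Minus (Cell ''L'' (V U)) (Const 1)) (V ''a'')));;
    Assign ''L'' (V ''y'') (Plus (Cell ''L'' (V W)) (Minus (Cell ''L'' (V U)) (V ''j'')))"

lemma run_new_outer:
  assumes UW: "U \<in> {''u'', ''v''}" "W \<in> {''u'', ''v''}" "U \<noteq> W"
    and s: "s ''n'' 0 = n" "s ''y'' 0 = x" "x < n" "s U 0 = u" "u < n" "s W 0 = w" "w < n" "x \<noteq> u" "x \<noteq> w"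
      "s ''j'' 0 = j" "j < s ''L'' u" "s ''L'' w + (s ''L'' u - j) \<le> n" "s ''L'' u \<le> n"
  shows "run B (new_outer U W) s (\<lambda>t s'. t \<le> 80 * n + 200 \<and>
    agree {''t'', ''b'', ''e'', ''q'', ''a'', ''P'', ''L''} s s' \<and>
    s' ''t'' = (s ''t'')(x := 2) \<and> s' ''b'' = (s ''b'')(x := s ''z'' 0) \<and>
    s' ''L'' = (s ''L'')(x := s ''L'' w + (s ''L'' u - j)) \<and>
    path s' x = path s w @ rev (drop j (path s u)) \<and>
    (\<forall>y a. y \<noteq> x \<longrightarrow> a < n \<longrightarrow> row s' y a = row s y a))"
proof -
  let ?rest = "''e'' ::= (Cell ''L'' (V W));;
    ''q'' ::= (Minus (Cell ''L'' (V U)) (V ''j''));;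
    write_row (at_row ''P'' (V U) (Minus (Minus (Cell ''L'' (V U)) (Const 1)) (V ''a'')));;
    Assign ''L'' (V ''y'') (Plus (Cell ''L'' (V W)) (Minus (Cell ''L'' (V U)) (V ''j'')))"
  let ?post = "\<lambda>s'. agree {''t'', ''b'', ''e'', ''q'', ''a'', ''P'', ''L''} s s' \<and>
    s' ''t'' = (s ''t'')(x := 2) \<and> s' ''b'' = (s ''b'')(x := s ''z'' 0) \<and>
    s' ''L'' = (s ''L'')(x := s ''L'' w + (s ''L'' u - j)) \<and>
    path s' x = path s w @ rev (drop j (path s u)) \<and>
    (\<forall>y a. y \<noteq> x \<longrightarrow> a < n \<longrightarrow> row s' y a = row s y a)"
  let ?Lu = "s ''L'' u" and ?Lw = "s ''L'' w"
  have nm [simp]: "U \<noteq> ''t''" "U \<noteq> ''b''" "U \<noteq> ''e''" "U \<noteq> ''q''" "U \<noteq> ''a''" "U \<noteq> ''P''" "U \<noteq> ''L''"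
     "W \<noteq> ''t''" "W \<noteq> ''b''" "W \<noteq> ''e''" "W \<noteq> ''q''" "W \<noteq> ''a''" "W \<noteq> ''P''" "W \<noteq> ''L''"
    using UW by auto
  have B1: "Suc 0 < B" "2 < B" using B_large by auto
  define s1 where "s1 = s(''t'' := (s ''t'')(x := 2), ''b'' := (s ''b'')(x := s ''z'' 0), ''e'' := (s ''e'')(0 := 0), ''q'' := (s ''q'')(0 := ?Lw))"
  have w1: "run B (write_row (at_row ''P'' (V W) (V ''a''))) s1 (\<lambda>t s'. agree {''P'', ''a''} s1 s' \<and> t \<le> n * 33 + 9 \<and>
     (\<forall>y a. a < n \<longrightarrow> row s' y a = (if y = x \<and> a < ?Lw then row s w a else row s y a)))"
  proof (rule run_mono)
    show "run B (write_row (at_row ''P'' (V W) (V ''a''))) s1 (\<lambda>t s'. agree {''P'', ''a''} s1 s' \<and>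
       t \<le> ?Lw * (acost (at_row ''P'' (V W) (V ''a'')) + 24) + 9 \<and>
     (\<forall>y a. a < n \<longrightarrow> row s' y a = (if y = x \<and> 0 \<le> a \<and> a < 0 + ?Lw then row s w (a - 0) else row s1 y a)))"
    proof (rule run_write_row)
      fix k s' assume k: "k < ?Lw" "agree {''P'', ''a''} s1 s'" "s' ''a'' 0 = k"
        and r: "\<And>y a. y \<noteq> x \<Longrightarrow> a < n \<Longrightarrow> row s' y a = row s1 y a"
      have [simp]: "s' ''n'' 0 = n" "s' W 0 = w" using agreeD[OF k(2)] s by (auto simp: s1_def)
      have "k < n" using k s by simp
      then have "row s' w k = row s w k" using r[of w k] s by (simp add: s1_def row_def)
      then show "afits B s' (at_row ''P'' (V W) (V ''a'')) \<and> aval s' (at_row ''P'' (V W) (V ''a'')) = row s w k"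
        using k row_bound[OF s(7)] B_large \<open>k < n\<close> by (simp add: row_def)
    qed (use s in \<open>auto simp: s1_def\<close>)
  next
    fix t s' assume *: "agree {''P'', ''a''} s1 s' \<and> t \<le> ?Lw * (acost (at_row ''P'' (V W) (V ''a'')) + 24) + 9 \<and>
     (\<forall>y a. a < n \<longrightarrow> row s' y a = (if y = x \<and> 0 \<le> a \<and> a < 0 + ?Lw then row s w (a - 0) else row s1 y a))"
    have "?Lw * 33 \<le> n * 33" using s by simp
    then show "agree {''P'', ''a''} s1 s' \<and> t \<le> n * 33 + 9 \<and>
     (\<forall>y a. a < n \<longrightarrow> row s' y a = (if y = x \<and> a < ?Lw then row s w a else row s y a))"
      using * by (simp add: s1_def row_def)
  qed
  have w2: "run B (?rest) s2
    (\<lambda>t s'. t \<le> n * 40 + 60 \<and> agree {''e'', ''q'', ''a'', ''P'', ''L''} s2 s' \<and>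
      s' ''L'' = (s ''L'')(x := ?Lw + (?Lu - j)) \<and>
     (\<forall>y a. a < n \<longrightarrow> row s' y a = (if y = x \<and> ?Lw \<le> a \<and> a < ?Lw + (?Lu - j) then row s u (?Lu - Suc (a - ?Lw)) else row s2 y a)))"
    if s2: "agree {''P'', ''a''} s1 s2" "\<And>y a. a < n \<Longrightarrow> row s2 y a = (if y = x \<and> a < ?Lw then row s w a else row s y a)" for s2
  proof -
    have [simp]: "s2 ''n'' 0 = n" "s2 W 0 = w" "s2 U 0 = u" "s2 ''y'' 0 = x" "s2 ''j'' 0 = j" "s2 ''L'' = s ''L''"
      using agreeD[OF s2(1)] s by (auto simp: s1_def)
    define s3 where "s3 = s2(''e'' := (s2 ''e'')(0 := ?Lw), ''q'' := (s2 ''q'')(0 := ?Lu - j))"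
    let ?e = "at_row ''P'' (V U) (Minus (Minus (Cell ''L'' (V U)) (Const 1)) (V ''a''))"
    have "run B (write_row ?e) s3 (\<lambda>t s'. agree {''P'', ''a''} s3 s' \<and>
       t \<le> (?Lu - j) * (acost ?e + 24) + 9 \<and>
     (\<forall>y a. a < n \<longrightarrow> row s' y a = (if y = x \<and> ?Lw \<le> a \<and> a < ?Lw + (?Lu - j) then row s u (?Lu - Suc (a - ?Lw)) else row s3 y a)))"
    proof (rule run_write_row)
      fix k s' assume k: "k < ?Lu - j" "agree {''P'', ''a''} s3 s'" "s' ''a'' 0 = k"
        and r: "\<And>y a. y \<noteq> x \<Longrightarrow> a < n \<Longrightarrow> row s' y a = row s3 y a"
      have [simp]: "s' ''n'' 0 = n" "s' U 0 = u" "s' ''L'' = s ''L''" using agreeD[OF k(2)] s by (auto simp: s3_def)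
      have kn: "?Lu - Suc k < n" using k s by simp
      then have "row s' u (?Lu - Suc k) = row s u (?Lu - Suc k)" using r[of u "?Lu - Suc k"] s s2(2)[of "?Lu - Suc k" u] by (simp add: s3_def row_def)
      then show "afits B s' ?e \<and> aval s' ?e = row s u (?Lu - Suc k)"
        using k row_bound[OF s(5)] B_large kn by (simp add: row_def plus_1_eq_Suc)
    qed (use s in \<open>auto simp: s3_def\<close>)
    then have "run B (write_row ?e) s3 (\<lambda>t s'. agree {''P'', ''a''} s3 s' \<and> t \<le> n * 40 + 9 \<and>
     (\<forall>y a. a < n \<longrightarrow> row s' y a = (if y = x \<and> ?Lw \<le> a \<and> a < ?Lw + (?Lu - j) then row s u (?Lu - Suc (a - ?Lw)) else row s2 y a)))"
    proof (rule run_mono)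
      fix t s' assume *: "agree {''P'', ''a''} s3 s' \<and> t \<le> (?Lu - j) * (acost ?e + 24) + 9 \<and>
       (\<forall>y a. a < n \<longrightarrow> row s' y a = (if y = x \<and> ?Lw \<le> a \<and> a < ?Lw + (?Lu - j) then row s u (?Lu - Suc (a - ?Lw)) else row s3 y a))"
      have "(?Lu - j) * 40 \<le> n * 40" using s by simp
      then show "agree {''P'', ''a''} s3 s' \<and> t \<le> n * 40 + 9 \<and>
       (\<forall>y a. a < n \<longrightarrow> row s' y a = (if y = x \<and> ?Lw \<le> a \<and> a < ?Lw + (?Lu - j) then row s u (?Lu - Suc (a - ?Lw)) else row s2 y a))"
        using * by (simp add: s3_def row_def)
    qed
    then show ?thesis
      using B1 s B_large
      apply (simp add: run_Seq flip: s3_def)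
      apply (erule run_mono)
      apply (auto simp: agree_def s3_def row_def)
      done
  qed
  have "run B (Seq (write_row (at_row ''P'' (V W) (V ''a''))) ?rest) s1 (\<lambda>t s'. t \<le> n * 73 + 69 \<and>
    ?post s')"
  proof (rule run_SeqI[OF w1])
    fix t1 s2
    assume p: "agree {''P'', ''a''} s1 s2 \<and> t1 \<le> n * 33 + 9 \<and>
     (\<forall>y a. a < n \<longrightarrow> row s2 y a = (if y = x \<and> a < ?Lw then row s w a else row s y a))"
    then have ag: "agree {''P'', ''a''} s1 s2" and t1: "t1 \<le> n * 33 + 9" by auto
    have r2: "\<And>y a. a < n \<Longrightarrow> row s2 y a = (if y = x \<and> a < ?Lw then row s w a else row s y a)" using p by blast
    show "run B (?rest) s2 (\<lambda>t s'. t1 + t \<le> n * 73 + 69 \<and>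
    ?post s')"
    proof (rule run_mono[OF w2[OF ag r2]], assumption)
      fix t2 s3
      assume 3: "t2 \<le> n * 40 + 60 \<and> agree {''e'', ''q'', ''a'', ''P'', ''L''} s2 s3 \<and>
        s3 ''L'' = (s ''L'')(x := ?Lw + (?Lu - j)) \<and>
       (\<forall>y a. a < n \<longrightarrow> row s3 y a = (if y = x \<and> ?Lw \<le> a \<and> a < ?Lw + (?Lu - j) then row s u (?Lu - Suc (a - ?Lw)) else row s2 y a))"
      then have r3: "\<And>y a. a < n \<Longrightarrow> row s3 y a = (if y = x \<and> ?Lw \<le> a \<and> a < ?Lw + (?Lu - j) then row s u (?Lu - Suc (a - ?Lw)) else row s2 y a)"
        by blast
      have L3: "s3 ''L'' = (s ''L'')(x := ?Lw + (?Lu - j))" and ag3: "agree {''e'', ''q'', ''a'', ''P'', ''L''} s2 s3"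
        using 3 by auto
      have c1: "path s3 x = path s w @ rev (drop j (path s u))"
        by (rule path_joinI) (use s r2 r3 L3 in auto)
      have c2: "\<forall>y a. y \<noteq> x \<longrightarrow> a < n \<longrightarrow> row s3 y a = row s y a" using r2 r3 by simp
      have c3: "agree {''t'', ''b'', ''e'', ''q'', ''a'', ''P'', ''L''} s s3"
        using ag ag3 unfolding s1_def agree_def by auto
      have c4: "s3 ''t'' = (s ''t'')(x := 2)" "s3 ''b'' = (s ''b'')(x := s ''z'' 0)"
        using agreeD[OF ag3] agreeD[OF ag] by (auto simp: s1_def)
      have "t1 + t2 \<le> n * 73 + 69" using t1 3 by simp
      then show "t1 + t2 \<le> n * 73 + 69 \<and> ?post s3"
        using c1 c2 c3 c4 L3 by blast
    qed
  qed
  then show ?thesis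
    unfolding new_outer_def
    using B1 s
    by (simp add: run_Seq[of B "Assign _ _ _"] flip: s1_def) (auto elim!: run_mono)
qed

definition outer :: "mem \<Rightarrow> nat set" where "outer s = {y. y < n \<and> s ''t'' y = 2}"
definition inner :: "mem \<Rightarrow> nat set" where "inner s = {y. y < n \<and> s ''t'' y = 1}"

text \<open>A vertex becomes outer once per search. The credit pays for writing its path in a
  contraction, which costs \<open>80 * n + 200\<close>, and for up to 100 units of surrounding
  instructions.\<close>

definition \<phi> :: "mem \<Rightarrow> nat" where "\<phi> s = (80 * n + 300) * card {y. y < n \<and> s ''t'' y \<noteq> 2}"

lemma path_eqI:
  assumes "s' ''L'' y = s ''L'' y" "s ''L'' y \<le> n" "\<And>a. a < n \<Longrightarrow> row s' y a = row s y a"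
  shows "path s' y = path s y"
  using assms by (intro nth_equalityI) auto

lemma outer_upd [simp]: "x \<noteq> ''t'' \<Longrightarrow> outer (s(x := f)) = outer s"
  and inner_upd [simp]: "x \<noteq> ''t'' \<Longrightarrow> inner (s(x := f)) = inner s"
  and \<phi>_upd [simp]: "x \<noteq> ''t'' \<Longrightarrow> \<phi> (s(x := f)) = \<phi> s"
  by (simp_all add: outer_def inner_def \<phi>_def)

lemma \<phi>_cong: "s ''t'' = s' ''t'' \<Longrightarrow> \<phi> s = \<phi> s'"
  by (simp add: \<phi>_def)

lemma \<phi>_new_outer:
  assumes "x < n" "s ''t'' x \<noteq> 2" "s' ''t'' = (s ''t'')(x := 2)"
  shows "\<phi> s = \<phi> s' + (80 * n + 300)"
proof -
  let ?A = "{y. y < n \<and> s ''t'' y \<noteq> 2}"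
  have "{y. y < n \<and> s' ''t'' y \<noteq> 2} = ?A - {x}" using assms(3) by auto
  moreover have "card ?A = Suc (card (?A - {x}))" using assms card_Suc_Diff1[of ?A x] by simp
  ultimately show ?thesis by (simp add: \<phi>_def)
qed

text \<open>A \<open>For\<close> loop starts at 0, so the positions before the new base are passed
  over by a test. All vertices of the tail are marked, the base included, but only those that are
  inner when they are met get a path.\<close>

definition absorb :: "aname \<Rightarrow> aname \<Rightarrow> com" where
  "absorb U W = ''l'' ::= (Cell ''L'' (V U));;
    For ''j'' ''l'' (Cond (Less (V ''j'') (V ''c'')) Skip
      (''y'' ::= (at_row ''P'' (V U) (V ''j''));;
       Assign ''h'' (V ''y'') (Const 1);;
       Cond (Equal (Cell ''t'' (V ''y'')) (Const 1)) (new_outer U W) Skip))"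

text \<open>\<open>D\<close> stands for the tail of the path of \<open>u\<close> from position
  \<open>c\<close> on, and \<open>X\<close> for the vertices in it that were inner at the
  start.\<close>

definition absorbed :: "nat \<Rightarrow> nat \<Rightarrow> nat set \<Rightarrow> nat set \<Rightarrow> mem \<Rightarrow> mem \<Rightarrow> bool" where
  "absorbed u w D X s s' \<longleftrightarrow>
    agree {''l'', ''j'', ''y'', ''h'', ''t'', ''b'', ''e'', ''q'', ''a'', ''P'', ''L''} s s' \<and>
    s' ''t'' = (\<lambda>y. if y \<in> X then 2 else s ''t'' y) \<and>
    s' ''b'' = (\<lambda>y. if y \<in> X then s ''z'' 0 else s ''b'' y) \<and>
    s' ''h'' = (\<lambda>y. if y \<in> D then 1 else s ''h'' y) \<and>
    (\<forall>y. y \<notin> X \<longrightarrow> s' ''L'' y = s ''L'' y \<and> (\<forall>a<n. row s' y a = row s y a)) \<and>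
    (\<forall>k. s ''c'' 0 \<le> k \<longrightarrow> k < s ''L'' u \<longrightarrow> row s u k \<in> X \<longrightarrow>
       path s' (row s u k) = path s w @ rev (drop k (path s u)))"

lemma absorbedD:
  assumes "absorbed u w D X s s'"
  shows "agree {''l'', ''j'', ''y'', ''h'', ''t'', ''b'', ''e'', ''q'', ''a'', ''P'', ''L''} s s'"
    "s' ''t'' = (\<lambda>y. if y \<in> X then 2 else s ''t'' y)"
    "s' ''b'' = (\<lambda>y. if y \<in> X then s ''z'' 0 else s ''b'' y)"
    "s' ''h'' = (\<lambda>y. if y \<in> D then 1 else s ''h'' y)"
    "\<forall>y. y \<notin> X \<longrightarrow> s' ''L'' y = s ''L'' y \<and> (\<forall>a<n. row s' y a = row s y a)"
    "\<forall>k. s ''c'' 0 \<le> k \<longrightarrow> k < s ''L'' u \<longrightarrow> row s u k \<in> X \<longrightarrow>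
       path s' (row s u k) = path s w @ rev (drop k (path s u))"
  using assms unfolding absorbed_def by blast+

text \<open>Amortised: the passage along the tail costs O(n), and each path written is paid by the
  vertex that leaves the set counted in \<open>\<phi>\<close>. The last assumption on
  \<open>s\<close> guarantees that every joined path fits into a row.\<close>

lemma run_absorb:
  assumes UW: "U \<in> {''u'', ''v''}" "W \<in> {''u'', ''v''}" "U \<noteq> W"
    and s: "s ''n'' 0 = n" "s U 0 = u" "u < n" "s W 0 = w" "w < n" "s ''t'' u = 2" "s ''t'' w = 2"
      "s ''L'' u \<le> n" "\<And>k. k < s ''L'' u \<Longrightarrow> row s u k < n" "distinct (path s u)"
      "\<And>k. k < s ''L'' u \<Longrightarrow> s ''c'' 0 \<le> k \<Longrightarrow> s ''t'' (row s u k) = 1 \<Longrightarrow> s ''L'' w + (s ''L'' u - k) \<le> n"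
    and D: "D = set (drop (s ''c'' 0) (path s u))" and X: "X = {x \<in> D. s ''t'' x = 1}"
  shows "run B (absorb U W) s (\<lambda>t s'. t + \<phi> s' \<le> 100 * n + 50 + \<phi> s \<and> absorbed u w D X s s')"
proof -
  let ?body = "Cond (Less (V ''j'') (V ''c'')) Skip
      (''y'' ::= (at_row ''P'' (V U) (V ''j''));;
       Assign ''h'' (V ''y'') (Const 1);;
       Cond (Equal (Cell ''t'' (V ''y'')) (Const 1)) (new_outer U W) Skip)"
  let ?A = "{''l'', ''j'', ''y'', ''h'', ''t'', ''b'', ''e'', ''q'', ''a'', ''P'', ''L''}"
  let ?c = "s ''c'' 0" and ?N = "s ''L'' u"
  have nm [simp]: "U \<noteq> ''t''" "U \<noteq> ''b''" "U \<noteq> ''e''" "U \<noteq> ''q''" "U \<noteq> ''a''" "U \<noteq> ''P''" "U \<noteq> ''L''"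
     "U \<noteq> ''l''" "U \<noteq> ''j''" "U \<noteq> ''y''" "U \<noteq> ''h''" "U \<noteq> ''n''" "U \<noteq> ''c''" "U \<noteq> ''z''"
     "W \<noteq> ''t''" "W \<noteq> ''b''" "W \<noteq> ''e''" "W \<noteq> ''q''" "W \<noteq> ''a''" "W \<noteq> ''P''" "W \<noteq> ''L''"
     "W \<noteq> ''l''" "W \<noteq> ''j''" "W \<noteq> ''y''" "W \<noteq> ''h''" "W \<noteq> ''n''" "W \<noteq> ''c''" "W \<noteq> ''z''"
    using UW by auto
  have B1: "1 < B" "2 < B" "n < B" using B_large by auto
  define Dk where "Dk k = {x. \<exists>j. ?c \<le> j \<and> j < k \<and> x = row s u j}" for k
  define Xk where "Xk k = {x \<in> Dk k. s ''t'' x = 1}" for k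
  \<comment> \<open>\<open>u\<close> and \<open>w\<close> are outer from the start, so the two rows
    serving as sources are never rewritten.\<close>
  have uX: "u \<notin> Xk k" "w \<notin> Xk k" for k using s(6,7) by (auto simp: Xk_def)
  have DN: "Dk ?N = D" unfolding D Dk_def by (auto simp: in_drop_iff) (metis nth_path)+
  then have XN: "Xk ?N = X" by (simp add: X Xk_def)
  define I where "I k s' \<longleftrightarrow> agree ?A s s' \<and>
    s' ''t'' = (\<lambda>y. if y \<in> Xk k then 2 else s ''t'' y) \<and>
    s' ''b'' = (\<lambda>y. if y \<in> Xk k then s ''z'' 0 else s ''b'' y) \<and>
    s' ''h'' = (\<lambda>y. if y \<in> Dk k then 1 else s ''h'' y) \<and>
    (\<forall>y. y \<notin> Xk k \<longrightarrow> s' ''L'' y = s ''L'' y \<and> (\<forall>a<n. row s' y a = row s y a)) \<and>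
    (\<forall>j. ?c \<le> j \<longrightarrow> j < k \<longrightarrow> row s u j \<in> Xk k \<longrightarrow> path s' (row s u j) = path s w @ rev (drop j (path s u)))" for k s'
  have put: "I k (s'(''j'' := f)) \<longleftrightarrow> I k s'" for k s' f
    by (simp_all add: I_def)
  let ?s = "put s ''l'' ?N"
  have "run B (For ''j'' ''l'' ?body) ?s
    (\<lambda>t s'. I ?N s' \<and> s' ''j'' 0 = ?N \<and> s' ''l'' 0 = ?N \<and> t + \<phi> s' \<le> ?N * (50 + 12) + 9 + \<phi> (put ?s ''j'' 0))"
  proof (rule run_For_potential)
    show "I 0 (put ?s ''j'' 0)" by (auto simp: I_def agree_def Dk_def Xk_def row_def path_def)
    fix k s' assume k: "k < ?N" "I k s'" "s' ''j'' 0 = k" "s' ''l'' 0 = ?N"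
    have ag: "agree ?A s s'" using k by (simp add: I_def)
    have [simp]: "s' ''n'' 0 = n" "s' U 0 = u" "s' W 0 = w" "s' ''c'' 0 = ?c" "s' ''z'' = s ''z''"
      using agreeD[OF ag] s by auto
    have kn: "k < n" using k s by simp
    let ?x = "row s u k"
    have xn: "?x < n" using s(9) k by simp
    \<comment> \<open>A simple path shows each vertex once: the status read now is the initial one,
      and a vertex just made outer is not met again.\<close>
    have nx: "?x \<notin> Dk k"
    proof
      assume "?x \<in> Dk k"
      then obtain j where j: "j < k" "row s u k = row s u j" by (auto simp: Dk_def)
      then show False using nth_eq_iff_index_eq[OF s(10), of k j] k by simp
    qed
    have Lw: "s' ''L'' y = s ''L'' y" "a < n \<Longrightarrow> row s' y a = row s y a" if "y \<notin> Xk k" for y a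
      using k(2) that by (auto simp: I_def)
    have rk: "s' ''P'' (u * n + k) = ?x" using Lw(2)[OF uX(1) kn] by (simp add: row_def)
    have paths: "path s' y = path s y" if "y \<notin> Xk k" "s ''L'' y \<le> n" for y
      using Lw[OF that(1)] that(2) by (intro nth_equalityI) auto
    let ?Q = "\<lambda>t s''. s'' ''j'' 0 = k \<and> s'' ''l'' 0 = ?N \<and> I (Suc k) (put s'' ''j'' (Suc k)) \<and>
          t + \<phi> (put s'' ''j'' (Suc k)) \<le> 50 + \<phi> s'"
    show "run B ?body s' ?Q"
    proof (cases "k < ?c")
      case True
      then have "Dk (Suc k) = Dk k" by (auto simp: Dk_def less_Suc_eq)
      then have "I (Suc k) s'" using k(2) True by (auto simp: I_def Xk_def)
      then show ?thesis using True k B1 put by (simp add: run_Cond)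
    next
      case False
      then have D': "Dk (Suc k) = insert ?x (Dk k)" by (auto simp: Dk_def less_Suc_eq intro: exI[of _ k])
      let ?s1 = "s'(''y'' := (s' ''y'')(0 := ?x), ''h'' := (s' ''h'')(?x := 1))"
      have ag1: "agree ?A s ?s1" using ag by (auto simp: agree_def)
      show ?thesis
      proof (cases "s ''t'' ?x = 1")
        case no: False
        then have X': "Xk (Suc k) = Xk k" using D' by (auto simp: Xk_def)
        have t': "s' ''t'' ?x \<noteq> 1" using k(2) no by (auto simp: I_def)
        have "I (Suc k) ?s1" using k(2) X' D' no unfolding I_def
          by (auto simp: agree_def row_def path_def less_Suc_eq Xk_def)
        then have "I (Suc k) (put ?s1 ''j'' (Suc k))" "\<phi> (put ?s1 ''j'' (Suc k)) = \<phi> s'"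
          using put by simp_all
        then show ?thesis using False k B1 t' rk row_bound[OF s(3)] B_large kn
          by (simp add: run_Cond run_Seq)
      next
        case yes: True
        have X': "Xk (Suc k) = insert ?x (Xk k)" "?x \<notin> Xk k" using D' yes nx by (auto simp: Xk_def)
        have t': "s' ''t'' ?x = 1" using k(2) X'(2) yes by (auto simp: I_def)
        have ne: "?x \<noteq> u" "?x \<noteq> w" using yes s by auto
        have L: "s' ''L'' u = s ''L'' u" "s' ''L'' w = s ''L'' w" using Lw uX by auto
        have Ln: "s ''L'' w + (s ''L'' u - k) \<le> n" using s(11)[OF k(1)] False yes by simp
        have new: "run B (new_outer U W) ?s1 (\<lambda>t s2. t \<le> 80 * n + 200 \<and>
          agree {''t'', ''b'', ''e'', ''q'', ''a'', ''P'', ''L''} ?s1 s2 \<and>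
          s2 ''t'' = (?s1 ''t'')(?x := 2) \<and> s2 ''b'' = (?s1 ''b'')(?x := ?s1 ''z'' 0) \<and>
          s2 ''L'' = (?s1 ''L'')(?x := ?s1 ''L'' w + (?s1 ''L'' u - k)) \<and>
          path s2 ?x = path ?s1 w @ rev (drop k (path ?s1 u)) \<and>
          (\<forall>y a. y \<noteq> ?x \<longrightarrow> a < n \<longrightarrow> row s2 y a = row ?s1 y a))"
          by (rule run_new_outer[OF UW]) (use xn s k L Ln ne in auto)
        have "run B (new_outer U W) ?s1 (\<lambda>t s2. s2 ''j'' 0 = k \<and> s2 ''l'' 0 = ?N \<and>
           I (Suc k) s2 \<and> t + 100 + \<phi> s2 \<le> \<phi> s')"
        proof (rule run_mono[OF new], elim conjE, intro conjI)
          fix t s2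
          assume 2: "t \<le> 80 * n + 200"
          "agree {''t'', ''b'', ''e'', ''q'', ''a'', ''P'', ''L''} ?s1 s2"
          "s2 ''t'' = (?s1 ''t'')(?x := 2)" "s2 ''b'' = (?s1 ''b'')(?x := ?s1 ''z'' 0)"
          "s2 ''L'' = (?s1 ''L'')(?x := ?s1 ''L'' w + (?s1 ''L'' u - k))"
          "path s2 ?x = path ?s1 w @ rev (drop k (path ?s1 u))"
          "\<forall>y a. y \<noteq> ?x \<longrightarrow> a < n \<longrightarrow> row s2 y a = row ?s1 y a"
          show "s2 ''j'' 0 = k" "s2 ''l'' 0 = ?N" using agreeD[OF 2(2)] k by auto
          have "\<phi> s' = \<phi> s2 + (80 * n + 300)" by (rule \<phi>_new_outer[OF xn]) (use t' 2 in auto)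
          then show "t + 100 + \<phi> s2 \<le> \<phi> s'" using 2(1) by simp
          have ps: "path ?s1 y = path s y" if "y \<notin> Xk k" "s ''L'' y \<le> n" for y
            using paths[OF that] by (simp add: path_def row_def)
          have new: "path s2 ?x = path s w @ rev (drop k (path s u))"
            using 2(6) ps[OF uX(1)] ps[OF uX(2)] s(8) Ln by simp
          have old: "path s2 (row s u j) = path s w @ rev (drop j (path s u))" 
            if j: "?c \<le> j" "j < k" "row s u j \<in> Xk k" for j
          proof -
            have "row s u j \<noteq> ?x" using j X' by auto
            then have "s2 ''L'' (row s u j) = s' ''L'' (row s u j)" "a < n \<Longrightarrow> row s2 (row s u j) a = row s' (row s u j) a" for a
              using 2(5,7) by (auto simp: row_def)
            moreover have pj: "path s' (row s u j) = path s w @ rev (drop j (path s u))" using k(2) j by (simp add: I_def)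
            moreover have "s' ''L'' (row s u j) \<le> n"
            proof -
              have "s ''t'' (row s u j) = 1" using j by (simp add: Xk_def)
              then have "s ''L'' w + (s ''L'' u - j) \<le> n" using s(11)[of j] j k by simp
              then show ?thesis using arg_cong[OF pj, of length] by simp
            qed
            ultimately have "path s2 (row s u j) = path s' (row s u j)" by (intro path_eqI)
            then show ?thesis using pj by simp
          qed
          have paths2: "path s2 (row s u j) = path s w @ rev (drop j (path s u))"
            if j: "?c \<le> j" "j < Suc k" "row s u j \<in> Xk (Suc k)" for j
          proof (cases "j = k")
            case True then show ?thesis using new by simp
          next
            case False
            then have "row s u j \<in> Dk k" using j by (auto simp: Dk_def)
            then have "row s u j \<noteq> ?x" using nx by auto
            then show ?thesis using old False j X' by simp
          qed
          have h2: "s2 ''h'' = (s' ''h'')(?x := 1)" using agreeD[OF 2(2)] by simp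
          have "agree ?A s s2" using ag1 2(2) by (auto simp: agree_def)
          moreover have "s2 ''t'' = (\<lambda>y. if y \<in> Xk (Suc k) then 2 else s ''t'' y)"
            using k(2) 2(3) X' by (auto simp: I_def fun_eq_iff)
          moreover have "s2 ''b'' = (\<lambda>y. if y \<in> Xk (Suc k) then s ''z'' 0 else s ''b'' y)"
            using k(2) 2(4) X' by (auto simp: I_def fun_eq_iff)
          moreover have "s2 ''h'' = (\<lambda>y. if y \<in> Dk (Suc k) then 1 else s ''h'' y)"
            using k(2) h2 D' by (auto simp: I_def fun_eq_iff)
          moreover have "s2 ''L'' y = s ''L'' y" "a < n \<Longrightarrow> row s2 y a = row s y a" if "y \<notin> Xk (Suc k)" for y a
            using 2(5,7) X' Lw that by auto
          ultimately show "I (Suc k) s2" unfolding I_def using paths2 by blast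
        qed
        then show ?thesis using False k B1 t' rk row_bound[OF s(3)] B_large kn
          apply (simp add: run_Cond run_Seq put)
          apply (erule run_mono)
          apply auto
          done
      qed
    qed
  qed (use B1 s in auto)
  then have "run B (For ''j'' ''l'' ?body) ?s
    (\<lambda>t s'. I ?N s' \<and> t + \<phi> s' \<le> n * 62 + 9 + \<phi> s)"
  proof (rule run_mono)
    fix t s'
    assume *: "I ?N s' \<and> s' ''j'' 0 = ?N \<and> s' ''l'' 0 = ?N \<and> t + \<phi> s' \<le> ?N * (50 + 12) + 9 + \<phi> (put ?s ''j'' 0)"
    have "?N * 62 \<le> n * 62" using s by simp
    moreover have "\<phi> (put ?s ''j'' 0) = \<phi> s" by (rule \<phi>_cong) simp
    ultimately show "I ?N s' \<and> t + \<phi> s' \<le> n * 62 + 9 + \<phi> s" using * by auto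
  qed
  then show ?thesis unfolding absorb_def run_Seq
    using B1 s
    apply simp
    apply (erule run_mono)
    apply (auto simp: I_def DN XN absorbed_def)
    done
qed

text \<open>\<open>Find\<close> returns the largest index, so \<open>c\<close> becomes the position
  of the last base on the path of \<open>u\<close> that also lies on the path of
  \<open>v\<close>.\<close>

definition find_meet :: com where
  "find_meet =
    Fill ''k'' ''i'' ''n'' (Equal (Const 0) (Const 0)) (Const 0);;
    Fill ''h'' ''i'' ''n'' (Equal (Const 0) (Const 0)) (Const 0);;
    ''l'' ::= (Cell ''L'' (V ''v''));;
    For ''j'' ''l'' (Assign ''k'' (at_row ''P'' (V ''v'') (V ''j'')) (Const 1));;
    ''l'' ::= (Cell ''L'' (V ''u''));;
    Find ''c'' ''j'' ''l''
      (Conj (Equal (Cell ''k'' (at_row ''P'' (V ''u'') (V ''j''))) (Const 1))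
      (Conj (Equal (Cell ''t'' (at_row ''P'' (V ''u'') (V ''j''))) (Const 2))
        (Equal (Cell ''b'' (at_row ''P'' (V ''u'') (V ''j''))) (at_row ''P'' (V ''u'') (V ''j'')))));;
    ''z'' ::= (at_row ''P'' (V ''u'') (V ''c''))"

text \<open>The relabelling runs over all vertices, since members of merged classes need not lie on
  either path. The vertices made outer just before already have the base \<open>z\<close>, which is
  marked, so relabelling leaves them as they are.\<close>

definition contract :: com where
  "contract = find_meet;; absorb ''u'' ''v'';; absorb ''v'' ''u'';;
     Fill ''b'' ''i'' ''n'' (Conj (Equal (Cell ''t'' (V ''i'')) (Const 2)) (Equal (Cell ''h'' (Cell ''b'' (V ''i''))) (Const 1))) (V ''z'')"

definition tree :: "mem \<Rightarrow> bool" where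
  "tree s \<longleftrightarrow> search (s ''m'') (s ''r'' 0) (outer s) (inner s) (s ''b'') (path s)"

lemma treeD:
  assumes "tree s" "v \<in> outer s"
  shows "v < n" "s ''t'' v = 2" "s ''L'' v \<le> n" "0 < s ''L'' v" "\<And>k. k < s ''L'' v \<Longrightarrow> row s v k < n"
    "distinct (path s v)" "s ''b'' v < n"
proof -
  note S = assms(1)[unfolded tree_def]
  show "v < n" "s ''t'' v = 2" using assms(2) by (auto simp: outer_def)
  have p: "odd (length (path s v))" "distinct (path s v)" "set (path s v) \<subseteq> {..<n}"
    using searchD(10)[OF S assms(2)] by (auto simp: altpath_def)
  show "distinct (path s v)" by (rule p)
  show "s ''L'' v \<le> n" using card_mono[OF _ p(3)] distinct_card[OF p(2)] by simp
  show "0 < s ''L'' v" using p(1) by (auto intro: Nat.gr0I)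
  show "row s v k < n" if "k < s ''L'' v" for k
    using p(3) nth_mem[of k "path s v"] that by auto
  show "s ''b'' v < n" using searchD(8)[OF S assms(2)] by (auto simp: outer_def)
qed

definition met :: "nat \<Rightarrow> nat \<Rightarrow> mem \<Rightarrow> mem \<Rightarrow> bool" where
  "met u v s s' \<longleftrightarrow> agree {''k'', ''h'', ''i'', ''l'', ''j'', ''c'', ''z''} s s' \<and>
     (\<forall>y<n. s' ''h'' y = 0) \<and> s' ''c'' 0 < s ''L'' u \<and> s' ''z'' 0 = row s u (s' ''c'' 0) \<and>
     s' ''z'' 0 \<in> outer s \<and> s ''b'' (s' ''z'' 0) = s' ''z'' 0 \<and> s' ''z'' 0 \<in> set (path s v) \<and>
     (\<forall>k<s ''L'' u. s' ''c'' 0 < k \<longrightarrow> row s u k \<in> outer s \<longrightarrow> s ''b'' (row s u k) = row s u k \<longrightarrow> row s u k \<notin> set (path s v))"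

lemma run_find_meet:
  assumes s: "s ''n'' 0 = n" "tree s" "s ''u'' 0 = u" "s ''v'' 0 = v" "u \<in> outer s" "v \<in> outer s"
  shows "run B find_meet  s (\<lambda>t s'. t \<le> n * 220 + 100 \<and> met u v s s')"
proof -
  note u = treeD[OF s(2,5)] and v = treeD[OF s(2,6)]
  have B1: "0 < B" "1 < B" "2 < B" "n < B" using B_large by auto
  let ?true = "Equal (Const 0) (Const 0)"
  have fill: "run B (Fill A ''i'' ''n'' ?true (Const 0)) s (\<lambda>t s'. t \<le> n * 24 + 10 \<and> agree {A, ''i''} s s' \<and>
     s' A = (\<lambda>y. if y < n then 0 else s A y))" if "s ''n'' 0 = n" "A \<noteq> ''i''" "A \<noteq> ''n''" for A s
    using run_Fill[of s "''n''" n B "''i''" A ?true "\<lambda>_. True" "Const 0" "\<lambda>_. 0"] that B1 by (auto elim!: run_mono)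
  define Q where "Q k \<longleftrightarrow> row s u k \<in> outer s \<and> s ''b'' (row s u k) = row s u k \<and> row s u k \<in> set (path s v)" for k
  \<comment> \<open>Both paths start at the root, which is a base; hence the search for a common
    base cannot fail.\<close>
  have Q0: "Q 0"
  proof -
    note S = s(2)[unfolded tree_def]
    have "row s u 0 = s ''r'' 0" using searchD(10)[OF S s(5)] u(4) unfolding altpath_def by (metis nth_path)
    moreover have "s ''r'' 0 \<in> set (path s v)"
      using searchD(10)[OF S s(6)] v(4) unfolding altpath_def by (metis length_path nth_mem)
    ultimately show ?thesis unfolding Q_def using searchD(3,4)[OF S] by simp
  qed
  let ?e = "at_row ''P'' (V ''u'') (V ''j'')"
  let ?b = "Conj (Equal (Cell ''k'' ?e) (Const 1)) (Conj (Equal (Cell ''t'' ?e) (Const 2)) (Equal (Cell ''b'' ?e) ?e))"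
  have find: "run B (''l'' ::= (Cell ''L'' (V ''u''));; Find ''c'' ''j'' ''l'' ?b;;
      ''z'' ::= (at_row ''P'' (V ''u'') (V ''c''))) s3 (\<lambda>t s'. t \<le> n * 90 + 40 \<and> met u v s s')"
    if 3: "agree {''k'', ''h'', ''i'', ''l'', ''j''} s s3" "\<And>y. y < n \<Longrightarrow> s3 ''h'' y = 0"
      "\<And>y. y < n \<Longrightarrow> s3 ''k'' y = (if y \<in> set (path s v) then 1 else 0)" for s3
  proof (rule run_assign_then)
    have L3: "s3 ''L'' = s ''L''" "s3 ''u'' 0 = u" "s3 ''n'' 0 = n" using agreeD[OF 3(1)] s by auto
    show "afits B s3 (Const 0)" "afits B s3 (Cell ''L'' (V ''u''))" using B1 by auto
    let ?s3 = "s3(''l'' := (s3 ''l'')(aval s3 (Const 0) := aval s3 (Cell ''L'' (V ''u''))))"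
    show "run B (Find ''c'' ''j'' ''l'' ?b;; ''z'' ::= (at_row ''P'' (V ''u'') (V ''c''))) ?s3
      (\<lambda>t s'. t \<le> n * 90 + 31 \<and> met u v s s')"
    proof (rule run_then)
      show "run B (Find ''c'' ''j'' ''l'' ?b) ?s3 (\<lambda>t s'. t \<le> n * 90 + 20 \<and> agree {''c'', ''j''} ?s3 s' \<and>
         s' ''c'' 0 < s ''L'' u \<and> Q (s' ''c'' 0) \<and> (\<forall>k<s ''L'' u. s' ''c'' 0 < k \<longrightarrow> \<not> Q k))"
      proof (rule run_mono)
        show "run B (Find ''c'' ''j'' ''l'' ?b) ?s3
        (\<lambda>t s'. agree {''c'', ''j''} ?s3 s' \<and> t \<le> s ''L'' u * (bcost ?b + 20) + 20 \<and>
         (s' ''c'' 0 = s ''L'' u \<and> (\<forall>k<s ''L'' u. \<not> Q k) \<or> s' ''c'' 0 < s ''L'' u \<and> Q (s' ''c'' 0) \<and>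
            (\<forall>k<s ''L'' u. s' ''c'' 0 < k \<longrightarrow> \<not> Q k)))"
        proof (rule run_Find)
          fix k s' assume k: "k < s ''L'' u" "agree {''c'', ''j''} ?s3 s'" "s' ''j'' 0 = k"
          have [simp]: "s' ''n'' 0 = n" "s' ''u'' 0 = u" "s' ''P'' = s ''P''" "s' ''t'' = s ''t''" "s' ''b'' = s ''b''"
            "s' ''k'' = s3 ''k''"
            using agreeD[OF k(2)] agreeD[OF 3(1)] s by auto
          have rn: "row s u k < n" using u(5) k by simp
          have "s3 ''k'' (row s u k) = (if row s u k \<in> set (path s v) then 1 else 0)" using 3(3)[OF rn] .
          then show "bfits B s' ?b \<and> (bval s' ?b \<longleftrightarrow> Q k)"
            using k row_bound[OF u(1)] u(3) B_large rn by (auto simp: Q_def outer_def row_def)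
        qed (use B1 u(3) L3 in auto)
        show "t \<le> n * 90 + 20 \<and> agree {''c'', ''j''} ?s3 s' \<and>
         s' ''c'' 0 < s ''L'' u \<and> Q (s' ''c'' 0) \<and> (\<forall>k<s ''L'' u. s' ''c'' 0 < k \<longrightarrow> \<not> Q k)"
          if "agree {''c'', ''j''} ?s3 s' \<and> t \<le> s ''L'' u * (bcost ?b + 20) + 20 \<and>
         (s' ''c'' 0 = s ''L'' u \<and> (\<forall>k<s ''L'' u. \<not> Q k) \<or> s' ''c'' 0 < s ''L'' u \<and> Q (s' ''c'' 0) \<and>
            (\<forall>k<s ''L'' u. s' ''c'' 0 < k \<longrightarrow> \<not> Q k))" for t s'
          using that Q0 u(4) mult_le_mono1[OF u(3), of 90] by auto
      qed
      fix s4 assume 4: "agree {''c'', ''j''} ?s3 s4 \<and> s4 ''c'' 0 < s ''L'' u \<and> Q (s4 ''c'' 0) \<and>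
        (\<forall>k<s ''L'' u. s4 ''c'' 0 < k \<longrightarrow> \<not> Q k)"
      have ag4: "agree {''k'', ''h'', ''i'', ''l'', ''j'', ''c'', ''z''} s s4" using 4 3(1) by (auto simp: agree_def)
      have L4: "s4 ''u'' 0 = u" "s4 ''n'' 0 = n" "s4 ''P'' = s ''P''" using agreeD[OF ag4] s by auto
      have h4: "\<And>y. y < n \<Longrightarrow> s4 ''h'' y = 0" using 4 3(2) by (simp add: agree_def)
      have z: "s ''P'' (u * n + s4 ''c'' 0) = row s u (s4 ''c'' 0)" "row s u (s4 ''c'' 0) \<in> outer s"
          "s ''b'' (row s u (s4 ''c'' 0)) = row s u (s4 ''c'' 0)" "row s u (s4 ''c'' 0) \<in> set (path s v)"
        using 4 by (auto simp: Q_def row_def)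
      have fits: "0 < B" "u * n < B" "u * n + s4 ''c'' 0 < B" using row_bound[OF u(1)] 4 u(3) B_large by auto
      have c: "s4 ''c'' 0 < s ''L'' u" "\<forall>k<s ''L'' u. s4 ''c'' 0 < k \<longrightarrow> row s u k \<in> outer s \<longrightarrow> s ''b'' (row s u k) = row s u k \<longrightarrow> row s u k \<notin> set (path s v)"
        using 4 by (auto simp: Q_def)
      show "run B (''z'' ::= (at_row ''P'' (V ''u'') (V ''c''))) s4 (\<lambda>t s'. t \<le> 11 \<and> met u v s s')"
        using c ag4 h4 z fits by (simp add: L4 met_def)
    qed simp
  qed simp
  have mark: "run B (''l'' ::= (Cell ''L'' (V ''v''));; For ''j'' ''l'' (Assign ''k'' (at_row ''P'' (V ''v'') (V ''j'')) (Const 1))) s2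
       (\<lambda>t s'. t \<le> n * 32 + 20 \<and> agree {''k'', ''h'', ''i'', ''l'', ''j''} s s' \<and> (\<forall>y<n. s' ''h'' y = 0) \<and>
         (\<forall>y<n. s' ''k'' y = (if y \<in> set (path s v) then 1 else 0)))"
    if 2: "agree {''k'', ''h'', ''i''} s s2" "\<And>y. y < n \<Longrightarrow> s2 ''h'' y = 0" "\<And>y. y < n \<Longrightarrow> s2 ''k'' y = 0" for s2
  proof (rule run_assign_then)
    show "afits B s2 (Const 0)" "afits B s2 (Cell ''L'' (V ''v''))" using B1 by auto
    let ?s2 = "s2(''l'' := (s2 ''l'')(aval s2 (Const 0) := aval s2 (Cell ''L'' (V ''v''))))"
    have L2: "s2 ''L'' = s ''L''" "s2 ''v'' 0 = v" "s2 ''n'' 0 = n" using agreeD[OF 2(1)] s by auto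
    define I where "I k s' \<longleftrightarrow> agree {''k'', ''j''} ?s2 s' \<and> s' ''k'' = (\<lambda>y. if \<exists>j<k. y = row s v j then 1 else s2 ''k'' y)" for k s'
    have mark: "run B (For ''j'' ''l'' (Assign ''k'' (at_row ''P'' (V ''v'') (V ''j'')) (Const 1))) ?s2
        (\<lambda>t s'. I (s ''L'' v) s' \<and> s' ''j'' 0 = s ''L'' v \<and> s' ''l'' 0 = s ''L'' v \<and> t \<le> s ''L'' v * (20 + 12) + 9)"
    proof (rule run_For)
      show "I 0 (put ?s2 ''j'' 0)" by (simp add: I_def)
      fix k s' assume k: "k < s ''L'' v" "I k s'" "s' ''j'' 0 = k" "s' ''l'' 0 = s ''L'' v"
      have ag: "agree {''k'', ''j''} ?s2 s'" using k by (simp add: I_def)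
      have [simp]: "s' ''n'' 0 = n" "s' ''v'' 0 = v" "s' ''P'' = s ''P''"
          using agreeD[OF ag] agreeD[OF 2(1)] s by auto
      have k': "(s' ''k'')(s ''P'' (v * n + k) := 1) = (\<lambda>y. if \<exists>j<Suc k. y = row s v j then 1 else s2 ''k'' y)"
          using k(2) by (auto simp: I_def less_Suc_eq fun_eq_iff row_def)
      show "run B (Assign ''k'' (at_row ''P'' (V ''v'') (V ''j'')) (Const 1)) s'
          (\<lambda>t s''. s'' ''j'' 0 = k \<and> s'' ''l'' 0 = s ''L'' v \<and> I (Suc k) (put s'' ''j'' (Suc k)) \<and> t \<le> 20)"
          using k row_bound[OF v(1)] v(3) B_large k'
          by (simp add: I_def)
    qed (use B1 v(3) L2 in auto)
    show "run B (For ''j'' ''l'' (Assign ''k'' (at_row ''P'' (V ''v'') (V ''j'')) (Const 1))) ?s2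
       (\<lambda>t s'. t \<le> n * 32 + 10 \<and> agree {''k'', ''h'', ''i'', ''l'', ''j''} s s' \<and> (\<forall>y<n. s' ''h'' y = 0) \<and>
         (\<forall>y<n. s' ''k'' y = (if y \<in> set (path s v) then 1 else 0)))"
    proof (rule run_mono[OF mark], elim conjE)
      fix t s' assume 3: "I (s ''L'' v) s'" "t \<le> s ''L'' v * (20 + 12) + 9"
      then have ag: "agree {''k'', ''j''} ?s2 s'" by (simp add: I_def)
      have "agree {''k'', ''h'', ''i'', ''l'', ''j''} s s'" using ag 2(1) by (auto simp: agree_def)
      moreover have "\<forall>y<n. s' ''h'' y = 0" using ag 2(2) by (simp add: agree_def)
      moreover have "(\<exists>j<s ''L'' v. y = row s v j) \<longleftrightarrow> y \<in> set (path s v)" for y by (auto simp: path_def)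
      then have "\<forall>y<n. s' ''k'' y = (if y \<in> set (path s v) then 1 else 0)" using 3(1) 2(3) by (simp add: I_def)
      moreover have "t \<le> n * 32 + 10" using 3(2) mult_le_mono1[OF v(3), of 32] by simp
      ultimately show "t \<le> n * 32 + 10 \<and> agree {''k'', ''h'', ''i'', ''l'', ''j''} s s' \<and> (\<forall>y<n. s' ''h'' y = 0) \<and>
         (\<forall>y<n. s' ''k'' y = (if y \<in> set (path s v) then 1 else 0))" by blast
    qed
  qed simp
  have tail: "run B ((''l'' ::= (Cell ''L'' (V ''v''));; For ''j'' ''l'' (Assign ''k'' (at_row ''P'' (V ''v'') (V ''j'')) (Const 1)));;
      ''l'' ::= (Cell ''L'' (V ''u''));; Find ''c'' ''j'' ''l'' ?b;;
      ''z'' ::= (at_row ''P'' (V ''u'') (V ''c''))) s2 (\<lambda>t s'. t \<le> n * 122 + 60 \<and> met u v s s')"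
    if 2: "agree {''k'', ''h'', ''i''} s s2" "\<And>y. y < n \<Longrightarrow> s2 ''h'' y = 0" "\<And>y. y < n \<Longrightarrow> s2 ''k'' y = 0" for s2
    by (rule run_then, rule mark, (use 2 in auto)[3], rule find) auto
  show ?thesis unfolding find_meet_def
  proof (rule run_then[OF fill])
    fix s1 assume 1: "agree {''k'', ''i''} s s1 \<and> s1 ''k'' = (\<lambda>y. if y < n then 0 else s ''k'' y)"
    show "run B (Fill ''h'' ''i'' ''n'' ?true (Const 0);;
    ''l'' ::= (Cell ''L'' (V ''v''));;
    For ''j'' ''l'' (Assign ''k'' (at_row ''P'' (V ''v'') (V ''j'')) (Const 1));;
    ''l'' ::= (Cell ''L'' (V ''u''));; Find ''c'' ''j'' ''l'' ?b;;
    ''z'' ::= (at_row ''P'' (V ''u'') (V ''c''))) s1 (\<lambda>t s'. t \<le> n * 160 + 80 \<and> met u v s s')"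
    proof (rule run_then[OF fill])
      fix s2 assume 2: "agree {''h'', ''i''} s1 s2 \<and> s2 ''h'' = (\<lambda>y. if y < n then 0 else s1 ''h'' y)"
      have "agree {''k'', ''h'', ''i''} s s2" using 1 2 by (auto simp: agree_def)
      moreover have "\<And>y. y < n \<Longrightarrow> s2 ''k'' y = 0" using 1 2 by (simp add: agree_def)
      moreover have "\<And>y. y < n \<Longrightarrow> s2 ''h'' y = 0" using 2 by simp
      ultimately show "run B (''l'' ::= (Cell ''L'' (V ''v''));;
    For ''j'' ''l'' (Assign ''k'' (at_row ''P'' (V ''v'') (V ''j'')) (Const 1));;
    ''l'' ::= (Cell ''L'' (V ''u''));; Find ''c'' ''j'' ''l'' ?b;;
    ''z'' ::= (at_row ''P'' (V ''u'') (V ''c''))) s2 (\<lambda>t s'. t \<le> n * 122 + 60 \<and> met u v s s')"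
        using tail[of s2] by (simp only: run_Seq add.assoc)
    qed (use 1 s in \<open>auto simp: agree_def\<close>)
  qed (use s in auto)
qed


text \<open>The joined list repeats no vertex, so it fits into a row of length
  \<open>n\<close>.\<close>

lemma search_join_length:
  assumes S: "search m r Out Inn base P" and uv: "u \<in> Out" "v \<in> Out"
    and dis: "set (P v) \<inter> set (drop k (P u)) = {}"
  shows "length (P v) + (length (P u) - k) \<le> n"
proof -
  have d: "distinct (P v @ drop k (P u))" "set (P v @ drop k (P u)) \<subseteq> {..<n}"
    using searchD(10)[OF S uv(1)] searchD(10)[OF S uv(2)] dis set_drop_subset[of k "P u"]
    by (auto simp: altpath_def)
  then show ?thesis using card_mono[OF _ d(2)] distinct_card[OF d(1)] by simp
qed

text \<open>The last two conclusions serve the surrounding search: a nonempty \<open>Z\<close> of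
  new outer vertices is the progress, and since equal bases remain equal, vertices scanned earlier
  need no second scan.\<close>

lemma run_contract:
  assumes s: "s ''n'' 0 = n" "tree s" "s ''u'' 0 = u" "s ''v'' 0 = v" "u \<in> outer s" "v \<in> outer s"
    "adj u v" "s ''b'' u \<noteq> s ''b'' v"
  shows "run B contract s (\<lambda>t s'. t + \<phi> s' \<le> 600 * n + 300 + \<phi> s \<and>
    agree {''k'', ''h'', ''i'', ''l'', ''j'', ''c'', ''z'', ''y'', ''t'', ''b'', ''e'', ''q'', ''a'', ''P'', ''L''} s s' \<and>
    tree s' \<and> (\<exists>Z\<subseteq>inner s. Z \<noteq> {} \<and> s' ''t'' = (\<lambda>y. if y \<in> Z then 2 else s ''t'' y)) \<and>
    (\<forall>y\<in>outer s. \<forall>z\<in>outer s. s ''b'' y = s ''b'' z \<longrightarrow> s' ''b'' y = s' ''b'' z))"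
proof -
  let ?A = "{''k'', ''h'', ''i'', ''l'', ''j'', ''c'', ''z'', ''y'', ''t'', ''b'', ''e'', ''q'', ''a'', ''P'', ''L''}"
  let ?Out = "outer s" and ?Inn = "inner s" and ?P = "path s"
  let ?post = "\<lambda>s'. agree ?A s s' \<and>
    tree s' \<and> (\<exists>Z\<subseteq>inner s. Z \<noteq> {} \<and> s' ''t'' = (\<lambda>y. if y \<in> Z then 2 else s ''t'' y)) \<and>
    (\<forall>y\<in>outer s. \<forall>z\<in>outer s. s ''b'' y = s ''b'' z \<longrightarrow> s' ''b'' y = s' ''b'' z)"
  let ?cond = "Conj (Equal (Cell ''t'' (V ''i'')) (Const 2)) (Equal (Cell ''h'' (Cell ''b'' (V ''i''))) (Const 1))"
  let ?relabel = "Fill ''b'' ''i'' ''n'' ?cond (V ''z'')"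
  note S = s(2)[unfolded tree_def]
  note u = treeD[OF s(2,5)] and v = treeD[OF s(2,6)]
  have B1: "0 < B" "1 < B" "2 < B" "n < B" using B_large by auto
  have rest: "run B (absorb ''u'' ''v'';; absorb ''v'' ''u'';;
     ?relabel) s1
     (\<lambda>t s'. t + \<phi> s' \<le> 250 * n + 150 + \<phi> s1 \<and> ?post s')"
    if 1: "agree {''k'', ''h'', ''i'', ''l'', ''j'', ''c'', ''z''} s s1" "\<And>y. y < n \<Longrightarrow> s1 ''h'' y = 0"
      "s1 ''c'' 0 = i" "i < s ''L'' u" "s1 ''z'' 0 = b" "b = row s u i"
      "b \<in> outer s" "s ''b'' b = b" "b \<in> set (path s v)"
      "\<And>k. k < s ''L'' u \<Longrightarrow> i < k \<Longrightarrow> row s u k \<in> outer s \<Longrightarrow> s ''b'' (row s u k) = row s u k \<Longrightarrow> row s u k \<notin> set (path s v)"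
    for s1 i b
  proof -
    have iu: "i < length (?P u)" "?P b = take (Suc i) (?P u)"
      using path_base_prefix[OF S s(5), of i] 1 by simp_all
    obtain i' where i': "i' < s ''L'' v" "b = row s v i'" using 1(9) by (auto simp: path_def)
    then have Pb: "?P b = take (Suc i') (?P v)" using path_base_prefix[OF S s(6), of i'] 1 by simp
    \<comment> \<open>The path of \<open>b\<close> is a prefix of both paths, so \<open>b\<close>
      has the same position on both; the single number \<open>c\<close> serves both passes.\<close>
    then have "i' = i" using arg_cong[OF iu(2), of length] arg_cong[OF Pb, of length] iu(1) i'(1) by simp
    then have iv: "i < length (?P v)" "?P b = take (Suc i) (?P v)" using i' Pb by auto
    have max: "length (?P y) \<le> Suc i" if y: "y \<in> ?Out" "s ''b'' y = y" "y \<in> set (?P u)" "y \<in> set (?P v)" for y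
    proof -
      obtain k where k: "k < s ''L'' u" "y = row s u k" using y(3) by (auto simp: path_def)
      then have "k \<le> i" using 1(10)[OF k(1)] y by (metis not_le)
      then show ?thesis using path_base_prefix[OF S s(5), of k] k y by simp
    qed
    have max': "length (?P y) \<le> Suc i" if y: "y \<in> ?Out" "s ''b'' y = y" "y \<in> set (?P v)" "y \<in> set (?P u)" for y
      using max y by blast
    have vu: "adj v u" using s(7) adj_commute by blast
    define H where "H = set (drop i (?P u)) \<union> set (drop i (?P v))"
    have bH: "b \<in> H" using 1(6) iu(1) by (auto simp: H_def in_drop_iff intro!: exI[of _ i])
    have OI: "?Out \<inter> ?Inn = {}" by (auto simp: outer_def inner_def)
    have ki: "i < k" if "i \<le> k" "s ''t'' (row s w k) = 1" "row s w i = b" for w k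
      using that 1(7) by (cases "i = k") (auto simp: outer_def)
    have dju: "set (?P v) \<inter> set (drop k (?P u)) = {}" if "k < s ''L'' u" "i \<le> k" "s ''t'' (row s u k) = 1" for k
      by (rule contract_disjoint(1)[OF S s(5,6) _ _ _ max, of k]) (use that ki[of k u] 1 u in \<open>auto simp: inner_def\<close>)
    have djv: "set (?P u) \<inter> set (drop k (?P v)) = {}" if "k < s ''L'' v" "i \<le> k" "s ''t'' (row s v k) = 1" for k
      by (rule contract_disjoint(1)[OF S s(6,5) _ _ _ max', of k]) (use that ki[of k v] 1 i' \<open>i' = i\<close> v in \<open>auto simp: inner_def\<close>)
    have lu: "s ''L'' v + (s ''L'' u - k) \<le> n" if "k < s ''L'' u" "i \<le> k" "s ''t'' (row s u k) = 1" for k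
      using search_join_length[OF S s(5,6) dju[OF that]] by simp
    have lv: "s ''L'' u + (s ''L'' v - k) \<le> n" if "k < s ''L'' v" "i \<le> k" "s ''t'' (row s v k) = 1" for k
      using search_join_length[OF S s(6,5) djv[OF that]] by simp
    define D1 where "D1 = set (drop i (?P u))"
    define X1 where "X1 = {x \<in> D1. s ''t'' x = 1}"
    define D2 where "D2 = set (drop i (?P v))"
    define X2 where "X2 = {x \<in> D2. s ''t'' x = 1}"
    have Hn: "x < n" if "x \<in> D1 \<union> D2" for x
      using that u(5) v(5) by (auto simp: D1_def D2_def in_drop_iff)
    \<comment> \<open>No inner vertex lies on both tails. So the second pass finds the original
      status of the vertices that it treats and does not overwrite a path written by the
      first.\<close>
    have X12: "X1 \<inter> X2 = {}"
    proof (rule ccontr)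
      assume "X1 \<inter> X2 \<noteq> {}"
      then obtain x where x: "x \<in> D1" "x \<in> D2" "s ''t'' x = 1" by (auto simp: X1_def X2_def)
      then obtain k where k: "i \<le> k" "k < s ''L'' u" "x = row s u k" by (auto simp: D1_def in_drop_iff)
      have "x \<in> set (drop k (?P u))" using k by (auto simp: in_drop_iff)
      moreover have "x \<in> set (?P v)" using x(2) set_drop_subset by (auto simp: D2_def dest: in_set_dropD)
      ultimately show False using dju[of k] k x by auto
    qed
    have XZ: "X1 \<union> X2 = ?Inn \<inter> H" using Hn by (auto simp: X1_def X2_def D1_def D2_def H_def inner_def)
    have s1: "s1 ''n'' 0 = n" "s1 ''u'' 0 = u" "s1 ''v'' 0 = v" "s1 ''t'' = s ''t''" "s1 ''b'' = s ''b''" "s1 ''L'' = s ''L''"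
      "path s1 = path s" "row s1 = row s" "s1 ''m'' = s ''m''" "s1 ''r'' = s ''r''"
      using agreeD[OF 1(1)] s by (simp_all add: path_def row_def fun_eq_iff)
    have uX: "u \<notin> X1" "v \<notin> X1" "u \<notin> X2" "v \<notin> X2" using u v by (auto simp: X1_def X2_def)
    have a1: "run B (absorb ''u'' ''v'') s1 (\<lambda>t s'. t + \<phi> s' \<le> 100 * n + 50 + \<phi> s1 \<and> absorbed u v D1 X1 s1 s')"
      by (rule run_absorb) (use s1 u v lu 1(3) in \<open>simp_all add: D1_def X1_def\<close>)
    show ?thesis
    proof (rule run_then_potential[OF a1])
      fix s2
      assume "absorbed u v D1 X1 s1 s2"
      note 2 = absorbedD[OF this]
      have s2: "s2 ''n'' 0 = n" "s2 ''u'' 0 = u" "s2 ''v'' 0 = v" "s2 ''c'' 0 = i" "s2 ''z'' 0 = b" "s2 ''m'' = s ''m''" "s2 ''r'' = s ''r''"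
        using agreeD[OF 2(1)] s1 1(3,5) by auto
      have keep: "s2 ''L'' y = s ''L'' y" "a < n \<Longrightarrow> row s2 y a = row s y a" if "y \<notin> X1" for y a
        using 2(5) that s1 by auto
      have pk: "path s2 y = path s y" if "y \<notin> X1" "s ''L'' y \<le> n" for y
        using path_eqI keep that by blast
      have puv: "path s2 u = path s u" "path s2 v = path s v" "s2 ''L'' u = s ''L'' u" "s2 ''L'' v = s ''L'' v"
        "\<And>k. k < s ''L'' v \<Longrightarrow> row s2 v k = row s v k"
        using pk uX u(3) v(3) keep by auto
      have t2: "s2 ''t'' x = 1 \<longleftrightarrow> s ''t'' x = 1 \<and> x \<notin> X1" for x using 2(2) s1 by auto
      have X2': "X2 = {x \<in> D2. s2 ''t'' x = 1}" using X12 t2 by (auto simp: X2_def)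
      have a2: "run B (absorb ''v'' ''u'') s2 (\<lambda>t s'. t + \<phi> s' \<le> 100 * n + 50 + \<phi> s2 \<and> absorbed v u D2 X2 s2 s')"
        by (rule run_absorb) (use s2 u v lv puv uX 2(2) s1 t2 X2' in \<open>simp_all add: D2_def\<close>)
      show "run B (absorb ''v'' ''u'';;
         ?relabel) s2
         (\<lambda>t s'. t + \<phi> s' \<le> 150 * n + 100 + \<phi> s2 \<and> ?post s')"
      proof (rule run_then_potential[OF a2])
        fix s3
        assume "absorbed v u D2 X2 s2 s3"
        note 3 = absorbedD[OF this]
        have s3: "s3 ''n'' 0 = n" "s3 ''z'' 0 = b" "s3 ''m'' = s ''m''" "s3 ''r'' = s ''r''"
          using agreeD[OF 3(1)] s2 by auto
        have t3: "s3 ''t'' = (\<lambda>y. if y \<in> ?Inn \<inter> H then 2 else s ''t'' y)"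
          using 3(2) 2(2) s1(4) XZ by (auto simp: fun_eq_iff)
        have b3: "s3 ''b'' = (\<lambda>y. if y \<in> ?Inn \<inter> H then b else s ''b'' y)"
          using 3(3) 2(3) s1(5) XZ s2(5) 1(5) by (auto simp: fun_eq_iff)
        have h3: "y < n \<Longrightarrow> s3 ''h'' y = (if y \<in> H then 1 else 0)" for y
          using 3(4) 2(4) 1(2)[of y] by (auto simp: H_def D1_def D2_def)
        have keep3: "s3 ''L'' y = s2 ''L'' y" "a < n \<Longrightarrow> row s3 y a = row s2 y a" if "y \<notin> X2" for y a
          using 3(5) that by auto
        have pk3: "path s3 y = path s2 y" if "y \<notin> X2" "s2 ''L'' y \<le> n" for y
          using path_eqI keep3 that by blast
        define Q where "Q k \<longleftrightarrow> s3 ''t'' k = 2 \<and> s3 ''h'' (s3 ''b'' k) = 1" for k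
        have fill: "run B ?relabel s3
          (\<lambda>t s'. agree {''b'', ''i''} s3 s' \<and> t \<le> n * (bcost ?cond + acost (V ''z'') + 20) + 10 \<and>
           s' ''b'' = (\<lambda>y. if y < n \<and> Q y then b else s3 ''b'' y))"
        proof (rule run_Fill)
          fix k s' assume k: "k < n" "agree {''b'', ''i''} s3 s'" "s' ''i'' 0 = k" "s' ''b'' k = s3 ''b'' k"
          have "s' ''t'' = s3 ''t''" "s' ''h'' = s3 ''h''" "s' ''z'' = s3 ''z''" using agreeD[OF k(2)] by auto
          then show "bfits B s' ?cond \<and> bval s' ?cond = Q k \<and> (Q k \<longrightarrow> afits B s' (V ''z'') \<and> aval s' (V ''z'') = b)"
            using k B1 s3 by (simp add: Q_def)
        qed (use s3 B1 in auto)
        show "run B ?relabel s3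
          (\<lambda>t s'. t + \<phi> s' \<le> 40 * n + 10 + \<phi> s3 \<and> ?post s')"
        proof (rule run_mono[OF fill], elim conjE)
          fix t s4
          assume 4: "agree {''b'', ''i''} s3 s4" "t \<le> n * (bcost ?cond + acost (V ''z'') + 20) + 10"
            "s4 ''b'' = (\<lambda>y. if y < n \<and> Q y then b else s3 ''b'' y)"
          have s4: "s4 ''t'' = s3 ''t''" "path s4 = path s3" "s4 ''m'' = s ''m''" "s4 ''r'' = s ''r''" "\<phi> s4 = \<phi> s3"
            using agreeD[OF 4(1)] s3 by (simp_all add: path_def row_def \<phi>_def fun_eq_iff)
          have O4: "outer s4 = ?Out \<union> ?Inn \<inter> H" "inner s4 = ?Inn - H"
            using s4(1) t3 by (auto simp: outer_def inner_def)
          have b4: "s4 ''b'' y = (if y \<in> ?Inn \<or> s ''b'' y \<in> H then b else s ''b'' y)" if y: "y \<in> ?Out \<union> ?Inn \<inter> H" for y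
          proof -
            have yn: "y < n" "s3 ''t'' y = 2" using y t3 by (auto simp: outer_def inner_def)
            show ?thesis
            proof (cases "y \<in> ?Inn")
              case True
              then have "s3 ''b'' y = b" using y b3 OI by auto
              then show ?thesis using True 4(3) by simp
            next
              case False
              then have yO: "y \<in> ?Out" "s3 ''b'' y = s ''b'' y" using y b3 by auto
              have "s ''b'' y < n" using treeD(7)[OF s(2) yO(1)] .
              then have "Q y \<longleftrightarrow> s ''b'' y \<in> H" using yn yO h3 by (simp add: Q_def)
              then show ?thesis using False 4(3) yn yO by simp
            qed
          qed
          have new_u: "path s4 (?P u ! j) = ?P v @ rev (drop j (?P u))" if j: "i < j" "j < length (?P u)" "?P u ! j \<in> ?Inn" for j
          proof -
            have jn: "j < s ''L'' u" "i \<le> j" "s ''t'' (row s u j) = 1" using j by (auto simp: inner_def)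
            then have x: "row s u j \<in> X1" by (auto simp: X1_def D1_def in_drop_iff)
            then have p2: "path s2 (row s u j) = ?P v @ rev (drop j (?P u))" using 2(6) s1 1(3) jn by simp
            have "s2 ''L'' (row s u j) \<le> n" using arg_cong[OF p2, of length] lu[OF jn] by simp
            then show ?thesis using pk3[of "row s u j"] x X12 p2 s4 jn by auto
          qed
          have new_v: "path s4 (?P v ! j) = ?P u @ rev (drop j (?P v))" if j: "i < j" "j < length (?P v)" "?P v ! j \<in> ?Inn" for j
          proof -
            have jn: "j < s ''L'' v" "i \<le> j" "s ''t'' (row s v j) = 1" using j by (auto simp: inner_def)
            then have x: "row s v j \<in> X2" by (auto simp: X2_def D2_def in_drop_iff)
            then show ?thesis using 3(6) s2 puv jn s4 by simp
          qed
          have old: "path s4 y = ?P y" if "y \<in> ?Out" for y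
          proof -
            have y: "y \<notin> X1" "y \<notin> X2" "s ''L'' y \<le> n" using treeD[OF s(2) that] by (auto simp: X1_def X2_def)
            then show ?thesis using pk3[of y] pk[of y] keep(1)[of y] s4 by simp
          qed
          have "tree s4" unfolding tree_def O4 s4(3,4)
            by (rule search_contract[OF S s(5,6,7) 1(7,8) iu iv max H_def b4 old new_u new_v]) assumption+
          moreover have "agree ?A s s4" using 1(1) 2(1) 3(1) 4(1) by (auto simp: agree_def)
          moreover have "?Inn \<inter> H \<noteq> {}"
            using contract_inner_exists[OF S s(5,6,8) 1(7,8) iu iv] by (auto simp: H_def)
          then have "\<exists>Z\<subseteq>inner s. Z \<noteq> {} \<and> s4 ''t'' = (\<lambda>y. if y \<in> Z then 2 else s ''t'' y)"
            using t3 s4(1) by (intro exI[of _ "?Inn \<inter> H"]) auto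
          moreover have "\<forall>y\<in>outer s. \<forall>z\<in>outer s. s ''b'' y = s ''b'' z \<longrightarrow> s4 ''b'' y = s4 ''b'' z"
            using b4 OI by auto
          moreover have "t + \<phi> s4 \<le> 40 * n + 10 + \<phi> s3" using 4(2) s4(5) by simp
          ultimately show "t + \<phi> s4 \<le> 40 * n + 10 + \<phi> s3 \<and> ?post s4" by blast
        qed
      qed simp
    qed simp
  qed
  show ?thesis unfolding contract_def
  proof (rule run_then_potential)
    show "run B find_meet s (\<lambda>t s'. t + \<phi> s' \<le> (n * 220 + 100) + \<phi> s \<and> met u v s s')"
    proof (rule run_mono[OF run_find_meet[OF s(1-6)]])
      fix t s' assume *: "t \<le> n * 220 + 100 \<and> met u v s s'"
      then have "\<phi> s' = \<phi> s" by (intro \<phi>_cong) (simp add: agree_def met_def)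
      then show "t + \<phi> s' \<le> (n * 220 + 100) + \<phi> s \<and> met u v s s'" using * by simp
    qed
  next
    fix s1
    assume 1: "met u v s s1"
    show "run B (absorb ''u'' ''v'';; absorb ''v'' ''u'';;
     ?relabel) s1
     (\<lambda>t s'. t + \<phi> s' \<le> 250 * n + 150 + \<phi> s1 \<and> ?post s')"
      by (rule rest[of s1 "s1 ''c'' 0" "s1 ''z'' 0"]) (use 1 in \<open>auto simp: met_def\<close>)
  qed simp
qed

subsection \<open>The search for an augmenting path\<close>

definition grow :: com where
  "grow =
    ''y'' ::= (Cell ''m'' (V ''v''));;
    Assign ''t'' (V ''v'') (Const 1);;
    Assign ''t'' (V ''y'') (Const 2);;
    Assign ''b'' (V ''y'') (V ''y'');;
    ''e'' ::= (Const 0);;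
    ''q'' ::= (Cell ''L'' (V ''u''));;
    write_row (at_row ''P'' (V ''u'') (V ''a''));;
    Assign ''P'' (Plus (Times (V ''y'') (V ''n'')) (V ''q'')) (V ''v'');;
    Assign ''P'' (Plus (Times (V ''y'') (V ''n'')) (Plus (V ''q'') (Const 1))) (V ''y'');;
    Assign ''L'' (V ''y'') (Plus (V ''q'') (Const 2))"

text \<open>The visited set is closed under \<open>m\<close>, so the path stays simple with
  \<open>w\<close> and \<open>m w\<close> appended and still fits into a row.\<close>

lemma grow_room:
  assumes S: "search m r Out Inn base P" and u: "u \<in> Out" and w: "w < n" "w \<notin> Out \<union> Inn" "m w \<noteq> w"
  shows "m w < n" "m w \<notin> Out \<union> Inn" "length (P u) + 2 \<le> n"
proof -
  have mm: "m (m w) = w" "m w < n" using matingD searchD(1)[OF S] w(1) by blast+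
  then show "m w < n" by simp
  show mw: "m w \<notin> Out \<union> Inn" using visited_mate[OF S, of "m w"] mm w by auto
  have p: "distinct (P u)" "set (P u) \<subseteq> {..<n}" using searchD(10)[OF S u] by (auto simp: altpath_def)
  have "set (P u) \<subseteq> Out \<union> Inn" using path_subset[OF S u] .
  then have d: "distinct (P u @ [w, m w])" "set (P u @ [w, m w]) \<subseteq> {..<n}" using p w mw mm by auto
  then show "length (P u) + 2 \<le> n" using card_mono[OF _ d(2)] distinct_card[OF d(1)] by simp
qed

lemma augment_room:
  assumes S: "search m r Out Inn base P" and u: "u \<in> Out" and w: "w < n" "w \<notin> Out \<union> Inn"
  shows "w \<notin> set (P u)" "length (P u) + 1 \<le> n"
proof -
  have p: "distinct (P u)" "set (P u) \<subseteq> {..<n}" using searchD(10)[OF S u] by (auto simp: altpath_def)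
  show "w \<notin> set (P u)" using path_subset[OF S u] w by blast
  then have d: "distinct (P u @ [w])" "set (P u @ [w]) \<subseteq> {..<n}" using p w by auto
  then show "length (P u) + 1 \<le> n" using card_mono[OF _ d(2)] distinct_card[OF d(1)] by simp
qed

lemma run_grow:
  assumes s: "s ''n'' 0 = n" "tree s" "s ''u'' 0 = u" "s ''v'' 0 = w" "u \<in> outer s" "adj u w"
    "s ''t'' w = 0" "s ''m'' w \<noteq> w"
  shows "run B grow s (\<lambda>t s'. t \<le> 40 * n + 100 \<and> agree {''y'', ''t'', ''b'', ''e'', ''q'', ''a'', ''P'', ''L''} s s' \<and>
    tree s' \<and> s' ''t'' = (s ''t'')(w := 1, s ''m'' w := 2) \<and> (\<forall>y\<in>outer s. s' ''b'' y = s ''b'' y) \<and>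
    s ''m'' w < n \<and> s ''m'' w \<notin> outer s \<union> inner s)"
proof -
  note S = s(2)[unfolded tree_def]
  note u = treeD[OF s(2,5)]
  let ?x = "s ''m'' w" and ?L = "s ''L'' u"
  have wn: "w < n" using s(6) adjD by blast
  have wO: "w \<notin> outer s \<union> inner s" using s(7) by (auto simp: outer_def inner_def)
  have x: "?x < n" "?x \<notin> outer s \<union> inner s" "?L + 2 \<le> n" using grow_room[OF S s(5) wn wO s(8)] by auto
  have ne: "?x \<noteq> u" "w \<noteq> u" using x(2) wO s(5) by auto
  have B1: "0 < B" "1 < B" "2 < B" "n < B" using B_large by auto
  have rx: "?x * n + n \<le> n * n" "u * n + n \<le> n * n" using row_bound x(1) u(1) by auto
  let ?s1 = "s(''y'' := (s ''y'')(0 := ?x), ''t'' := (s ''t'')(w := 1, ?x := 2), ''b'' := (s ''b'')(?x := ?x),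
     ''e'' := (s ''e'')(0 := 0), ''q'' := (s ''q'')(0 := ?L))"
  let ?e = "at_row ''P'' (V ''u'') (V ''a'')"
  let ?F = "\<lambda>s'. agree {''y'', ''t'', ''b'', ''e'', ''q'', ''a'', ''P'', ''L''} s s' \<and>
    tree s' \<and> s' ''t'' = (s ''t'')(w := 1, ?x := 2) \<and> (\<forall>y\<in>outer s. s' ''b'' y = s ''b'' y)"
  have wr: "run B (write_row ?e) ?s1 (\<lambda>t s'. agree {''P'', ''a''} ?s1 s' \<and> t \<le> ?L * (acost ?e + 24) + 9 \<and>
     (\<forall>y a. a < n \<longrightarrow> row s' y a = (if y = ?x \<and> 0 \<le> a \<and> a < 0 + ?L then row s u (a - 0) else row ?s1 y a)))"
  proof (rule run_write_row)
    fix k s' assume k: "k < ?L" "agree {''P'', ''a''} ?s1 s'" "s' ''a'' 0 = k"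
      and r: "\<And>y a. y \<noteq> ?x \<Longrightarrow> a < n \<Longrightarrow> row s' y a = row ?s1 y a"
    have [simp]: "s' ''n'' 0 = n" "s' ''u'' 0 = u" using agreeD[OF k(2)] s by auto
    have kn: "k < n" using k u by simp
    have "row s' u k = row s u k" using r[of u k] ne kn by simp
    then show "afits B s' ?e \<and> aval s' ?e = row s u k"
      using k rx B_large kn by (simp add: row_def)
  qed (use s x in auto)
  have tail: "run B (write_row ?e;;
    Assign ''P'' (Plus (Times (V ''y'') (V ''n'')) (V ''q'')) (V ''v'');;
    Assign ''P'' (Plus (Times (V ''y'') (V ''n'')) (Plus (V ''q'') (Const 1))) (V ''y'');;
    Assign ''L'' (V ''y'') (Plus (V ''q'') (Const 2))) ?s1 (\<lambda>t s'. t \<le> 40 * n + 60 \<and> ?F s')"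
  proof (rule run_then)
    show "run B (write_row ?e) ?s1 (\<lambda>t s'. t \<le> 33 * n + 9 \<and> (agree {''P'', ''a''} ?s1 s' \<and>
     (\<forall>y a. a < n \<longrightarrow> row s' y a = (if y = ?x \<and> a < ?L then row s u a else row s y a))))"
      by (rule run_mono[OF wr]) (use mult_le_mono1[OF u(3), of 33] in auto)
    fix s2 assume 2: "agree {''P'', ''a''} ?s1 s2 \<and>
     (\<forall>y a. a < n \<longrightarrow> row s2 y a = (if y = ?x \<and> a < ?L then row s u a else row s y a))"
    then have ag: "agree {''P'', ''a''} ?s1 s2" 
      and r2: "\<And>y a. a < n \<Longrightarrow> row s2 y a = (if y = ?x \<and> a < ?L then row s u a else row s y a)" by auto
    have s2: "s2 ''y'' 0 = ?x" "s2 ''n'' 0 = n" "s2 ''q'' 0 = ?L" "s2 ''v'' 0 = w" "s2 ''L'' = s ''L''"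
      "s2 ''t'' = (s ''t'')(w := 1, ?x := 2)" "s2 ''b'' = (s ''b'')(?x := ?x)" "s2 ''m'' = s ''m''" "s2 ''r'' = s ''r''"
      using agreeD[OF ag] s by auto
    let ?s3 = "s2(''P'' := (s2 ''P'')(?x * n + ?L := w, ?x * n + (?L + 1) := ?x), ''L'' := (s ''L'')(?x := ?L + 2))"
    have r3: "row ?s3 y a = (if y = ?x \<and> a = ?L then w else if y = ?x \<and> a = ?L + 1 then ?x else row s2 y a)"
      if a: "a < n" for y a
    proof -
      have "y * n + a = ?x * n + ?L \<longleftrightarrow> y = ?x \<and> a = ?L" using row_index_inj[OF a, of ?L y ?x] x by auto
      moreover have "y * n + a = ?x * n + (?L + 1) \<longleftrightarrow> y = ?x \<and> a = ?L + 1"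
        using row_index_inj[OF a, of "?L + 1" y ?x] x by auto
      ultimately show ?thesis by (auto simp: row_def)
    qed
    have ag3: "agree {''y'', ''t'', ''b'', ''e'', ''q'', ''a'', ''P'', ''L''} s ?s3" using ag by (auto simp: agree_def)
    have O3: "outer ?s3 = insert ?x (outer s)" "inner ?s3 = insert w (inner s)"
      using s2 wn x s(7,8) by (auto simp: outer_def inner_def)
    have px: "path ?s3 ?x = path s u @ [w, ?x]"
    proof (rule nth_equalityI)
      fix k assume "k < length (path ?s3 ?x)"
      then have k: "k < ?L + 2" by simp
      then have "path ?s3 ?x ! k = row ?s3 ?x k" by simp
      also have "\<dots> = (if k = ?L then w else if k = ?L + 1 then ?x else row s2 ?x k)" using r3[of k ?x] k x by simp
      also have "\<dots> = (path s u @ [w, ?x]) ! k" using k x r2[of k ?x] by (auto simp: nth_append nth_Cons split: nat.split)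
      finally show "path ?s3 ?x ! k = (path s u @ [w, ?x]) ! k" .
    qed simp
    have po: "path ?s3 y = path s y" if y: "y \<in> outer s" for y
      by (rule path_eqI) (use treeD[OF s(2) y] y x r2 r3 in auto)
    have tr: "tree ?s3"
    proof -
      have b: "\<And>y. y \<in> outer s \<Longrightarrow> ?s3 ''b'' y = s ''b'' y" "?s3 ''b'' ?x = ?x" using s2 x(2) by auto
      have m: "?s3 ''m'' = s ''m''" "?s3 ''r'' = s ''r''" using s2 by auto
      show ?thesis unfolding tree_def O3 m by (rule search_grow[OF S s(5,6) wO s(8) b po px])
    qed
    have fits: "?x * n + ?L < B" "?x * n + (?L + 1) < B" "?x * n < B" "?L + 1 < B" "?L + 2 < B" using rx x B_large by auto
    have b3: "\<forall>y\<in>outer s. s2 ''b'' y = s ''b'' y" using s2 x(2) by auto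
    show "run B (Assign ''P'' (Plus (Times (V ''y'') (V ''n'')) (V ''q'')) (V ''v'');;
    Assign ''P'' (Plus (Times (V ''y'') (V ''n'')) (Plus (V ''q'') (Const 1))) (V ''y'');;
    Assign ''L'' (V ''y'') (Plus (V ''q'') (Const 2))) s2 (\<lambda>t s'. t \<le> 50 \<and> ?F s')"
      using B1 fits tr ag3 b3 by (simp add: run_Seq s2)
  qed simp
  have "run B grow s (\<lambda>t s'. t \<le> 40 * n + 100 \<and> ?F s')"
    unfolding grow_def
    using B1 s tail[unfolded row_def] by (simp add: run_Seq[of B "Assign _ _ _"]) (auto elim!: run_mono)
  then show ?thesis using x by (auto elim!: run_mono)
qed

text \<open>Appending the exposed endpoint to the row of \<open>u\<close> makes the augmenting path
  one array segment with an even number of vertices; each even position is then mated with its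
  successor.\<close>

definition flip :: com where
  "flip =
    ''q'' ::= (Cell ''L'' (V ''u''));;
    Assign ''P'' (Plus (Times (V ''u'') (V ''n'')) (V ''q'')) (V ''v'');;
    For ''a'' ''q'' (Cond (Equal (Mod (V ''a'') (Const 2)) (Const 0))
      (''y'' ::= (at_row ''P'' (V ''u'') (V ''a''));;
       ''z'' ::= (at_row ''P'' (V ''u'') (Plus (V ''a'') (Const 1)));;
       Assign ''m'' (V ''y'') (V ''z'');;
       Assign ''m'' (V ''z'') (V ''y'')) Skip)"

lemma run_flip:
  assumes s: "s ''n'' 0 = n" "tree s" "s ''u'' 0 = u" "s ''v'' 0 = w" "u \<in> outer s" "adj u w"
    "s ''t'' w = 0" "s ''m'' w = w"
  shows "run B flip s (\<lambda>t s'. t \<le> 80 * n + 50 \<and> agree {''q'', ''P'', ''a'', ''y'', ''z'', ''m''} s s' \<and>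
    mating (s' ''m'') \<and> (\<forall>x<n. s ''m'' x \<noteq> x \<or> x = s ''r'' 0 \<longrightarrow> s' ''m'' x \<noteq> x))"
proof -
  note S = s(2)[unfolded tree_def]
  note u = treeD[OF s(2,5)]
  let ?L = "s ''L'' u" and ?m = "s ''m''"
  define q where "q = path s u @ [w]"
  have wn: "w < n" using s(6) adjD by blast
  have wO: "w \<notin> outer s \<union> inner s" using s(7) by (auto simp: outer_def inner_def)
  have room: "w \<notin> set (path s u)" "?L + 1 \<le> n" using augment_room[OF S s(5) wn wO] by auto
  have B1: "0 < B" "1 < B" "2 < B" "n < B" using B_large by auto
  have ru: "u * n + n \<le> n * n" using row_bound u(1) by auto
  have dq: "distinct q" "length q = Suc ?L" using u(6) room(1) by (auto simp: q_def)
  have qn: "q ! k < n" if "k \<le> ?L" for k using that u(5) wn by (auto simp: q_def nth_append)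
  let ?s1 = "s(''q'' := (s ''q'')(0 := ?L), ''P'' := (s ''P'')(u * n + ?L := w))"
  have q1: "?s1 ''P'' (u * n + k) = q ! k" if "k \<le> ?L" for k
    using that by (auto simp: q_def nth_append row_def)
  define I where "I k s' \<longleftrightarrow> agree {''m'', ''y'', ''z'', ''a''} ?s1 s' \<and>
    (\<forall>c<k. even c \<longrightarrow> s' ''m'' (q ! c) = q ! Suc c \<and> s' ''m'' (q ! Suc c) = q ! c) \<and>
    (\<forall>x. x \<notin> set q \<longrightarrow> s' ''m'' x = ?m x)" for k s'
  let ?body = "Cond (Equal (Mod (V ''a'') (Const 2)) (Const 0))
      (''y'' ::= (at_row ''P'' (V ''u'') (V ''a''));;
       ''z'' ::= (at_row ''P'' (V ''u'') (Plus (V ''a'') (Const 1)));;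
       Assign ''m'' (V ''y'') (V ''z'');;
       Assign ''m'' (V ''z'') (V ''y'')) Skip"
  have loop: "run B (For ''a'' ''q'' ?body) ?s1 (\<lambda>t s'. I ?L s' \<and> s' ''a'' 0 = ?L \<and> s' ''q'' 0 = ?L \<and> t \<le> ?L * (60 + 12) + 9)"
  proof (rule run_For)
    show "I 0 (put ?s1 ''a'' 0)" by (simp add: I_def)
    fix k s' assume k: "k < ?L" "I k s'" "s' ''a'' 0 = k" "s' ''q'' 0 = ?L"
    have ag: "agree {''m'', ''y'', ''z'', ''a''} ?s1 s'" using k by (simp add: I_def)
    have [simp]: "s' ''n'' 0 = n" "s' ''u'' 0 = u" using agreeD[OF ag] s by auto
    have P': "s' ''P'' = ?s1 ''P''" using agreeD[OF ag] by simp
    have [simp]: "s' ''P'' (u * n + k) = q ! k" unfolding P' by (rule q1) (use k in simp)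
    have [simp]: "s' ''P'' (u * n + (k + 1)) = q ! Suc k"
      unfolding P' Suc_eq_plus1 by (rule q1) (use k in simp)
    show "run B ?body s' (\<lambda>t s''. s'' ''a'' 0 = k \<and> s'' ''q'' 0 = ?L \<and> I (Suc k) (put s'' ''a'' (Suc k)) \<and> t \<le> 60)"
    proof (cases "even k")
      case False
      then have "I (Suc k) s'" using k(2) by (auto simp: I_def less_Suc_eq)
      then show ?thesis using False k B1 by (simp add: run_Cond I_def odd_iff_mod_2_eq_one)
    next
      case True
      define m2 where "m2 = (s' ''m'')(q ! k := q ! Suc k, q ! Suc k := q ! k)"
      have ne: "q ! c \<noteq> q ! k" "q ! c \<noteq> q ! Suc k" "q ! Suc c \<noteq> q ! k" "q ! Suc c \<noteq> q ! Suc k"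
        if "c < k" "even c" for c
      proof -
        have "Suc c \<noteq> k" using that True by auto
        then show "q ! c \<noteq> q ! k" "q ! c \<noteq> q ! Suc k" "q ! Suc c \<noteq> q ! k" "q ! Suc c \<noteq> q ! Suc k"
          using that k(1) dq by (auto simp: nth_eq_iff_index_eq)
      qed
      have "q ! k \<noteq> q ! Suc k" using k(1) dq by (auto simp: nth_eq_iff_index_eq)
      then have "\<forall>c<Suc k. even c \<longrightarrow> m2 (q ! c) = q ! Suc c \<and> m2 (q ! Suc c) = q ! c"
        using k(2) ne by (auto simp: I_def less_Suc_eq m2_def)
      moreover have "q ! k \<in> set q" "q ! Suc k \<in> set q" using k(1) dq by auto
      then have "\<forall>x. x \<notin> set q \<longrightarrow> m2 x = ?m x" using k(2) by (auto simp: I_def m2_def)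
      ultimately have "I (Suc k) (s'(''y'' := f, ''z'' := g, ''m'' := m2, ''a'' := h))" for f g h
        using ag by (simp add: I_def)
      then show ?thesis
        using True k(1,3,4) B1 ru B_large room
        by (simp add: run_Cond run_Seq even_iff_mod_2_eq_zero flip: m2_def)
    qed
  qed (use B1 u in auto)
  have "run B (For ''a'' ''q'' ?body) ?s1 (\<lambda>t s'. t \<le> 80 * n + 20 \<and> agree {''q'', ''P'', ''a'', ''y'', ''z'', ''m''} s s' \<and>
    mating (s' ''m'') \<and> (\<forall>x<n. ?m x \<noteq> x \<or> x = s ''r'' 0 \<longrightarrow> s' ''m'' x \<noteq> x))"
  proof (rule run_mono[OF loop], elim conjE)
    fix t s' assume 1: "I ?L s'" "t \<le> ?L * (60 + 12) + 9"
    have a: "adj (last (path s u)) w" using searchD(11)[OF S s(5)] s(6) by simp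
    have aug: "mating (s' ''m'')" "\<And>x. x < n \<Longrightarrow> ?m x \<noteq> x \<or> x = s ''r'' 0 \<Longrightarrow> s' ''m'' x \<noteq> x"
      using augment[OF searchD(1,2)[OF S] searchD(10)[OF S s(5)] a room(1) s(8) q_def, of "s' ''m''"] 1(1)
      by (auto simp: I_def)
    moreover have "agree {''q'', ''P'', ''a'', ''y'', ''z'', ''m''} s s'" using 1(1) by (auto simp: I_def agree_def)
    moreover have "t \<le> 80 * n + 20" using 1(2) mult_le_mono1[OF u(3), of 72] by simp
    ultimately show "t \<le> 80 * n + 20 \<and> agree {''q'', ''P'', ''a'', ''y'', ''z'', ''m''} s s' \<and>
      mating (s' ''m'') \<and> (\<forall>x<n. ?m x \<noteq> x \<or> x = s ''r'' 0 \<longrightarrow> s' ''m'' x \<noteq> x)" by blast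
  qed
  then show ?thesis unfolding flip_def
    using B1 s ru B_large room by (simp add: run_Seq[of B "Assign _ _ _"]) (auto elim!: run_mono)
qed

section \<open>Invariant and potential of one search\<close>

definition stored :: "mem \<Rightarrow> bool" where
  "stored s \<longleftrightarrow> s ''n'' 0 = n \<and> (\<forall>u<n. \<forall>w<n. s ''adj'' (u * n + w) = (if adj u w then 1 else 0))"

lemma stored_agree: "agree X s s' \<Longrightarrow> ''n'' \<notin> X \<Longrightarrow> ''adj'' \<notin> X \<Longrightarrow> stored s' \<longleftrightarrow> stored s"
  by (simp add: stored_def agree_def)

definition non_outer :: "mem \<Rightarrow> nat" where "non_outer s = card {y. y < n \<and> s ''t'' y \<noteq> 2}"
definition undone :: "mem \<Rightarrow> nat" where "undone s = card {y. y < n \<and> s ''d'' y = 0}"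

lemma \<phi>_eq: "\<phi> s = (80 * n + 300) * non_outer s" by (simp add: \<phi>_def non_outer_def)

lemma non_outer_less:
  assumes "Z \<noteq> {}" "\<And>y. y \<in> Z \<Longrightarrow> y < n \<and> s ''t'' y \<noteq> 2 \<and> s' ''t'' y = 2" "\<And>y. s ''t'' y = 2 \<Longrightarrow> s' ''t'' y = 2"
  shows "non_outer s' < non_outer s"
  unfolding non_outer_def
proof (rule psubset_card_mono)
  show "{y. y < n \<and> s' ''t'' y \<noteq> 2} \<subset> {y. y < n \<and> s ''t'' y \<noteq> 2}" using assms by blast
qed simp

text \<open>The flag \<open>d\<close> records a scan in the past. A neighbour that was inner then
  may have become outer since, with another base, so equality of bases is claimed only between
  flagged vertices: a vertex that turned outer later is unflagged, and its own scan will find the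
  edge. Once all outer vertices are flagged, this is the hypothesis of
  \<open>no_perfect_matching\<close>.\<close>

definition settled :: "mem \<Rightarrow> bool" where
  "settled s \<longleftrightarrow> (\<forall>u<n. s ''d'' u \<noteq> 0 \<longrightarrow> u \<in> outer s \<and>
     (\<forall>w. adj u w \<longrightarrow> w \<in> outer s \<union> inner s \<and> (w \<in> outer s \<longrightarrow> s ''d'' w \<noteq> 0 \<longrightarrow> s ''b'' w = s ''b'' u)))"

text \<open>Growing and contracting enlarge the visited set, keep outer vertices outer, and merge
  classes without splitting any; so the result of a scan remains valid.\<close>

lemma settled_transfer:
  assumes s: "settled s" and d: "s' ''d'' = s ''d''" and O: "outer s \<subseteq> outer s'" "outer s \<union> inner s \<subseteq> outer s' \<union> inner s'"
    and b: "\<And>y z. y \<in> outer s \<Longrightarrow> z \<in> outer s \<Longrightarrow> s ''b'' y = s ''b'' z \<Longrightarrow> s' ''b'' y = s' ''b'' z"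
  shows "settled s'"
  unfolding settled_def
proof (intro allI impI conjI)
  fix x w assume x: "x < n" "s' ''d'' x \<noteq> 0"
  then have st: "x \<in> outer s" "\<And>w. adj x w \<Longrightarrow> w \<in> outer s \<union> inner s \<and> (w \<in> outer s \<longrightarrow> s ''d'' w \<noteq> 0 \<longrightarrow> s ''b'' w = s ''b'' x)"
    using s d by (auto simp: settled_def)
  then show "x \<in> outer s'" using O by blast
  assume w: "adj x w"
  then show "w \<in> outer s' \<union> inner s'" using st(2) O by blast
  assume "s' ''d'' w \<noteq> 0"
  then have wd: "s ''d'' w \<noteq> 0" "w < n" using d adjD w by auto
  then have "w \<in> outer s" using s by (auto simp: settled_def)
  then show "s' ''b'' w = s' ''b'' x" using st w wd b by blast
qed

definition running :: "(nat \<Rightarrow> nat) \<Rightarrow> nat \<Rightarrow> mem \<Rightarrow> bool" where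
  "running m r s \<longleftrightarrow> stored s \<and> s ''r'' 0 = r \<and> s ''g'' 0 = 1 \<and> s ''o'' 0 = 1 \<and> s ''m'' = m \<and> tree s \<and>
     (\<forall>y<n. s ''t'' y \<le> 2) \<and> settled s"

text \<open>\<open>m\<close> and \<open>r\<close> are the matching and the root with which the
  search began. Failure is a statement about all perfect matchings, not about augmenting paths from
  \<open>r\<close>.\<close>

definition finished :: "(nat \<Rightarrow> nat) \<Rightarrow> nat \<Rightarrow> mem \<Rightarrow> bool" where
  "finished m r s \<longleftrightarrow> stored s \<and> s ''r'' 0 = r \<and> s ''g'' 0 = 0 \<and>
     (s ''o'' 0 = 1 \<and> mating (s ''m'') \<and> (\<forall>x<n. m x \<noteq> x \<or> x = r \<longrightarrow> s ''m'' x \<noteq> x) \<or>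
      s ''o'' 0 = 0 \<and> (\<forall>F. \<not> matching_cover {..<n} E 1 F))"

text \<open>Each step makes a vertex outer, flags a vertex, or clears \<open>g\<close>. Any of these
  releases \<open>1000 * n + 1000\<close>, which exceeds the cost of a step once
  \<open>\<phi>\<close> has paid for the paths written in a contraction.\<close>

definition \<psi> :: "mem \<Rightarrow> nat" where
  "\<psi> s = \<phi> s + (1000 * n + 1000) * (non_outer s + undone s + s ''g'' 0)"

lemma running_agree:
  assumes "running m r s" "agree X s s'"
    "X \<inter> {''n'', ''adj'', ''r'', ''g'', ''o'', ''m'', ''t'', ''b'', ''P'', ''L'', ''d''} = {}"
  shows "running m r s'" "\<psi> s' = \<psi> s" "outer s' = outer s" "inner s' = inner s"
proof -
  have e: "s' x = s x" if "x \<in> {''n'', ''adj'', ''r'', ''g'', ''o'', ''m'', ''t'', ''b'', ''P'', ''L'', ''d''}" for x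
    using assms(2,3) that by (auto simp: agree_def)
  show o: "outer s' = outer s" "inner s' = inner s" by (simp_all add: outer_def inner_def e)
  have "path s' = path s" by (simp add: path_def row_def fun_eq_iff e)
  then show "running m r s'" using assms(1) by (auto simp: running_def stored_def tree_def settled_def e o)
  show "\<psi> s' = \<psi> s" by (simp add: \<psi>_def \<phi>_def non_outer_def undone_def e)
qed

lemma \<psi>_drop:
  assumes "non_outer s' < non_outer s" "undone s' = undone s" "s' ''g'' 0 = s ''g'' 0" "t + \<phi> s' \<le> T + \<phi> s"
  shows "t + \<psi> s' + (1000 * n + 1000) \<le> T + \<psi> s"
proof -
  have "(1000 * n + 1000) * (non_outer s' + 1) \<le> (1000 * n + 1000) * non_outer s"
    using assms(1) by (intro mult_le_mono2) simp
  then show ?thesis using assms by (simp add: \<psi>_def algebra_simps)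
qed

definition act :: com where
  "act = Cond (Equal (Cell ''t'' (V ''v'')) (Const 2)) contract
     (Cond (Equal (Cell ''m'' (V ''v'')) (V ''v'')) (flip;; ''g'' ::= (Const 0)) grow)"

lemma run_act:
  assumes J: "running m r s" and uv: "s ''u'' 0 = u" "s ''v'' 0 = v" "u \<in> outer s" "adj u v"
    and c: "s ''t'' v = 0 \<or> s ''t'' v = 2 \<and> s ''b'' v \<noteq> s ''b'' u"
  shows "run B act s (\<lambda>t s'. (running m r s' \<or> finished m r s') \<and> t + 300 * n + 300 + \<psi> s' \<le> \<psi> s)"
proof -
  have Jd: "stored s" "s ''n'' 0 = n" "s ''r'' 0 = r" "s ''g'' 0 = 1" "s ''o'' 0 = 1" "s ''m'' = m" "tree s" "settled s"
    and t2: "\<And>y. y < n \<Longrightarrow> s ''t'' y \<le> 2" using J by (auto simp: running_def stored_def)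
  have vn: "v < n" using uv(4) adjD by blast
  have B1: "0 < B" "1 < B" "2 < B" using B_large by auto
  consider (con) "s ''t'' v = 2" "s ''b'' v \<noteq> s ''b'' u" | (aug) "s ''t'' v = 0" "m v = v" | (gro) "s ''t'' v = 0" "m v \<noteq> v"
    using c by argo
  then show ?thesis
  proof cases
    case con
    then have vO: "v \<in> outer s" using vn by (simp add: outer_def)
    let ?A = "{''k'', ''h'', ''i'', ''l'', ''j'', ''c'', ''z'', ''y'', ''t'', ''b'', ''e'', ''q'', ''a'', ''P'', ''L''}"
    have "run B contract s (\<lambda>t s'. (running m r s' \<or> finished m r s') \<and> t + 320 * n + 320 + \<psi> s' \<le> \<psi> s)"
    proof (rule run_mono[OF run_contract[OF Jd(2,7) uv(1,2,3) vO uv(4) con(2)[symmetric]]], elim conjE exE)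
      fix t s' Z
      assume 1: "t + \<phi> s' \<le> 600 * n + 300 + \<phi> s" "agree ?A s s'" "tree s'"
        "Z \<subseteq> inner s" "Z \<noteq> {}" "s' ''t'' = (\<lambda>y. if y \<in> Z then 2 else s ''t'' y)"
        "\<forall>y\<in>outer s. \<forall>z\<in>outer s. s ''b'' y = s ''b'' z \<longrightarrow> s' ''b'' y = s' ''b'' z"
      have e: "s' ''n'' = s ''n''" "s' ''r'' = s ''r''" "s' ''g'' = s ''g''" "s' ''o'' = s ''o''" "s' ''m'' = s ''m''" "s' ''d'' = s ''d''"
        using agreeD[OF 1(2)] by auto
      have O: "outer s' = outer s \<union> Z" "inner s' = inner s - Z"
        using 1(4,6) by (auto simp: outer_def inner_def)
      have "settled s'" by (rule settled_transfer[OF Jd(8)], rule e(6)) (use O 1(4,7) in blast)+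
      moreover have "\<forall>y<n. s' ''t'' y \<le> 2" using 1(6) t2 by auto
      moreover have "stored s'" using Jd(1) 1(2) stored_agree by auto
      ultimately have "running m r s'" using 1(3) Jd by (simp add: running_def e)
      moreover have "non_outer s' < non_outer s"
        by (rule non_outer_less[OF 1(5)]) (use 1(4,6) in \<open>auto simp: inner_def\<close>)
      then have "t + \<psi> s' + (1000 * n + 1000) \<le> (600 * n + 300) + \<psi> s"
        by (rule \<psi>_drop) (use 1(1) e in \<open>auto simp: undone_def\<close>)
      ultimately show "(running m r s' \<or> finished m r s') \<and> t + 320 * n + 320 + \<psi> s' \<le> \<psi> s" by simp
    qed
    then show ?thesis unfolding act_def using con uv B1 by (simp add: run_Cond) (auto elim!: run_mono)
  next
    case aug
    have mv: "s ''m'' v = v" using aug Jd by simp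
    have "run B (flip;; ''g'' ::= (Const 0)) s
      (\<lambda>t s'. (running m r s' \<or> finished m r s') \<and> t + 320 * n + 320 + \<psi> s' \<le> \<psi> s)"
    proof (rule run_SeqI[OF run_flip[OF Jd(2,7) uv aug(1) mv]], elim conjE)
      fix t s'
      assume 1: "t \<le> 80 * n + 50" "agree {''q'', ''P'', ''a'', ''y'', ''z'', ''m''} s s'" "mating (s' ''m'')"
        "\<forall>x<n. s ''m'' x \<noteq> x \<or> x = s ''r'' 0 \<longrightarrow> s' ''m'' x \<noteq> x"
      let ?s = "put s' ''g'' 0"
      have ag: "agree {''q'', ''P'', ''a'', ''y'', ''z'', ''m'', ''g''} s ?s" using 1(2) by (auto simp: agree_def)
      have "stored ?s" using Jd(1) stored_agree[OF ag] by simp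
      moreover have e: "?s ''r'' = s ''r''" "?s ''o'' = s ''o''" "?s ''t'' = s ''t''" "?s ''d'' = s ''d''" using agreeD[OF ag] by auto
      ultimately have "finished m r ?s" using 1(3,4) Jd by (auto simp: finished_def)
      moreover have "\<psi> ?s + (1000 * n + 1000) = \<psi> s" using Jd(4) e by (simp add: \<psi>_def \<phi>_def non_outer_def undone_def algebra_simps)
      ultimately show "run B (''g'' ::= (Const 0)) s'
         (\<lambda>t' s'. (running m r s' \<or> finished m r s') \<and> t + t' + 320 * n + 320 + \<psi> s' \<le> \<psi> s)"
        using 1(1) B1 by simp
    qed
    then show ?thesis unfolding act_def using aug uv B1 mv by (simp add: run_Cond) (auto elim!: run_mono)
  next
    case gro
    have mv: "s ''m'' v \<noteq> v" using gro Jd by simp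
    have "run B grow s (\<lambda>t s'. (running m r s' \<or> finished m r s') \<and> t + 320 * n + 320 + \<psi> s' \<le> \<psi> s)"
    proof (rule run_mono[OF run_grow[OF Jd(2,7) uv gro(1) mv]], elim conjE)
      fix t s'
      assume 1: "t \<le> 40 * n + 100" "agree {''y'', ''t'', ''b'', ''e'', ''q'', ''a'', ''P'', ''L''} s s'"
        "tree s'" "s' ''t'' = (s ''t'')(v := 1, s ''m'' v := 2)" "\<forall>y\<in>outer s. s' ''b'' y = s ''b'' y"
        "s ''m'' v < n" "s ''m'' v \<notin> outer s \<union> inner s"
      let ?x = "s ''m'' v"
      have e: "s' ''n'' = s ''n''" "s' ''r'' = s ''r''" "s' ''g'' = s ''g''" "s' ''o'' = s ''o''" "s' ''m'' = s ''m''" "s' ''d'' = s ''d''"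
        using agreeD[OF 1(2)] by auto
      have O: "outer s' = insert ?x (outer s)" "inner s' = insert v (inner s)"
        using 1(4,6,7) vn gro mv by (auto simp: outer_def inner_def)
      have "settled s'" by (rule settled_transfer[OF Jd(8)], rule e(6)) (use O 1(5) in auto)
      moreover have "\<forall>y<n. s' ''t'' y \<le> 2" using 1(4) t2 by auto
      moreover have "stored s'" using Jd(1) 1(2) stored_agree by auto
      ultimately have "running m r s'" using 1(3) Jd by (simp add: running_def e)
      moreover have less: "non_outer s' < non_outer s"
        by (rule non_outer_less[of "{?x}"]) (use 1(4,6,7) gro in \<open>auto simp: outer_def\<close>)
      have "\<phi> s' \<le> \<phi> s" unfolding \<phi>_eq using less by (intro mult_le_mono2) simp
      then have "t + \<phi> s' \<le> (40 * n + 100) + \<phi> s" using 1(1) by simp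
      with less have "t + \<psi> s' + (1000 * n + 1000) \<le> (40 * n + 100) + \<psi> s"
        by (intro \<psi>_drop) (use e in \<open>auto simp: undone_def\<close>)
      ultimately show "(running m r s' \<or> finished m r s') \<and> t + 320 * n + 320 + \<psi> s' \<le> \<psi> s" by simp
    qed
    then show ?thesis unfolding act_def using gro uv B1 mv by (simp add: run_Cond) (auto elim!: run_mono)
  qed
qed

text \<open>The disjunction is spelled out by De Morgan, as the language offers only negation and
  conjunction. A neighbour calls for action if it is unvisited or is outer in another class; an
  inner neighbour never does.\<close>

abbreviation actionable :: bexp where
  "actionable \<equiv> Conj (Equal (Cell ''adj'' (Plus (Times (V ''u'') (V ''n'')) (V ''i''))) (Const 1))
     (Neg (Conj (Neg (Equal (Cell ''t'' (V ''i'')) (Const 0)))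
       (Neg (Conj (Equal (Cell ''t'' (V ''i'')) (Const 2))
         (Neg (Equal (Cell ''b'' (V ''i'')) (Cell ''b'' (V ''u''))))))))"

definition step :: com where
  "step =
    Find ''u'' ''i'' ''n'' (Conj (Equal (Cell ''t'' (V ''i'')) (Const 2)) (Equal (Cell ''d'' (V ''i'')) (Const 0)));;
    Cond (Equal (V ''u'') (V ''n''))
      (''o'' ::= (Const 0);; ''g'' ::= (Const 0))
      (Find ''v'' ''i'' ''n'' actionable;;
       Cond (Equal (V ''v'') (V ''n'')) (Assign ''d'' (V ''u'') (Const 1)) act)"

lemma run_step:
  assumes J: "running m r s"
  shows "run B step s (\<lambda>t s'. (running m r s' \<or> finished m r s') \<and> t + 10 + \<psi> s' \<le> \<psi> s)"
proof -
  have Jd: "stored s" "s ''n'' 0 = n" "s ''r'' 0 = r" "s ''g'' 0 = 1" "s ''o'' 0 = 1" "s ''m'' = m" "tree s" "settled s"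
    and t2: "\<And>y. y < n \<Longrightarrow> s ''t'' y \<le> 2" using J by (auto simp: running_def stored_def)
  have B1: "0 < B" "1 < B" "2 < B" "n < B" using B_large by auto
  let ?b1 = "Conj (Equal (Cell ''t'' (V ''i'')) (Const 2)) (Equal (Cell ''d'' (V ''i'')) (Const 0))"
  define Q1 where "Q1 k \<longleftrightarrow> s ''t'' k = 2 \<and> s ''d'' k = 0" for k
  have find1: "run B (Find ''u'' ''i'' ''n'' ?b1) s (\<lambda>t s'. agree {''u'', ''i''} s s' \<and> t \<le> n * (bcost ?b1 + 20) + 20 \<and>
     (s' ''u'' 0 = n \<and> (\<forall>k<n. \<not> Q1 k) \<or> s' ''u'' 0 < n \<and> Q1 (s' ''u'' 0) \<and> (\<forall>k<n. s' ''u'' 0 < k \<longrightarrow> \<not> Q1 k)))"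
  proof (rule run_Find)
    fix k s' assume k: "k < n" "agree {''u'', ''i''} s s'" "s' ''i'' 0 = k"
    have "s' ''t'' = s ''t''" "s' ''d'' = s ''d''" using agreeD[OF k(2)] by auto
    then show "bfits B s' ?b1 \<and> bval s' ?b1 = Q1 k" using k B1 by (simp add: Q1_def)
  qed (use Jd B1 in auto)
  show ?thesis unfolding step_def
  proof (rule run_SeqI[OF find1], elim conjE)
    fix t1 s1
    assume ag1: "agree {''u'', ''i''} s s1" and "t1 \<le> n * (bcost ?b1 + 20) + 20"
      and u: "s1 ''u'' 0 = n \<and> (\<forall>k<n. \<not> Q1 k) \<or> s1 ''u'' 0 < n \<and> Q1 (s1 ''u'' 0) \<and> (\<forall>k<n. s1 ''u'' 0 < k \<longrightarrow> \<not> Q1 k)"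
    then have t1: "t1 \<le> 31 * n + 20" by simp
    note R1 = running_agree[OF J ag1]
    have J1: "running m r s1" "\<psi> s1 = \<psi> s" using R1 by auto
    have e1: "s1 ''n'' 0 = n" "s1 ''t'' = s ''t''" "s1 ''d'' = s ''d''" "s1 ''b'' = s ''b''" "s1 ''adj'' = s ''adj''" "s1 ''g'' = s ''g''" "s1 ''r'' = s ''r''"
      using agreeD[OF ag1] Jd by auto
    show "run B (Cond (Equal (V ''u'') (V ''n''))
      (''o'' ::= (Const 0);; ''g'' ::= (Const 0))
      (Find ''v'' ''i'' ''n'' actionable;;
       Cond (Equal (V ''v'') (V ''n'')) (Assign ''d'' (V ''u'') (Const 1)) act)) s1
      (\<lambda>t' s'. (running m r s' \<or> finished m r s') \<and> t1 + t' + 10 + \<psi> s' \<le> \<psi> s)"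
    proof (cases "s1 ''u'' 0 = n")
      case True
      then have none: "\<And>k. k < n \<Longrightarrow> k \<in> outer s \<Longrightarrow> s ''d'' k \<noteq> 0" using u by (auto simp: Q1_def outer_def)
      let ?s = "s1(''o'' := (s1 ''o'')(0 := 0), ''g'' := (s1 ''g'')(0 := 0))"
      have ag: "agree {''u'', ''i'', ''o'', ''g''} s ?s" using ag1 by (auto simp: agree_def)
      \<comment> \<open>Every outer vertex is flagged, so \<open>settled\<close> yields the closure
        of the outer set that a Tutte set requires.\<close>
      have "\<not> matching_cover {..<n} E 1 F" for F
      proof (rule no_perfect_matching[OF Jd(7)[unfolded tree_def]])
        fix x w assume x: "x \<in> outer s" "adj x w"
        have xn: "x < n" "w < n" using adjD x by auto
        then show "w \<in> outer s \<union> inner s \<and> (w \<in> outer s \<longrightarrow> s ''b'' w = s ''b'' x)"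
          using Jd(8) none x unfolding settled_def by blast
      qed
      then have "finished m r ?s" using Jd e1 stored_agree[OF ag] by (simp add: finished_def)
      moreover have "\<psi> ?s + (1000 * n + 1000) = \<psi> s"
        using Jd(4) e1 by (simp add: \<psi>_def \<phi>_def non_outer_def undone_def algebra_simps)
      ultimately show ?thesis using True B1 e1 t1 by (simp add: run_Cond run_Seq)
    next
      case False
      define u0 where "u0 = s1 ''u'' 0"
      have u0: "u0 < n" "s ''t'' u0 = 2" "s ''d'' u0 = 0" "u0 \<in> outer s" using u False by (auto simp: Q1_def outer_def u0_def)
      define Q2 where "Q2 k \<longleftrightarrow> adj u0 k \<and> (s ''t'' k = 0 \<or> s ''t'' k = 2 \<and> s ''b'' k \<noteq> s ''b'' u0)" for k
      have find2: "run B (Find ''v'' ''i'' ''n'' actionable) s1 (\<lambda>t s'. agree {''v'', ''i''} s1 s' \<and> t \<le> n * (bcost actionable + 20) + 20 \<and>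
         (s' ''v'' 0 = n \<and> (\<forall>k<n. \<not> Q2 k) \<or> s' ''v'' 0 < n \<and> Q2 (s' ''v'' 0) \<and> (\<forall>k<n. s' ''v'' 0 < k \<longrightarrow> \<not> Q2 k)))"
      proof (rule run_Find)
        fix k s' assume k: "k < n" "agree {''v'', ''i''} s1 s'" "s' ''i'' 0 = k"
        have e: "s' ''t'' = s ''t''" "s' ''b'' = s ''b''" "s' ''adj'' = s ''adj''" "s' ''n'' 0 = n" "s' ''u'' 0 = u0"
          using agreeD[OF k(2)] e1 by (auto simp: u0_def)
        have "s ''adj'' (u0 * n + k) = (if adj u0 k then 1 else 0)" using Jd(1) k u0 by (simp add: stored_def)
        moreover have "u0 * n + k < B" "u0 * n < B" using row_bound[OF u0(1)] k B_large by auto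
        ultimately show "bfits B s' actionable \<and> bval s' actionable = Q2 k" using k B1 by (auto simp: Q2_def e)
      qed (use e1 B1 in auto)
      have "run B (Find ''v'' ''i'' ''n'' actionable;;
       Cond (Equal (V ''v'') (V ''n'')) (Assign ''d'' (V ''u'') (Const 1)) act) s1
         (\<lambda>t' s'. (running m r s' \<or> finished m r s') \<and> t' + 100 * n + 100 + \<psi> s' \<le> \<psi> s)"
      proof (rule run_SeqI[OF find2], elim conjE)
        fix t2 s2
        assume ag2: "agree {''v'', ''i''} s1 s2" and "t2 \<le> n * (bcost actionable + 20) + 20"
          and v: "s2 ''v'' 0 = n \<and> (\<forall>k<n. \<not> Q2 k) \<or> s2 ''v'' 0 < n \<and> Q2 (s2 ''v'' 0) \<and> (\<forall>k<n. s2 ''v'' 0 < k \<longrightarrow> \<not> Q2 k)"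
        then have t2': "t2 \<le> 60 * n + 20" by simp
        note R2 = running_agree[OF J1(1) ag2]
        have J2: "running m r s2" "\<psi> s2 = \<psi> s" "outer s2 = outer s" using R2 R1 J1 by auto
        have e2: "s2 ''n'' 0 = n" "s2 ''t'' = s ''t''" "s2 ''d'' = s ''d''" "s2 ''b'' = s ''b''" "s2 ''u'' 0 = u0" "s2 ''g'' = s ''g''"
          using agreeD[OF ag2] e1 by (auto simp: u0_def)
        show "run B (Cond (Equal (V ''v'') (V ''n'')) (Assign ''d'' (V ''u'') (Const 1)) act) s2
         (\<lambda>t' s'. (running m r s' \<or> finished m r s') \<and> t2 + t' + 100 * n + 100 + \<psi> s' \<le> \<psi> s)"
        proof (cases "s2 ''v'' 0 = n")
          case True
          then have none: "\<not> Q2 k" if "k < n" for k using v that by auto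
          let ?s = "s2(''d'' := (s2 ''d'')(u0 := 1))"
          have ag: "agree {''v'', ''i'', ''u'', ''d''} s ?s" using ag1 ag2 by (auto simp: agree_def)
          have O: "outer ?s = outer s" "inner ?s = inner s" by (simp_all add: outer_def inner_def e2)
          have p: "path ?s = path s" using agreeD[OF ag] by (simp add: path_def row_def fun_eq_iff)
          have nb: "w \<in> outer s \<union> inner s \<and> (w \<in> outer s \<longrightarrow> s ''b'' w = s ''b'' u0)" if "adj u0 w" for w
          proof -
            have w: "w < n" using that adjD by blast
            then have "s ''t'' w \<noteq> 0" "s ''t'' w = 2 \<longrightarrow> s ''b'' w = s ''b'' u0" using none[OF w] that by (auto simp: Q2_def)
            moreover have "s ''t'' w \<le> 2" using t2 w .
            ultimately show ?thesis using w by (auto simp: outer_def inner_def)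
          qed
          have "settled ?s"
            unfolding settled_def O
          proof (intro allI impI conjI)
            fix x w assume x: "x < n" "?s ''d'' x \<noteq> 0"
            then have xo: "x = u0 \<or> s ''d'' x \<noteq> 0" using e2 by (auto split: if_splits)
            then show xO: "x \<in> outer s" using u0 Jd(8) x(1) by (auto simp: settled_def)
            assume w: "adj x w"
            show "w \<in> outer s \<union> inner s" using xo nb w Jd(8) x(1) unfolding settled_def by blast
            assume wO: "w \<in> outer s" and d: "?s ''d'' w \<noteq> 0"
            have wd: "w = u0 \<or> s ''d'' w \<noteq> 0" using d e2 by (auto split: if_splits)
            have "s ''b'' w = s ''b'' x"
            proof (cases "x = u0")
              case True then show ?thesis using nb w wO by blast
            next
              case xu: False
              show ?thesis
              proof (cases "w = u0")
                \<comment> \<open>For a vertex flagged earlier, equality with the base of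
                  \<open>u0\<close> comes from the present scan of \<open>u0\<close>, the edge being
                  symmetric.\<close>
                case True then show ?thesis using nb[of x] w xO adj_commute by metis
              next
                case False
                then show ?thesis using xu xo wd w wO x(1) Jd(8) unfolding settled_def by blast
              qed
            qed
            then show "?s ''b'' w = ?s ''b'' x" using e2 by simp
          qed
          moreover have "stored ?s" using Jd(1) stored_agree[OF ag] by simp
          moreover have "?s ''r'' = s ''r''" "?s ''o'' = s ''o''" "?s ''m'' = s ''m''" using agreeD[OF ag] by auto
          ultimately have "running m r ?s" using Jd t2 e2 p O by (simp add: running_def tree_def)
          moreover have "undone ?s < undone s"
            unfolding undone_def
          proof (rule psubset_card_mono)
            show "{y. y < n \<and> ?s ''d'' y = 0} \<subset> {y. y < n \<and> s ''d'' y = 0}" using u0 e2 by auto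
          qed simp
          then have "(1000 * n + 1000) * (undone ?s + 1) \<le> (1000 * n + 1000) * undone s"
            by (intro mult_le_mono2) simp
          then have "\<psi> ?s + (1000 * n + 1000) \<le> \<psi> s"
            using e2 by (simp add: \<psi>_def \<phi>_def non_outer_def algebra_simps)
          ultimately show ?thesis using True B1 e2 t2' by (simp add: run_Cond)
        next
          case False
          then have v0: "s2 ''v'' 0 < n" "Q2 (s2 ''v'' 0)" using v by auto
          have "run B act s2 (\<lambda>t s'. (running m r s' \<or> finished m r s') \<and> t + 300 * n + 300 + \<psi> s' \<le> \<psi> s2)"
            by (rule run_act[OF J2(1) e2(5) refl]) (use v0 u0 J2 e2 in \<open>auto simp: Q2_def\<close>)
          then show ?thesis using False B1 e2 t2' J2(2) by (simp add: run_Cond) (auto elim!: run_mono)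
        qed
      qed
      then show ?thesis using False B1 e1 t1 by (simp add: run_Cond) (auto elim!: run_mono)
    qed
  qed
qed


section \<open>A complete search, and one search from each exposed vertex\<close>

definition find_augmentation :: com where
  "find_augmentation =
    Fill ''t'' ''i'' ''n'' (Equal (Const 0) (Const 0)) (Const 0);;
    Fill ''d'' ''i'' ''n'' (Equal (Const 0) (Const 0)) (Const 0);;
    Assign ''t'' (V ''r'') (Const 2);;
    Assign ''b'' (V ''r'') (V ''r'');;
    Assign ''P'' (Times (V ''r'') (V ''n'')) (V ''r'');;
    Assign ''L'' (V ''r'') (Const 1);;
    ''g'' ::= (Const 1);;
    While (Equal (V ''g'') (Const 1)) step"

lemma run_clear:
  assumes "s ''n'' 0 = n" "A \<noteq> ''i''" "A \<noteq> ''n''"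
  shows "run B (Fill A ''i'' ''n'' (Equal (Const 0) (Const 0)) (Const 0)) s
    (\<lambda>t s'. t \<le> n * 24 + 10 \<and> (agree {A, ''i''} s s' \<and> (\<forall>y<n. s' A y = 0)))"
proof -
  have "0 < B" "1 < B" "n < B" using B_large by auto
  then show ?thesis
    using run_Fill[of s "''n''" n B "''i''" A "Equal (Const 0) (Const 0)" "\<lambda>_. True" "Const 0" "\<lambda>_. 0"] assms
    by (auto elim!: run_mono)
qed

lemma run_find_augmentation:
  assumes s: "stored s" "s ''r'' 0 = r" "r < n" "s ''o'' 0 = 1" "s ''m'' = m" "mating m" "m r = r"
  shows "run B find_augmentation s (\<lambda>t s'. t \<le> 4000 * n * n + 8000 * n + 3000 \<and> finished m r s')"
proof -
  have B1: "0 < B" "1 < B" "2 < B" "n < B" using B_large by auto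
  let ?init = "Assign ''t'' (V ''r'') (Const 2);;
    Assign ''b'' (V ''r'') (V ''r'');;
    Assign ''P'' (Times (V ''r'') (V ''n'')) (V ''r'');;
    Assign ''L'' (V ''r'') (Const 1);;
    ''g'' ::= (Const 1);;
    While (Equal (V ''g'') (Const 1)) step"
  have rr: "r * n < B" using row_bound[OF s(3)] B_large by simp
  have loop: "run B (While (Equal (V ''g'') (Const 1)) step) s'
    (\<lambda>t s''. t \<le> 4000 * n * n + 6000 * n + 2000 \<and> finished m r s'')" if R: "running m r s'" for s'
  proof -
    have "run B (While (Equal (V ''g'') (Const 1)) step) s'
     (\<lambda>t s''. (running m r s'' \<or> finished m r s'') \<and> \<not> bval s'' (Equal (V ''g'') (Const 1)) \<and>
        t \<le> \<psi> s' + bcost (Equal (V ''g'') (Const 1)) + 1)"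
    proof (rule run_While)
      show "running m r s' \<or> finished m r s'" using R by simp
      show "bfits B x (Equal (V ''g'') (Const 1))" for x using B1 by simp
      fix x assume "running m r x \<or> finished m r x" "bval x (Equal (V ''g'') (Const 1))"
      then have "running m r x" by (auto simp: finished_def)
      then show "run B step x (\<lambda>t s'. (running m r s' \<or> finished m r s') \<and> t + bcost (Equal (V ''g'') (Const 1)) + 1 + \<psi> s' \<le> \<psi> x)"
        by (rule run_mono[OF run_step]) auto
    qed
    \<comment> \<open>At most \<open>n\<close> vertices are not outer, at most \<open>n\<close> are
      unflagged, and \<open>g\<close> is 1: this gives \<open>2 * n + 1\<close> units of
      \<open>1000 * n + 1000\<close> besides \<open>\<phi>\<close>. The constants are rounded
      up.\<close>
    moreover have "\<psi> s' \<le> 4000 * n * n + 6000 * n + 1500"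
    proof -
      have c: "non_outer s' \<le> n" "undone s' \<le> n"
        unfolding non_outer_def undone_def using card_mono[of "{..<n}"] by (metis (no_types, lifting) card_lessThan finite_lessThan lessThan_iff mem_Collect_eq subsetI)+
      have g: "s' ''g'' 0 = 1" using R by (simp add: running_def)
      have "(80 * n + 300) * non_outer s' \<le> (80 * n + 300) * n" using c by (intro mult_le_mono2)
      moreover have "(1000 * n + 1000) * (non_outer s' + undone s' + 1) \<le> (1000 * n + 1000) * (n + n + 1)"
        using c by (intro mult_le_mono2) simp
      ultimately show ?thesis unfolding \<psi>_def \<phi>_eq g by (simp add: algebra_simps)
    qed
    ultimately show ?thesis by (auto simp: running_def elim!: run_mono)
  qed
  have start: "run B (?init) s2 (\<lambda>t s'. t \<le> 4000 * n * n + 6000 * n + 2100 \<and> finished m r s')"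
    if 2: "agree {''t'', ''d'', ''i''} s s2" "\<And>y. y < n \<Longrightarrow> s2 ''t'' y = 0" "\<And>y. y < n \<Longrightarrow> s2 ''d'' y = 0" for s2
  proof -
    have e: "s2 ''n'' 0 = n" "s2 ''r'' 0 = r" "s2 ''m'' = m" "s2 ''o'' 0 = 1"
      using agreeD[OF 2(1)] s by (auto simp: stored_def)
    let ?s = "s2(''t'' := (s2 ''t'')(r := 2), ''b'' := (s2 ''b'')(r := r), ''P'' := (s2 ''P'')(r * n := r),
      ''L'' := (s2 ''L'')(r := 1), ''g'' := (s2 ''g'')(0 := 1))"
    have ag: "agree {''t'', ''d'', ''i'', ''b'', ''P'', ''L'', ''g''} s ?s" using 2(1) by (auto simp: agree_def)
    have O: "outer ?s = {r}" "inner ?s = {}" using 2(2) s(3) by (auto simp: outer_def inner_def)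
    have "search m r {r} {} (?s ''b'') (path ?s)"
      by (rule search_init) (use s in \<open>auto simp: path_def row_def One_nat_def\<close>)
    then have "tree ?s" unfolding tree_def O using e by simp
    moreover have "stored ?s" using s(1) stored_agree[OF ag] by simp
    moreover have "settled ?s" using 2(3) by (simp add: settled_def)
    ultimately have R: "running m r ?s" using e 2(2) by (simp add: running_def)
    then show ?thesis using loop[OF R] B1 rr e
      by (simp add: run_Seq[of B "Assign _ _ _"]) (auto elim!: run_mono)
  qed
  have n: "s ''n'' 0 = n" using s by (simp add: stored_def)
  show ?thesis unfolding find_augmentation_def
  proof (rule run_then[OF run_clear])
    fix s1 assume 1: "agree {''t'', ''i''} s s1 \<and> (\<forall>y<n. s1 ''t'' y = 0)"
    show "run B (Fill ''d'' ''i'' ''n'' (Equal (Const 0) (Const 0)) (Const 0);;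
      ?init) s1 (\<lambda>t s'. t \<le> 4000 * n * n + 7000 * n + 2200 \<and> finished m r s')"
    proof (rule run_then[OF run_clear])
      fix s2 assume 2: "agree {''d'', ''i''} s1 s2 \<and> (\<forall>y<n. s2 ''d'' y = 0)"
      show "run B (?init) s2 (\<lambda>t s'. t \<le> 4000 * n * n + 6000 * n + 2100 \<and> finished m r s')"
        by (rule start) (use 1 2 in \<open>auto simp: agree_def\<close>)
    qed (use 1 n in \<open>auto simp: agree_def\<close>)
  qed (use n in auto)
qed

lemma n_le_cube: "n \<le> n ^ 3" "n * n \<le> n ^ 3"
  using self_le_power[OF n_pos, of 3] mult_le_mono2[OF n_pos, of "n * n"] by (simp_all add: power3_eq_cube)

definition perfect :: com where
  "perfect =
    Fill ''m'' ''i'' ''n'' (Equal (Const 0) (Const 0)) (V ''i'');;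
    ''o'' ::= (Const 1);;
    For ''r'' ''n'' (Cond (Conj (Equal (V ''o'') (Const 1)) (Equal (Cell ''m'' (V ''r'')) (V ''r''))) find_augmentation Skip)"

text \<open>Roots are tried in increasing order. A successful search covers its root and keeps every
  matched vertex matched, so the vertices below the counter are covered; a failed one sets
  \<open>o\<close> to 0, which turns all later rounds into mere tests.\<close>

lemma run_perfect:
  assumes s: "stored s"
  shows "run B perfect s (\<lambda>t s'. t \<le> 20000 * n ^ 3 + 1000 \<and> (stored s' \<and>
     (s' ''o'' 0 = 1 \<and> mating (s' ''m'') \<and> (\<forall>v<n. s' ''m'' v \<noteq> v) \<or>
      s' ''o'' 0 = 0 \<and> (\<forall>F. \<not> matching_cover {..<n} E 1 F))))"
proof -
  have B1: "0 < B" "1 < B" "2 < B" "n < B" using B_large by auto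
  have n: "s ''n'' 0 = n" using s by (simp add: stored_def)
  let ?F = "\<lambda>s'. (stored s' \<and>
     (s' ''o'' 0 = 1 \<and> mating (s' ''m'') \<and> (\<forall>v<n. s' ''m'' v \<noteq> v) \<or>
      s' ''o'' 0 = 0 \<and> (\<forall>F. \<not> matching_cover {..<n} E 1 F)))"
  let ?b = "Cond (Conj (Equal (V ''o'') (Const 1)) (Equal (Cell ''m'' (V ''r'')) (V ''r''))) find_augmentation Skip"
  define I where "I k s' \<longleftrightarrow> stored s' \<and>
     (s' ''o'' 0 = 1 \<and> mating (s' ''m'') \<and> (\<forall>v<k. s' ''m'' v \<noteq> v) \<or>
      s' ''o'' 0 = 0 \<and> (\<forall>F. \<not> matching_cover {..<n} E 1 F))" for k :: nat and s' :: mem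
  have put: "I k (s'(''r'' := f)) \<longleftrightarrow> I k s'" for k s' f by (simp add: I_def stored_def)
  have loop: "run B (For ''r'' ''n'' ?b) s1 (\<lambda>t s'. I n s' \<and> s' ''r'' 0 = n \<and> s' ''n'' 0 = n \<and>
      t \<le> n * ((4000 * n * n + 8000 * n + 3020) + 12) + 9)" if I0: "I 0 s1" for s1
  proof (rule run_For)
    show "I 0 (put s1 ''r'' 0)" using I0 put by simp
    show "s1 ''n'' 0 = n" using I0 by (simp add: I_def stored_def)
    fix k s' assume k: "k < n" "I k s'" "s' ''r'' 0 = k" "s' ''n'' 0 = n"
    let ?Q = "\<lambda>t s''. s'' ''r'' 0 = k \<and> s'' ''n'' 0 = n \<and> I (Suc k) (put s'' ''r'' (Suc k)) \<and> t \<le> 4000 * n * n + 8000 * n + 3020"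
    show "run B ?b s' ?Q"
    proof (cases "s' ''o'' 0 = 1 \<and> s' ''m'' k = k")
      case True
      then have m: "stored s'" "mating (s' ''m'')" "\<forall>v<k. s' ''m'' v \<noteq> v" using k(2) by (auto simp: I_def)
      have "run B find_augmentation s' (\<lambda>t s''. t \<le> 4000 * n * n + 8000 * n + 3000 \<and> finished (s' ''m'') k s'')"
        by (rule run_find_augmentation) (use m True k in auto)
      then have "run B find_augmentation s' (\<lambda>t s''. ?Q (t + 15) s'')"
      proof (rule run_mono, elim conjE)
        fix t s'' assume 1: "t \<le> 4000 * n * n + 8000 * n + 3000" "finished (s' ''m'') k s''"
        have "\<forall>v<Suc k. s'' ''m'' v \<noteq> v" if "\<forall>x<n. s' ''m'' x \<noteq> x \<or> x = k \<longrightarrow> s'' ''m'' x \<noteq> x"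
          using that m(3) k(1) by (auto simp: less_Suc_eq)
        then have "I (Suc k) s''" using 1(2) unfolding I_def finished_def by blast
        then show "?Q (t + 15) s''" using 1 put by (auto simp: finished_def stored_def)
      qed
      then show ?thesis using True k B1 by (simp add: run_Cond) (auto elim!: run_mono)
    next
      case False
      then have "I (Suc k) s'" using k(2) by (auto simp: I_def less_Suc_eq)
      then show ?thesis using False k B1 put by (auto simp: run_Cond)
    qed
  qed (use B1 in auto)
  have fill: "run B (Fill ''m'' ''i'' ''n'' (Equal (Const 0) (Const 0)) (V ''i'')) s
    (\<lambda>t s'. t \<le> n * 25 + 10 \<and> (agree {''m'', ''i''} s s' \<and> (\<forall>y<n. s' ''m'' y = y)))"
    using run_Fill[of s "''n''" n B "''i''" "''m''" "Equal (Const 0) (Const 0)" "\<lambda>_. True" "V ''i''" "\<lambda>k. k"] n B1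
    by (auto elim!: run_mono)
  note pow = n_le_cube
  have pow3: "n * (n * n) = n ^ 3" by (simp add: power3_eq_cube)
  show ?thesis unfolding perfect_def
  proof (rule run_then[OF fill])
    fix s1 assume 1: "agree {''m'', ''i''} s s1 \<and> (\<forall>y<n. s1 ''m'' y = y)"
    then have st: "stored s1" using s stored_agree by auto
    have "mating (s1 ''m'')" using 1 by (simp add: mating_def)
    then have I0: "I 0 (put s1 ''o'' 1)" using st by (simp add: I_def stored_def)
    show "run B (''o'' ::= (Const 1);; For ''r'' ''n'' ?b) s1 (\<lambda>t s'. t \<le> 19000 * n ^ 3 + 900 \<and> ?F s')"
    proof (rule run_assign_then[where T' = "18000 * n ^ 3 + 800"])
      show "run B (For ''r'' ''n'' ?b) (s1(''o'' := (s1 ''o'')(aval s1 (Const 0) := aval s1 (Const 1))))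
        (\<lambda>t s'. t \<le> 18000 * n ^ 3 + 800 \<and> ?F s')"
      proof (rule run_mono[OF loop])
        show "I 0 (s1(''o'' := (s1 ''o'')(aval s1 (Const 0) := aval s1 (Const 1))))" using I0 by simp
        fix t s' assume 2: "I n s' \<and> s' ''r'' 0 = n \<and> s' ''n'' 0 = n \<and> t \<le> n * ((4000 * n * n + 8000 * n + 3020) + 12) + 9"
        have "n * ((4000 * n * n + 8000 * n + 3020) + 12) + 9 = 4000 * (n * (n * n)) + 8000 * (n * n) + 3032 * n + 9"
          by (simp add: algebra_simps)
        also have "\<dots> \<le> 18000 * n ^ 3 + 800" using pow unfolding pow3 by linarith
        finally have "t \<le> 18000 * n ^ 3 + 800" using 2 by simp
        then show "t \<le> 18000 * n ^ 3 + 800 \<and> ?F s'" using 2 unfolding I_def by blast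
      qed
    qed (use B1 in auto)
  next
    show "n * 25 + 10 + (19000 * n ^ 3 + 900) \<le> 20000 * n ^ 3 + 1000" using pow by linarith
  qed
qed

subsection \<open>Star forests\<close>

text \<open>
  In memory \<open>C\<close> is the centre map, \<open>D\<close> counts leaves, \<open>K\<close> is the current bound on the number of leaves and
  \<open>s\<close> the vertex to be covered. The search marks full centres with \<open>V\<close>, the vertex from which they were
  found is \<open>p\<close>, and \<open>F\<close> marks the vertices whose neighbours have been scanned.
\<close>

definition shift :: com where
  "shift =
    ''y'' ::= (Cell ''C'' (V ''x''));;
    Assign ''C'' (V ''x'') (V ''x'');;
    ''z'' ::= (V ''x'');;
    While (Neg (Equal (V ''z'') (V ''s'')))
      (''z'' ::= (Cell ''p'' (V ''y''));;
       ''q'' ::= (Cell ''C'' (V ''z''));;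
       Assign ''C'' (V ''z'') (V ''y'');;
       ''y'' ::= (V ''q''))"

text \<open>The rank \<open>dep\<close> shows that following parents and centres leads back to \<open>v\<close>.\<close>

definition alternating :: "(nat \<Rightarrow> nat) \<Rightarrow> (nat \<Rightarrow> nat) \<Rightarrow> nat \<Rightarrow> nat \<Rightarrow> nat set \<Rightarrow> (nat \<Rightarrow> nat) \<Rightarrow> (nat \<Rightarrow> nat) \<Rightarrow> bool" where
  "alternating c l K v Y p dep \<longleftrightarrow> (\<forall>y\<in>Y. y < n \<and> l y = K \<and> adj (p y) y \<and> dep y < card Y \<and>
     (p y = v \<or> c (p y) \<noteq> p y \<and> c (p y) \<in> Y \<and> dep (c (p y)) < dep y))"

text \<open>The chain leads from \<open>x\<close> through its centre to the parent of that centre,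
  then through the centre of the parent, and so on to \<open>v\<close>. Every centre on it loses one
  leaf and gains one, so the counts \<open>l\<close> are the same at the end and the program leaves
  them alone; only \<open>x\<close> is exposed in exchange for \<open>v\<close>. Centres have ranks
  below \<open>n\<close> that fall strictly, which bounds the number of rounds.\<close>

lemma run_shift:
  assumes s: "s ''C'' = c" "s ''x'' 0 = x" "s ''s'' 0 = v" "s ''p'' = p" "x < n" "v < n"
    and st: "star c l K" "2 \<le> K" "\<not> covered c l v"
    and x: "x = v \<or> c x \<noteq> x \<and> c x \<in> Y \<and> alternating c l K v Y p dep"
  shows "run B shift s (\<lambda>t s'. t \<le> 40 * n + 100 \<and> (agree {''y'', ''z'', ''q'', ''C''} s s' \<and>
    star (s' ''C'') l K \<and> s' ''C'' x = x \<and> l x = 0 \<and>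
    (\<forall>u. u \<noteq> x \<longrightarrow> u = v \<or> covered c l u \<longrightarrow> covered (s' ''C'') l u)))"
proof -
  have B1: "0 < B" using B_large by simp
  have v: "c v = v" "l v = 0" using st(3) by (auto simp: covered_def)
  let ?w = "While (Neg (Equal (V ''z'') (V ''s'')))
      (''z'' ::= (Cell ''p'' (V ''y''));;
       ''q'' ::= (Cell ''C'' (V ''z''));;
       Assign ''C'' (V ''z'') (V ''y'');;
       ''y'' ::= (V ''q''))"
  let ?F = "\<lambda>s'. agree {''y'', ''z'', ''q'', ''C''} s s' \<and>
    star (s' ''C'') l K \<and> s' ''C'' x = x \<and> l x = 0 \<and>
    (\<forall>u. u \<noteq> x \<longrightarrow> u = v \<or> covered c l u \<longrightarrow> covered (s' ''C'') l u)"
  let ?s1 = "s(''y'' := (s ''y'')(0 := c x), ''C'' := c(x := x), ''z'' := (s ''z'')(0 := x))"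
  have "run B ?w ?s1 (\<lambda>t s'. t \<le> 40 * n + 80 \<and> ?F s')"
  proof (cases "x = v")
    case True
    have "c(x := x) = c" using v True by auto
    then have F: "?F ?s1" using st v True by (simp add: agree_def)
    then show ?thesis using True B1 s
      by (intro runI[OF exec.WhileFalse]) auto
  next
    case False
    then have xl: "c x \<noteq> x" "c x \<in> Y" "alternating c l K v Y p dep" using x by auto
    have Y: "y < n" "l y = K" "adj (p y) y" "dep y < card Y"
      "p y = v \<or> c (p y) \<noteq> p y \<and> c (p y) \<in> Y \<and> dep (c (p y)) < dep y" if "y \<in> Y" for y
      using xl(3) that by (auto simp: alternating_def)
    have cardY: "card Y \<le> n"
    proof -
      have "Y \<subseteq> {..<n}" using Y(1) by auto
      then show ?thesis using card_mono[of "{..<n}" Y] by simp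
    qed
    have lx: "l x = 0" using star_leaf(1)[OF st(1) s(5) xl(1)] .
    have vY: "v \<notin> Y" using Y(2) v st(2) by auto
    \<comment> \<open>While the loop runs, the centre in \<open>y\<close> lacks one leaf and all
      other counts agree with \<open>l\<close>. Vertices whose centre has smaller rank still have
      the centre given by \<open>c\<close>, so the chain can be followed in the array that is being
      changed.\<close>
    define J where "J s' \<longleftrightarrow> agree {''y'', ''z'', ''q'', ''C''} s s' \<and> s' ''C'' x = x \<and>
      (\<forall>u. u \<noteq> x \<longrightarrow> c u \<noteq> u \<longrightarrow> s' ''C'' u \<noteq> u) \<and>
      (if s' ''z'' 0 = v then star (s' ''C'') l K \<and> s' ''C'' v \<noteq> v
       else s' ''y'' 0 \<in> Y \<and> star (s' ''C'') (l(s' ''y'' 0 := l (s' ''y'' 0) - 1)) K \<and>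
         s' ''C'' (s' ''y'' 0) = s' ''y'' 0 \<and> dep (s' ''y'' 0) < n \<and>
         (\<forall>z. z = v \<or> c z \<noteq> z \<and> c z \<in> Y \<and> dep (c z) < dep (s' ''y'' 0) \<longrightarrow> s' ''C'' z = c z))" for s'
    define pot where "pot s' = (if s' ''z'' 0 = v then 0 else 36 * (dep (s' ''y'' 0) + 1))" for s' :: mem
    have w: "run B ?w ?s1 (\<lambda>t s'. J s' \<and> \<not> bval s' (Neg (Equal (V ''z'') (V ''s''))) \<and>
       t \<le> pot ?s1 + bcost (Neg (Equal (V ''z'') (V ''s''))) + 1)"
    proof (rule run_While)
      have "star (c(x := x)) (l(c x := l (c x) - 1)) K" using star_remove[OF st(1) s(5) xl(1)] .
      moreover have "c (c x) = c x" using starD(3)[OF st(1) s(5)] .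
      moreover have "dep (c x) < n" using Y(4)[OF xl(2)] cardY by simp
      ultimately show "J ?s1" using False xl(1,2) v by (auto simp: J_def agree_def)
      show "bfits B s' (Neg (Equal (V ''z'') (V ''s'')))" for s' using B1 by simp
      fix s' assume J: "J s'" and b: "bval s' (Neg (Equal (V ''z'') (V ''s'')))"
      have ag: "agree {''y'', ''z'', ''q'', ''C''} s s'" using J by (simp add: J_def)
      have e: "s' ''s'' 0 = v" "s' ''p'' = p" using agreeD[OF ag] s by auto
      define y where "y = s' ''y'' 0"
      define C where "C = s' ''C''"
      have zv: "s' ''z'' 0 \<noteq> v" using b e by simp
      then have y: "y \<in> Y" "star C (l(y := l y - 1)) K" "C y = y" "dep y < n"
        and Cc: "\<And>z. z = v \<or> c z \<noteq> z \<and> c z \<in> Y \<and> dep (c z) < dep y \<Longrightarrow> C z = c z"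
        and Cx: "C x = x" "\<And>u. u \<noteq> x \<Longrightarrow> c u \<noteq> u \<Longrightarrow> C u \<noteq> u"
        using J by (auto simp: J_def y_def C_def)
      let ?z = "p y"
      let ?s2 = "s'(''z'' := (s' ''z'')(0 := ?z), ''q'' := (s' ''q'')(0 := C ?z), ''C'' := C(?z := y), ''y'' := (s' ''y'')(0 := C ?z))"
      have ag2: "agree {''y'', ''z'', ''q'', ''C''} s ?s2" using ag by simp
      have zn: "?z < n" "?z \<noteq> y" using adjD Y(3)[OF y(1)] by auto
      have l1: "(l(y := l y - 1)) y < K" using Y(2)[OF y(1)] st(2) by simp
      have "J ?s2 \<and> pot ?s2 + 36 \<le> pot s'"
      proof (cases "?z = v")
        case True
        have Cv: "C v = v" using Cc v by simp
        have "star (C(v := y)) ((l(y := l y - 1))(y := Suc ((l(y := l y - 1)) y))) K"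
          using star_add[OF y(2), of v y] Cv y(3) Y(3)[OF y(1)] l1 v True zn s(6) by auto
        moreover have "(l(y := l y - 1))(y := Suc ((l(y := l y - 1)) y)) = l"
          using Y(2)[OF y(1)] st(2) by auto
        ultimately have "J ?s2" using True ag2 Cx zn False by (auto simp: J_def)
        then show ?thesis using True zv by (simp add: pot_def)
      next
        case zl: False
        let ?t = "c ?z"
        have t: "?t \<noteq> ?z" "?t \<in> Y" "dep ?t < dep y" using Y(5)[OF y(1)] zl by auto
        have Cz: "C ?z = ?t" using Cc t by blast
        have ty: "?t \<noteq> y" using t(3) by auto
        have zx: "?z \<noteq> x" using Cx(1) Cz t(1) by auto
        \<comment> \<open>Moving the parent from its centre to \<open>y\<close> repairs
          \<open>y\<close> and passes the deficit on to that centre, which has smaller rank.\<close>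
        have rem: "star (C(?z := ?z)) ((l(y := l y - 1))(?t := l ?t - 1)) K"
          using star_remove[OF y(2) zn(1)] Cz t(1) ty by simp
        have lz: "(l(y := l y - 1)) ?z = 0" using star_leaf(1)[OF y(2) zn(1)] Cz t(1) by simp
        have "star ((C(?z := ?z))(?z := y)) (((l(y := l y - 1))(?t := l ?t - 1))(y := Suc (((l(y := l y - 1))(?t := l ?t - 1)) y))) K"
          by (rule star_add[OF rem zn(1)]) (use lz t(1) ty zn y(3) Y(3)[OF y(1)] l1 in auto)
        moreover have "((l(y := l y - 1))(?t := l ?t - 1))(y := Suc (((l(y := l y - 1))(?t := l ?t - 1)) y)) = l(?t := l ?t - 1)"
          using Y(2)[OF y(1)] st(2) ty by auto
        ultimately have star2: "star (C(?z := y)) (l(?t := l ?t - 1)) K" by simp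
        have Ct: "(C(?z := y)) ?t = ?t" using starD(3)[OF y(2) zn(1)] Cz t(1) by simp
        have keep: "(C(?z := y)) z = c z" if z: "z = v \<or> c z \<noteq> z \<and> c z \<in> Y \<and> dep (c z) < dep ?t" for z
        proof -
          have "z \<noteq> ?z" using z zl by auto
          moreover have "C z = c z" by (rule Cc) (use z t(3) in auto)
          ultimately show ?thesis by simp
        qed
        have dt: "dep ?t < n" using t(3) y(4) by simp
        have "J ?s2" unfolding J_def
          using ag2 Cx zn zx zl Cz star2 Ct keep dt t(2) by simp
        then show ?thesis using zl zv t(3) Cz by (simp add: pot_def y_def[symmetric])
      qed
      then show "run B (''z'' ::= (Cell ''p'' (V ''y''));;
       ''q'' ::= (Cell ''C'' (V ''z''));;
       Assign ''C'' (V ''z'') (V ''y'');;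
       ''y'' ::= (V ''q'')) s'
        (\<lambda>t s'a. J s'a \<and> t + bcost (Neg (Equal (V ''z'') (V ''s''))) + 1 + pot s'a \<le> pot s')"
        using B1 e by (simp add: run_Seq y_def[symmetric] C_def[symmetric])
    qed
    show ?thesis
    proof (rule run_mono[OF w], elim conjE)
      fix t s' assume J: "J s'" and b: "\<not> bval s' (Neg (Equal (V ''z'') (V ''s'')))"
        and t: "t \<le> pot ?s1 + bcost (Neg (Equal (V ''z'') (V ''s''))) + 1"
      have ag: "agree {''y'', ''z'', ''q'', ''C''} s s'" using J by (simp add: J_def)
      have zv: "s' ''z'' 0 = v" using b agreeD[OF ag] s by simp
      have "dep (c x) + 1 \<le> n" using Y(4)[OF xl(2)] cardY by simp
      then have "pot ?s1 \<le> 36 * n" using False by (simp add: pot_def)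
      then have "t \<le> 40 * n + 80" using t by simp
      moreover have "?F s'" using J zv ag lx v by (auto simp: J_def covered_def)
      ultimately show "t \<le> 40 * n + 80 \<and> ?F s'" by blast
    qed
  qed
  then show ?thesis unfolding shift_def using B1 s
    by (simp add: run_Seq[of B "Assign _ _ _"]) (auto elim!: run_mono)
qed

definition attach :: com where
  "attach =
    ''q'' ::= (Cell ''C'' (V ''w''));;
    Cond (Equal (V ''q'') (V ''w'')) Skip
      (Assign ''D'' (V ''q'') (Minus (Cell ''D'' (V ''q'')) (Const 1));;
       Assign ''C'' (V ''w'') (V ''w'');;
       Cond (Equal (Cell ''D'' (V ''q'')) (Const 0))
         (Assign ''C'' (V ''q'') (V ''w'');; Assign ''D'' (V ''w'') (Const 1)) Skip);;
    Assign ''C'' (V ''x'') (V ''w'');;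
    Assign ''D'' (V ''w'') (Plus (Cell ''D'' (V ''w'')) (Const 1))"

text \<open>If \<open>w\<close> is a leaf, it leaves its star and becomes the centre for
  \<open>x\<close>. Should its former centre lose the only leaf, that centre becomes a second leaf
  of \<open>w\<close>; this case makes a star with two leaves and is where \<open>2 \<le> K\<close>
  enters.\<close>

lemma run_attach:
  assumes s: "s ''x'' 0 = x" "s ''w'' 0 = w" "s ''C'' = c" "s ''D'' = l"
    and st: "star c l K" "2 \<le> K" "c x = x" "l x = 0" "adj x w" "l w < K" "K \<le> n + 1"
  shows "run B attach s (\<lambda>t s'. t \<le> 100 \<and> (agree {''q'', ''C'', ''D''} s s' \<and> star (s' ''C'') (s' ''D'') K \<and>
    (\<forall>u. u = x \<or> u < n \<and> covered c l u \<longrightarrow> covered (s' ''C'') (s' ''D'') u)))"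
proof -
  have B1: "0 < B" "1 < B" "n + 2 < B" using B_large by auto
  have xw: "x < n" "w < n" "x \<noteq> w" using adjD st(5) by auto
  have add: "star (c(x := w)) (l(w := Suc (l w))) K" if "star c l K" "c x = x" "l x = 0" "c w = w" "l w < K" for c l
    using star_add[OF that(1) xw(1) that(2,3,4) st(5) that(5)] .
  show ?thesis
  proof (cases "c w = w")
    case True
    have "star (c(x := w)) (l(w := l w + 1)) K" using add[of c l] st True by (simp flip: Suc_eq_plus1)
    moreover have "l w + 1 < B" using st(6,7) B1 by simp
    ultimately show ?thesis unfolding attach_def using True s B1 xw
      by (simp add: run_Seq run_Cond covered_def)
  next
    case False
    let ?q = "c w"
    let ?l1 = "l(?q := l ?q - 1)" and ?c1 = "c(w := w)"
    have q: "?q < n" "c ?q = ?q" "adj w ?q" "l ?q > 0" "l w = 0"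
      using starD[OF st(1) xw(2)] star_leaf[OF st(1) xw(2) False] False by auto
    have qx: "?q \<noteq> x" using q(4) st(4) by auto
    have r: "star ?c1 ?l1 K" using star_remove[OF st(1) xw(2) False] .
    show ?thesis
    proof (cases "l ?q = 1")
      case True
      have "star (?c1(?q := w)) (?l1(w := Suc (?l1 w))) K"
        by (rule star_add[OF r q(1)]) (use q False True st(2) adj_commute in auto)
      then have r2: "star (?c1(?q := w)) (?l1(w := 1)) K" using q(5) False by (simp add: One_nat_def)
      have "star (?c1(?q := w, x := w)) (?l1(w := Suc 1)) K"
        using add[OF r2] st False qx xw by auto
      then have "star (c(w := w, ?q := w, x := w)) (l(?q := 0, w := 2)) K" using True by (simp add: numeral_2_eq_2 One_nat_def)
      moreover have "2 < B" using B_large by simp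
      ultimately show ?thesis unfolding attach_def using True s B1 xw False qx
        by (simp add: run_Seq run_Cond covered_def)
    next
      case big: False
      then have l2: "l ?q \<ge> 2" using q(4) by simp
      have "star (?c1(x := w)) (?l1(w := Suc (?l1 w))) K"
        by (rule add[OF r]) (use st False qx xw q in auto)
      then have "star (c(w := w, x := w)) (l(?q := l ?q - 1, w := 1)) K" using q(5) False by (simp add: One_nat_def)
      then show ?thesis unfolding attach_def using l2 s B1 xw False qx q
        by (simp add: run_Seq run_Cond covered_def)
    qed
  qed
qed


section \<open>The search for a vertex that can be attached\<close>

text \<open>\<open>w\<close> equal to \<open>n\<close> signals that no neighbour has spare capacity.
  The loop goes on after a usable neighbour and keeps the last one, marking full neighbours all the
  while.\<close>

definition scan :: com where
  "scan = ''w'' ::= (V ''n'');;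
    For ''i'' ''n'' (Cond (Equal (Cell ''adj'' (Plus (Times (V ''x'') (V ''n'')) (V ''i''))) (Const 1))
      (Cond (Less (Cell ''D'' (V ''i'')) (V ''K''))
        (''w'' ::= (V ''i''))
        (Cond (Equal (Cell ''V'' (V ''i'')) (Const 0))
          (Assign ''V'' (V ''i'') (Const 1);; Assign ''p'' (V ''i'') (V ''x'')) Skip)) Skip)"

lemma run_scan:
  assumes s: "stored s" "s ''x'' 0 = x" "x < n" "s ''D'' = l" "s ''K'' 0 = K"
    and N: "N = {i. adj x i \<and> \<not> l i < K \<and> s ''V'' i = 0}"
  shows "run B scan s (\<lambda>t s'. t \<le> 60 * n + 20 \<and> (agree {''w'', ''i'', ''V'', ''p''} s s' \<and>
    s' ''V'' = (\<lambda>i. if i \<in> N then 1 else s ''V'' i) \<and> s' ''p'' = (\<lambda>i. if i \<in> N then x else s ''p'' i) \<and>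
    (s' ''w'' 0 = n \<and> (\<forall>i. adj x i \<longrightarrow> \<not> l i < K) \<or> adj x (s' ''w'' 0) \<and> l (s' ''w'' 0) < K)))"
proof -
  have B1: "0 < B" "1 < B" "n < B" using B_large by auto
  have n: "s ''n'' 0 = n" using s by (simp add: stored_def)
  let ?s = "put s ''w'' n"
  let ?b = "Cond (Equal (Cell ''adj'' (Plus (Times (V ''x'') (V ''n'')) (V ''i''))) (Const 1))
      (Cond (Less (Cell ''D'' (V ''i'')) (V ''K''))
        (''w'' ::= (V ''i''))
        (Cond (Equal (Cell ''V'' (V ''i'')) (Const 0))
          (Assign ''V'' (V ''i'') (Const 1);; Assign ''p'' (V ''i'') (V ''x'')) Skip)) Skip"
  define I where "I k s' \<longleftrightarrow> agree {''w'', ''i'', ''V'', ''p''} s s' \<and>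
    s' ''V'' = (\<lambda>i. if i < k \<and> i \<in> N then 1 else s ''V'' i) \<and> s' ''p'' = (\<lambda>i. if i < k \<and> i \<in> N then x else s ''p'' i) \<and>
    (s' ''w'' 0 = n \<and> (\<forall>i<k. adj x i \<longrightarrow> \<not> l i < K) \<or> adj x (s' ''w'' 0) \<and> l (s' ''w'' 0) < K)" for k s'
  have put: "I k (s'(''i'' := f)) \<longleftrightarrow> I k s'" for k s' f by (simp add: I_def)
  have "run B (For ''i'' ''n'' ?b) ?s (\<lambda>t s'. I n s' \<and> s' ''i'' 0 = n \<and> s' ''n'' 0 = n \<and> t \<le> n * (45 + 12) + 9)"
  proof (rule run_For)
    show "I 0 (put ?s ''i'' 0)" by (simp add: I_def)
    fix k s' assume k: "k < n" "I k s'" "s' ''i'' 0 = k" "s' ''n'' 0 = n"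
    have ag: "agree {''w'', ''i'', ''V'', ''p''} s s'" using k by (simp add: I_def)
    have e: "s' ''x'' 0 = x" "s' ''D'' = l" "s' ''K'' 0 = K" "s' ''adj'' = s ''adj''" using agreeD[OF ag] s by auto
    have a: "s ''adj'' (x * n + k) = (if adj x k then 1 else 0)" using s k by (simp add: stored_def)
    have f: "x * n < B" "x * n + k < B" using row_bound[OF s(3)] k B_large by auto
    have Vk: "s' ''V'' k = s ''V'' k" using k by (simp add: I_def)
    show "run B ?b s' (\<lambda>t s''. s'' ''i'' 0 = k \<and> s'' ''n'' 0 = n \<and> I (Suc k) (put s'' ''i'' (Suc k)) \<and> t \<le> 45)"
    proof (cases "adj x k \<and> l k < K")
      case True
      then have "k \<notin> N" using N by simp
      then have "I (Suc k) (put s' ''w'' k)" using k(2) True by (auto simp: I_def less_Suc_eq fun_eq_iff)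
      then show ?thesis using True k e a f B1 put by (simp add: run_Cond)
    next
      case no: False
      show ?thesis
      proof (cases "k \<in> N")
        case True
        let ?s2 = "s'(''V'' := (s' ''V'')(k := 1), ''p'' := (s' ''p'')(k := x))"
        have "?s2 ''V'' = (\<lambda>i. if i < Suc k \<and> i \<in> N then 1 else s ''V'' i)"
          "?s2 ''p'' = (\<lambda>i. if i < Suc k \<and> i \<in> N then x else s ''p'' i)"
          using k(2) True by (auto simp: I_def less_Suc_eq fun_eq_iff)
        then have "I (Suc k) ?s2" using k(2) no ag by (auto simp: I_def less_Suc_eq)
        then show ?thesis using True N k e a f B1 put Vk by (simp add: run_Cond run_Seq)
      next
        case False
        then have "I (Suc k) s'" using k(2) no by (auto simp: I_def less_Suc_eq fun_eq_iff)
        then show ?thesis using False no N k e a f B1 put Vk by (auto simp: run_Cond)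
      qed
    qed
  qed (use B1 n in auto)
  then have "run B (For ''i'' ''n'' ?b) ?s (\<lambda>t s'. t \<le> 57 * n + 9 \<and> I n s')" by (rule run_mono) auto
  moreover have "I n s' \<Longrightarrow> agree {''w'', ''i'', ''V'', ''p''} s s' \<and>
    s' ''V'' = (\<lambda>i. if i \<in> N then 1 else s ''V'' i) \<and> s' ''p'' = (\<lambda>i. if i \<in> N then x else s ''p'' i) \<and>
    (s' ''w'' 0 = n \<and> (\<forall>i. adj x i \<longrightarrow> \<not> l i < K) \<or> adj x (s' ''w'' 0) \<and> l (s' ''w'' 0) < K)" for s'
    using adjD(2)[of x] N by (auto simp: I_def fun_eq_iff)
  ultimately show ?thesis unfolding scan_def using B1 n
    by (simp add: run_Seq) (auto elim!: run_mono)
qed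

text \<open>With \<open>Y\<close> the visited full centres, these are the vertices that can be
  exposed in place of \<open>v\<close> by a shift, \<open>v\<close> itself included.\<close>

definition reached :: "(nat \<Rightarrow> nat) \<Rightarrow> nat \<Rightarrow> nat set \<Rightarrow> nat set" where
  "reached c v Y = {z. z < n \<and> (z = v \<or> c z \<noteq> z \<and> c z \<in> Y)}"

definition visited :: "mem \<Rightarrow> nat set" where "visited s = {y. y < n \<and> s ''V'' y \<noteq> 0}"

lemma visited_upd [simp]: "x \<noteq> ''V'' \<Longrightarrow> visited (s(x := f)) = visited s"
  by (simp add: visited_def)

text \<open>A certificate, kept throughout, that no cover uses fewer than \<open>K\<close>
  matchings; it turns into optimality as soon as all vertices are covered. The upper limit keeps
  \<open>K\<close> within the number bound.\<close>

definition optimal_bound :: "nat \<Rightarrow> bool" where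
  "optimal_bound K \<longleftrightarrow> 2 \<le> K \<and> K \<le> n + 1 \<and> (\<forall>F. \<not> matching_cover {..<n} E (K - 1) F)"

definition exploring :: "nat \<Rightarrow> (nat \<Rightarrow> nat) \<Rightarrow> (nat \<Rightarrow> nat) \<Rightarrow> mem \<Rightarrow> bool" where
  "exploring v c l s \<longleftrightarrow> stored s \<and> s ''s'' 0 = v \<and> s ''C'' = c \<and> s ''D'' = l \<and> s ''g'' 0 = 1 \<and>
     star c l (s ''K'' 0) \<and> optimal_bound (s ''K'' 0) \<and>
     (\<exists>dep. alternating c l (s ''K'' 0) v (visited s) (s ''p'') dep) \<and>
     (\<forall>x<n. s ''F'' x \<noteq> 0 \<longrightarrow> x \<in> reached c v (visited s) \<and> (\<forall>w. adj x w \<longrightarrow> w \<in> visited s))"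

text \<open>The chain back to \<open>v\<close> is required only for \<open>x\<close> other than
  \<open>v\<close>. If \<open>K\<close> has just been increased, the visited centres are no longer
  full for the new value, but then \<open>x\<close> is \<open>v\<close> and the shift changes
  nothing.\<close>

definition found :: "nat \<Rightarrow> (nat \<Rightarrow> nat) \<Rightarrow> (nat \<Rightarrow> nat) \<Rightarrow> mem \<Rightarrow> bool" where
  "found v c l s \<longleftrightarrow> stored s \<and> s ''s'' 0 = v \<and> s ''C'' = c \<and> s ''D'' = l \<and> s ''g'' 0 = 0 \<and>
     star c l (s ''K'' 0) \<and> optimal_bound (s ''K'' 0) \<and> s ''x'' 0 < n \<and>
     adj (s ''x'' 0) (s ''w'' 0) \<and> l (s ''w'' 0) < s ''K'' 0 \<and>
     (s ''x'' 0 = v \<or> c (s ''x'' 0) \<noteq> s ''x'' 0 \<and> c (s ''x'' 0) \<in> visited s \<and>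
       (\<exists>dep. alternating c l (s ''K'' 0) v (visited s) (s ''p'') dep))"

definition unexplored :: "mem \<Rightarrow> nat" where "unexplored s = card {y. y < n \<and> s ''F'' y = 0}"

text \<open>The newly marked centres get the rank \<open>card Y\<close>, which is larger than all
  ranks given so far, so the centre of their parent \<open>x\<close> has smaller rank unless
  \<open>x\<close> is \<open>v\<close>.\<close>

lemma alternating_extend:
  assumes a: "alternating c l K v Y p dep" and st: "star c l K" and x: "x \<in> reached c v Y"
    and fin: "finite Y" and N: "N = {i. adj x i \<and> \<not> l i < K \<and> i \<notin> Y}"
    and p': "p' = (\<lambda>i. if i \<in> N then x else p i)"
  shows "\<exists>dep'. alternating c l K v (Y \<union> N) p' dep'"
proof -
  define dep' where "dep' i = (if i \<in> N then card Y else dep i)" for i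
  have finN: "finite N" using N adjD(2) by (auto intro: finite_subset[of _ "{..<n}"])
  have NY: "N \<inter> Y = {}" using N by auto
  have cU: "card (Y \<union> N) = card Y + card N" using card_Un_disjoint[OF fin finN] NY by auto
  have "y < n \<and> l y = K \<and> adj (p' y) y \<and> dep' y < card (Y \<union> N) \<and>
     (p' y = v \<or> c (p' y) \<noteq> p' y \<and> c (p' y) \<in> Y \<union> N \<and> dep' (c (p' y)) < dep' y)" if y: "y \<in> Y \<union> N" for y
  proof (cases "y \<in> N")
    case True
    have yn: "y < n" using True N adjD(2) by auto
    then have "l y = K" using starD(5)[OF st yn] True N by auto
    moreover have "card N > 0" using True finN by (auto simp: card_gt_0_iff)
    moreover have "dep (c x) < card Y" if "c x \<in> Y" using a that by (auto simp: alternating_def)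
    ultimately show ?thesis using True yn N x NY cU
      by (auto simp: p' dep'_def reached_def)
  next
    case False
    then have yY: "y \<in> Y" using y by simp
    then have *: "y < n \<and> l y = K \<and> adj (p y) y \<and> dep y < card Y \<and>
       (p y = v \<or> c (p y) \<noteq> p y \<and> c (p y) \<in> Y \<and> dep (c (p y)) < dep y)"
      using a by (simp add: alternating_def)
    have "c (p y) \<in> Y \<Longrightarrow> c (p y) \<notin> N" using NY by blast
    then show ?thesis using False * cU by (auto simp: p' dep'_def)
  qed
  then show ?thesis unfolding alternating_def by blast
qed

text \<open>If every reached vertex has been scanned, \<open>K\<close> is increased and the scan
  restarts at the uncovered vertex itself. All its neighbours then have spare capacity, so the
  search ends in this very round and increases \<open>K\<close> at most once.\<close>

definition explore :: com where
  "explore =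
    Find ''x'' ''i'' ''n'' (Conj (Equal (Cell ''F'' (V ''i'')) (Const 0))
      (Neg (Conj (Neg (Equal (V ''i'') (V ''s'')))
        (Neg (Conj (Neg (Equal (Cell ''C'' (V ''i'')) (V ''i'')))
          (Neg (Equal (Cell ''V'' (Cell ''C'' (V ''i''))) (Const 0))))))));;
    Cond (Equal (V ''x'') (V ''n''))
      (''K'' ::= (Plus (V ''K'') (Const 1));; ''x'' ::= (V ''s'')) Skip;;
    scan;;
    Assign ''F'' (V ''x'') (Const 1);;
    Cond (Less (V ''w'') (V ''n'')) (''g'' ::= (Const 0)) Skip"

lemma run_explore:
  assumes J: "exploring v c l s" and v: "v < n" "\<not> covered c l v" "\<exists>w. adj v w"
  shows "run B explore s (\<lambda>t s'. t \<le> 200 * n + 200 \<and>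
    (exploring v c l s' \<and> unexplored s' < unexplored s \<or> found v c l s'))"
proof -
  define K where "K = s ''K'' 0"
  define Y where "Y = visited s"
  obtain dep where Jd: "stored s" "s ''s'' 0 = v" "s ''C'' = c" "s ''D'' = l" "s ''g'' 0 = 1"
    "star c l K" "optimal_bound K" "alternating c l K v Y (s ''p'') dep"
    "\<And>x. x < n \<Longrightarrow> s ''F'' x \<noteq> 0 \<Longrightarrow> x \<in> reached c v Y \<and> (\<forall>w. adj x w \<longrightarrow> w \<in> Y)"
    using J unfolding exploring_def K_def Y_def by blast
  have n: "s ''n'' 0 = n" using Jd by (simp add: stored_def)
  have B1: "0 < B" "1 < B" "n < B" "n + 2 < B" using B_large by auto
  have K: "2 \<le> K" "K \<le> n + 1" using Jd(7) by (auto simp: optimal_bound_def)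
  have finY: "finite Y" by (simp add: Y_def visited_def)
  have cn: "c z < n" if "z < n" for z using starD(1)[OF Jd(6) that] .
  let ?b = "Conj (Equal (Cell ''F'' (V ''i'')) (Const 0))
      (Neg (Conj (Neg (Equal (V ''i'') (V ''s'')))
        (Neg (Conj (Neg (Equal (Cell ''C'' (V ''i'')) (V ''i'')))
          (Neg (Equal (Cell ''V'' (Cell ''C'' (V ''i''))) (Const 0)))))))"
  define Q where "Q k \<longleftrightarrow> s ''F'' k = 0 \<and> k \<in> reached c v Y" for k
  have find: "run B (Find ''x'' ''i'' ''n'' ?b) s (\<lambda>t s'. agree {''x'', ''i''} s s' \<and> t \<le> n * (bcost ?b + 20) + 20 \<and>
     (s' ''x'' 0 = n \<and> (\<forall>k<n. \<not> Q k) \<or> s' ''x'' 0 < n \<and> Q (s' ''x'' 0) \<and> (\<forall>k<n. s' ''x'' 0 < k \<longrightarrow> \<not> Q k)))"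
  proof (rule run_Find)
    fix k s' assume k: "k < n" "agree {''x'', ''i''} s s'" "s' ''i'' 0 = k"
    have "s' ''F'' = s ''F''" "s' ''C'' = c" "s' ''V'' = s ''V''" "s' ''s'' 0 = v" using agreeD[OF k(2)] Jd by auto
    then show "bfits B s' ?b \<and> bval s' ?b = Q k" using k B1 cn[OF k(1)] by (auto simp: Q_def reached_def Y_def visited_def)
  qed (use n B1 in auto)
  let ?rest = "scan;; Assign ''F'' (V ''x'') (Const 1);; Cond (Less (V ''w'') (V ''n'')) (''g'' ::= (Const 0)) Skip"
  let ?post = "\<lambda>s'. exploring v c l s' \<and> unexplored s' < unexplored s \<or> found v c l s'"
  have rest: "run B ?rest s1 (\<lambda>t s'. t \<le> 60 * n + 60 \<and> ?post s')"
    if 1: "agree {''x'', ''i'', ''K''} s s1" "s1 ''x'' 0 = x" "x < n" "s1 ''K'' 0 = K'"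
      and K': "K' = K \<and> Q x \<or> K' = K + 1 \<and> x = v \<and> optimal_bound K'" for s1 x K'
  proof -
    have e1: "s1 ''D'' = l" "s1 ''C'' = c" "s1 ''s'' 0 = v" "s1 ''V'' = s ''V''" "s1 ''p'' = s ''p''" "s1 ''F'' = s ''F''"
      "s1 ''g'' 0 = 1" using agreeD[OF 1(1)] Jd by auto
    have st1: "stored s1" using stored_agree[OF 1(1)] Jd(1) by simp
    have n1: "s1 ''n'' 0 = n" using st1 by (simp add: stored_def)
    have star': "star c l K'" using star_mono[OF Jd(6)] K' by auto
    have ob: "optimal_bound K'" using K' Jd(7) by auto
    define N where "N = {i. adj x i \<and> \<not> l i < K' \<and> s1 ''V'' i = 0}"
    have NY: "N = {i. adj x i \<and> \<not> l i < K' \<and> i \<notin> Y}" using adjD(2) e1 by (auto simp: N_def Y_def visited_def)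
    have xr: "x \<in> reached c v Y" using K' 1(3) by (auto simp: Q_def reached_def)
    show ?thesis
    proof (rule run_then[OF run_scan[OF st1 1(2,3) e1(1) 1(4) N_def]])
      fix s2
      assume 2: "agree {''w'', ''i'', ''V'', ''p''} s1 s2 \<and>
        s2 ''V'' = (\<lambda>i. if i \<in> N then 1 else s1 ''V'' i) \<and> s2 ''p'' = (\<lambda>i. if i \<in> N then x else s1 ''p'' i) \<and>
        (s2 ''w'' 0 = n \<and> (\<forall>i. adj x i \<longrightarrow> \<not> l i < K') \<or> adj x (s2 ''w'' 0) \<and> l (s2 ''w'' 0) < K')"
      then have ag2: "agree {''w'', ''i'', ''V'', ''p''} s1 s2" and p2: "s2 ''p'' = (\<lambda>i. if i \<in> N then x else s ''p'' i)"
        and V2: "s2 ''V'' = (\<lambda>i. if i \<in> N then 1 else s1 ''V'' i)"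
        and w2: "s2 ''w'' 0 = n \<and> (\<forall>i. adj x i \<longrightarrow> \<not> l i < K') \<or> adj x (s2 ''w'' 0) \<and> l (s2 ''w'' 0) < K'"
        using e1 by auto
      have e2: "s2 ''D'' = l" "s2 ''C'' = c" "s2 ''s'' 0 = v" "s2 ''F'' = s ''F''" "s2 ''g'' 0 = 1" "s2 ''x'' 0 = x" "s2 ''n'' 0 = n" "s2 ''K'' 0 = K'"
        using agreeD[OF ag2] e1 1 n1 by auto
      have st2: "stored s2" using stored_agree[OF ag2] st1 by simp
      have vis2: "visited s2 = Y \<union> N" using V2 e1 NY adjD(2) by (auto simp: visited_def Y_def)
      have alt2: "\<exists>dep. alternating c l K' v (Y \<union> N) (s2 ''p'') dep" if "K' = K"
        using alternating_extend[OF Jd(8,6) xr finY _ p2] NY that by blast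
      let ?s3 = "s2(''F'' := (s ''F'')(x := 1))"
      have st3: "stored ?s3" "stored (put ?s3 ''g'' 0)" using st2 by (simp_all add: stored_def)
      show "run B (Assign ''F'' (V ''x'') (Const 1);; Cond (Less (V ''w'') (V ''n'')) (''g'' ::= (Const 0)) Skip) s2
        (\<lambda>t s'. t \<le> 30 \<and> ?post s')"
      proof (cases "s2 ''w'' 0 = n")
        case True
        then have full: "\<And>i. adj x i \<Longrightarrow> \<not> l i < K'" using w2 adjD(2) by blast
        \<comment> \<open>After an increase the scan is at \<open>v\<close>, whose neighbours have
          at most \<open>K\<close> leaves; since \<open>v\<close> has a neighbour, such a scan
          cannot come back empty.\<close>
        have KK: "K' = K"
        proof (rule ccontr)
          assume "K' \<noteq> K"
          then have "K' = K + 1" "x = v" using K' by auto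
          then obtain w where "adj x w" using v by blast
          then show False using full[of w] starD(5)[OF Jd(6), of w] adjD(2)[of x w] \<open>K' = K + 1\<close> by auto
        qed
        then have xQ: "s ''F'' x = 0" using K' by (auto simp: Q_def)
        have mono: "reached c v Y \<subseteq> reached c v (Y \<union> N)" by (auto simp: reached_def)
        have "z \<in> reached c v (Y \<union> N) \<and> (\<forall>w. adj z w \<longrightarrow> w \<in> Y \<union> N)" if z: "z < n" "((s ''F'')(x := 1)) z \<noteq> 0" for z
        proof (cases "z = x")
          case True then show ?thesis using xr mono full NY by auto
        next
          case False then show ?thesis using Jd(9)[of z] z mono by auto
        qed
        then have "exploring v c l ?s3" unfolding exploring_def
          using st3 e2 star' ob alt2[OF KK] by (simp add: vis2)
        moreover have "unexplored ?s3 < unexplored s" unfolding unexplored_def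
        proof (rule psubset_card_mono)
          show "{y. y < n \<and> ?s3 ''F'' y = 0} \<subset> {y. y < n \<and> s ''F'' y = 0}" using xQ 1(3) by auto
        qed simp
        ultimately show ?thesis using True B1 e2 by (simp add: run_Seq run_Cond)
      next
        case False
        then have w: "adj x (s2 ''w'' 0)" "l (s2 ''w'' 0) < K'" "s2 ''w'' 0 < n" using w2 adjD(2) by auto
        have "x = v \<or> c x \<noteq> x \<and> c x \<in> Y \<union> N \<and> (\<exists>dep. alternating c l K' v (Y \<union> N) (s2 ''p'') dep)"
          using K' xr alt2 by (auto simp: reached_def)
        then have "found v c l (put ?s3 ''g'' 0)" unfolding found_def
          using st3 e2 star' ob 1(3) w by (simp add: vis2)
        then show ?thesis using False w B1 e2 by (simp add: run_Seq run_Cond)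
      qed
    qed simp
  qed
  show ?thesis unfolding explore_def
  proof (rule run_then)
    show "run B (Find ''x'' ''i'' ''n'' ?b) s (\<lambda>t s'. t \<le> 70 * n + 20 \<and> (agree {''x'', ''i''} s s' \<and>
     (s' ''x'' 0 = n \<and> (\<forall>k<n. \<not> Q k) \<or> s' ''x'' 0 < n \<and> Q (s' ''x'' 0))))"
      by (rule run_mono[OF find]) auto
    fix s1 assume 1: "agree {''x'', ''i''} s s1 \<and> (s1 ''x'' 0 = n \<and> (\<forall>k<n. \<not> Q k) \<or> s1 ''x'' 0 < n \<and> Q (s1 ''x'' 0))"
    then have ag: "agree {''x'', ''i'', ''K''} s s1" by (auto simp: agree_def)
    have e: "s1 ''K'' 0 = K" "s1 ''s'' 0 = v" "s1 ''n'' 0 = n" using 1 n Jd by (auto simp: agree_def K_def)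
    let ?c = "Cond (Equal (V ''x'') (V ''n''))
      (''K'' ::= (Plus (V ''K'') (Const 1));; ''x'' ::= (V ''s'')) Skip"
    show "run B (?c;; ?rest) s1 (\<lambda>t s'. t \<le> 60 * n + 100 \<and> ?post s')"
    proof (cases "s1 ''x'' 0 = n")
      case True
      then have none: "\<And>k. k < n \<Longrightarrow> k \<in> reached c v Y \<Longrightarrow> s ''F'' k \<noteq> 0" using 1 by (auto simp: Q_def)
      have nb: "w \<in> Y" if "x < n" "x = v \<or> c x \<noteq> x \<and> c x \<in> Y" "adj x w" for x w
        using none[of x] Jd(9)[of x] that by (auto simp: reached_def)
      have Yf: "y < n \<and> l y = K" if "y \<in> Y" for y using Jd(8) that by (auto simp: alternating_def)
      \<comment> \<open>Every vertex that could be exposed has been scanned, so all their neighbours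
        are visited, hence full centres: the configuration counted in
        \<open>star_no_cover\<close>.\<close>
      have nc: "\<not> matching_cover {..<n} E K F" for F by (rule star_no_cover[OF Jd(6) v(1,2) Yf nb])
      obtain w where w: "adj v w" using v by blast
      then have "w \<in> Y" using nb v by blast
      then have lw: "w < n" "l w = K" using Yf by auto
      have "leaves c w \<subseteq> {..<n}" by (auto simp: leaves_def)
      \<comment> \<open>A neighbour of \<open>v\<close> is a centre with \<open>K\<close> leaves,
        all among the \<open>n\<close> vertices; this keeps \<open>K + 1\<close> within
        \<open>optimal_bound\<close>.\<close>
      then have "K \<le> n" using starD(4)[OF Jd(6) lw(1)] lw(2) card_mono[of "{..<n}" "leaves c w"] by simp
      then have ob: "optimal_bound (K + 1)" using nc K by (simp add: optimal_bound_def)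
      let ?s2 = "s1(''K'' := (s1 ''K'')(0 := K + 1), ''x'' := (s1 ''x'')(0 := v))"
      have "run B ?rest ?s2 (\<lambda>t s'. t \<le> 60 * n + 60 \<and> ?post s')"
        by (rule rest) (use ag ob v in auto)
      then show ?thesis using True e B1 K by (simp add: run_Seq[of B ?c] run_Seq[of B "Assign ''K'' _ _"] run_Cond) (auto elim!: run_mono)
    next
      case False
      have "run B ?rest s1 (\<lambda>t s'. t \<le> 60 * n + 60 \<and> ?post s')"
        by (rule rest[OF ag refl]) (use 1 False e in auto)
      then show ?thesis using False e B1 by (simp add: run_Seq[of B ?c] run_Cond) (auto elim!: run_mono)
    qed
  qed simp
qed

section \<open>Covering one vertex, and then all of them\<close>

definition cover_vertex :: com where
  "cover_vertex =
    Fill ''V'' ''i'' ''n'' (Equal (Const 0) (Const 0)) (Const 0);;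
    Fill ''F'' ''i'' ''n'' (Equal (Const 0) (Const 0)) (Const 0);;
    ''g'' ::= (Const 1);;
    While (Equal (V ''g'') (Const 1)) explore;;
    shift;;
    attach"

definition forest :: "mem \<Rightarrow> bool" where
  "forest s \<longleftrightarrow> stored s \<and> star (s ''C'') (s ''D'') (s ''K'' 0) \<and> optimal_bound (s ''K'' 0)"

lemma run_cover_vertex:
  assumes s: "forest s" "s ''s'' 0 = v" and v: "v < n" "\<not> covered (s ''C'') (s ''D'') v" "\<exists>w. adj v w"
  shows "run B cover_vertex s (\<lambda>t s'. t \<le> 300 * (n * n) + 1000 * n + 1000 \<and> (forest s' \<and> s' ''s'' 0 = v \<and>
     (\<forall>u<n. u = v \<or> covered (s ''C'') (s ''D'') u \<longrightarrow> covered (s' ''C'') (s' ''D'') u)))"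
proof -
  have B1: "0 < B" "1 < B" "n < B" using B_large by auto
  define c where "c = s ''C''"
  define l where "l = s ''D''"
  have st: "stored s" "star c l (s ''K'' 0)" "optimal_bound (s ''K'' 0)" using s by (auto simp: forest_def c_def l_def)
  have n: "s ''n'' 0 = n" using st by (simp add: stored_def)
  have nv: "\<not> covered c l v" using v by (simp add: c_def l_def)
  let ?F = "\<lambda>s'. forest s' \<and> s' ''s'' 0 = v \<and> (\<forall>u<n. u = v \<or> covered c l u \<longrightarrow> covered (s' ''C'') (s' ''D'') u)"
  have loop: "run B (While (Equal (V ''g'') (Const 1)) explore) s1 (\<lambda>t s'. t \<le> 210 * (n * n) + 500 * n + 300 \<and> found v c l s')"
    if J: "exploring v c l s1" for s1
  proof -
    define pot where "pot s' = (if s' ''g'' 0 = 1 then (200 * n + 210) * (unexplored s' + 1) else 0)" for s' :: mem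
    have "run B (While (Equal (V ''g'') (Const 1)) explore) s1 (\<lambda>t s'. (exploring v c l s' \<or> found v c l s') \<and>
      \<not> bval s' (Equal (V ''g'') (Const 1)) \<and> t \<le> pot s1 + bcost (Equal (V ''g'') (Const 1)) + 1)"
    proof (rule run_While)
      show "exploring v c l s1 \<or> found v c l s1" using J by simp
      show "bfits B x (Equal (V ''g'') (Const 1))" for x using B1 by simp
      fix x assume "exploring v c l x \<or> found v c l x" "bval x (Equal (V ''g'') (Const 1))"
      then have Jx: "exploring v c l x" by (auto simp: found_def)
      then have px: "pot x = (200 * n + 210) * (unexplored x + 1)" by (simp add: pot_def exploring_def)
      show "run B explore x (\<lambda>t s'. (exploring v c l s' \<or> found v c l s') \<and> t + bcost (Equal (V ''g'') (Const 1)) + 1 + pot s' \<le> pot x)"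
      proof (rule run_mono[OF run_explore[OF Jx v(1) nv v(3)]], elim conjE)
        fix t s' assume t: "t \<le> 200 * n + 200" and d: "exploring v c l s' \<and> unexplored s' < unexplored x \<or> found v c l s'"
        from d have "pot s' + (200 * n + 210) \<le> pot x"
        proof
          assume a: "exploring v c l s' \<and> unexplored s' < unexplored x"
          then have "(200 * n + 210) * (unexplored s' + 1 + 1) \<le> (200 * n + 210) * (unexplored x + 1)"
            by (intro mult_le_mono2) simp
          moreover have "pot s' = (200 * n + 210) * (unexplored s' + 1)" using a by (simp add: pot_def exploring_def)
          ultimately show ?thesis unfolding px by (simp add: algebra_simps)
        next
          assume "found v c l s'"
          then show ?thesis using px by (simp add: pot_def found_def)
        qed
        then show "(exploring v c l s' \<or> found v c l s') \<and> t + bcost (Equal (V ''g'') (Const 1)) + 1 + pot s' \<le> pot x"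
          using t d by auto
      qed
    qed
    moreover have "pot s1 \<le> (200 * n + 210) * (n + 1)"
    proof -
      have "unexplored s1 \<le> card {..<n}" unfolding unexplored_def by (rule card_mono) auto
      then have "(200 * n + 210) * (unexplored s1 + 1) \<le> (200 * n + 210) * (n + 1)" by (intro mult_le_mono2) simp
      then show ?thesis by (simp add: pot_def)
    qed
    ultimately show ?thesis by (auto simp: exploring_def algebra_simps elim!: run_mono)
  qed
  \<comment> \<open>The scan tested \<open>l w < K\<close> before the shift. The shift preserves all
    counts, so the test is still valid when \<open>x\<close> is attached to
    \<open>w\<close>.\<close>
  have fin: "run B (shift;; attach) s2 (\<lambda>t s'. t \<le> 40 * n + 200 \<and> ?F s')" if fd: "found v c l s2" for s2
  proof -
    define K where "K = s2 ''K'' 0"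
    define x where "x = s2 ''x'' 0"
    define w where "w = s2 ''w'' 0"
    have f: "stored s2" "s2 ''s'' 0 = v" "s2 ''C'' = c" "s2 ''D'' = l" "star c l K" "optimal_bound K" "x < n" "adj x w" "l w < K"
      using fd by (auto simp: found_def K_def x_def w_def)
    have K2: "2 \<le> K" "K \<le> n + 1" using f(6) by (auto simp: optimal_bound_def)
    obtain dep where dep: "x = v \<or> c x \<noteq> x \<and> c x \<in> visited s2 \<and> alternating c l K v (visited s2) (s2 ''p'') dep"
      using fd by (auto simp: found_def K_def x_def)
    show ?thesis
    proof (rule run_then[OF run_shift[OF f(3) x_def[symmetric] f(2) refl f(7) v(1) f(5) K2(1) nv dep]])
      fix s3
      assume 3: "agree {''y'', ''z'', ''q'', ''C''} s2 s3 \<and> star (s3 ''C'') l K \<and> s3 ''C'' x = x \<and> l x = 0 \<and>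
        (\<forall>u. u \<noteq> x \<longrightarrow> u = v \<or> covered c l u \<longrightarrow> covered (s3 ''C'') l u)"
      then have ag: "agree {''y'', ''z'', ''q'', ''C''} s2 s3" by simp
      have e: "s3 ''x'' 0 = x" "s3 ''w'' 0 = w" "s3 ''D'' = l" "s3 ''s'' 0 = v" "s3 ''K'' 0 = K"
        using agreeD[OF ag] f by (auto simp: x_def w_def K_def)
      have st3: "stored s3" using f(1) stored_agree[OF ag] by simp
      have "run B attach s3 (\<lambda>t s'. t \<le> 100 \<and> (agree {''q'', ''C'', ''D''} s3 s' \<and> star (s' ''C'') (s' ''D'') K \<and>
        (\<forall>u. u = x \<or> u < n \<and> covered (s3 ''C'') l u \<longrightarrow> covered (s' ''C'') (s' ''D'') u)))"
        by (rule run_attach[OF e(1,2) refl e(3)]) (use 3 K2 f in auto)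
      then show "run B attach s3 (\<lambda>t s'. t \<le> 100 \<and> ?F s')"
      proof (rule run_weaken)
        fix s4 assume 4: "agree {''q'', ''C'', ''D''} s3 s4 \<and> star (s4 ''C'') (s4 ''D'') K \<and>
          (\<forall>u. u = x \<or> u < n \<and> covered (s3 ''C'') l u \<longrightarrow> covered (s4 ''C'') (s4 ''D'') u)"
        then have ag4: "agree {''q'', ''C'', ''D''} s3 s4" by simp
        have "s4 ''s'' 0 = v" "s4 ''K'' 0 = K" using agreeD[OF ag4] e by auto
        moreover have "stored s4" using st3 stored_agree[OF ag4] by simp
        ultimately show "?F s4" using 3 4 f(6) unfolding forest_def by metis
      qed simp
    qed simp
  qed
  have tail: "run B (''g'' ::= (Const 1);; While (Equal (V ''g'') (Const 1)) explore;; shift;; attach) s1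
     (\<lambda>t s'. t \<le> 210 * (n * n) + 540 * n + 510 \<and> ?F s')"
    if 1: "agree {''V'', ''i'', ''F''} s s1" "\<And>y. y < n \<Longrightarrow> s1 ''V'' y = 0" "\<And>y. y < n \<Longrightarrow> s1 ''F'' y = 0" for s1
  proof (rule run_assign_then[where T' = "210 * (n * n) + 540 * n + 500"])
    let ?s1 = "s1(''g'' := (s1 ''g'')(aval s1 (Const 0) := aval s1 (Const 1)))"
    have ag: "agree {''V'', ''i'', ''F'', ''g''} s ?s1" using 1(1) by (auto simp: agree_def)
    have vis: "visited ?s1 = {}" using 1(2) by (auto simp: visited_def)
    have e: "?s1 ''s'' = s ''s''" "?s1 ''C'' = c" "?s1 ''D'' = l" "?s1 ''K'' = s ''K''" using agreeD[OF ag] by (auto simp: c_def l_def)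
    have "\<exists>dep. alternating c l (s ''K'' 0) v {} (?s1 ''p'') dep" by (auto simp: alternating_def)
    moreover have "stored ?s1" using st(1) stored_agree[OF ag] by simp
    moreover have "?s1 ''g'' 0 = 1" "\<forall>x<n. ?s1 ''F'' x = 0" using 1(3) by auto
    ultimately have "exploring v c l ?s1" unfolding exploring_def e vis
      using st s(2) by (simp del: fun_upd_apply)
    then show "run B (While (Equal (V ''g'') (Const 1)) explore;; shift;; attach) ?s1
      (\<lambda>t s'. t \<le> 210 * (n * n) + 540 * n + 500 \<and> ?F s')"
      by (rule run_then[OF loop fin]) auto
  qed (use B1 in auto)
  show ?thesis unfolding cover_vertex_def c_def[symmetric] l_def[symmetric]
  proof (rule run_then[OF run_clear])
    fix s1 assume 1: "agree {''V'', ''i''} s s1 \<and> (\<forall>y<n. s1 ''V'' y = 0)"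
    show "run B (Fill ''F'' ''i'' ''n'' (Equal (Const 0) (Const 0)) (Const 0);;
      ''g'' ::= (Const 1);; While (Equal (V ''g'') (Const 1)) explore;; shift;; attach) s1
      (\<lambda>t s'. t \<le> 250 * (n * n) + 600 * n + 600 \<and> ?F s')"
    proof (rule run_then[OF run_clear])
      fix s2 assume 2: "agree {''F'', ''i''} s1 s2 \<and> (\<forall>y<n. s2 ''F'' y = 0)"
      show "run B (''g'' ::= (Const 1);; While (Equal (V ''g'') (Const 1)) explore;; shift;; attach) s2
        (\<lambda>t s'. t \<le> 210 * (n * n) + 540 * n + 510 \<and> ?F s')"
        by (rule tail) (use 1 2 in \<open>auto simp: agree_def\<close>)
    qed (use 1 n in \<open>auto simp: agree_def\<close>)
  qed (use n in auto)
qed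

text \<open>\<open>K\<close> is set once and carried from vertex to vertex. The value 2 is a lower
  bound because perfect matchings have been excluded before. Covered vertices stay covered, so one
  pass suffices.\<close>

definition star_cover_prog :: com where
  "star_cover_prog =
    Fill ''C'' ''i'' ''n'' (Equal (Const 0) (Const 0)) (V ''i'');;
    Fill ''D'' ''i'' ''n'' (Equal (Const 0) (Const 0)) (Const 0);;
    ''K'' ::= (Const 2);;
    For ''s'' ''n'' (Cond (Conj (Equal (Cell ''C'' (V ''s'')) (V ''s'')) (Equal (Cell ''D'' (V ''s'')) (Const 0))) cover_vertex Skip)"

lemma run_star_cover_prog:
  assumes s: "stored s" and nb: "\<And>v. v < n \<Longrightarrow> \<exists>w. adj v w" and no: "\<And>F. \<not> matching_cover {..<n} E 1 F"
  shows "run B star_cover_prog s (\<lambda>t s'. t \<le> 5000 * n ^ 3 + 1000 \<and> (forest s' \<and>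
     (\<forall>u<n. covered (s' ''C'') (s' ''D'') u)))"
proof -
  have B1: "0 < B" "1 < B" "2 < B" "n < B" using B_large by auto
  let ?true = "Equal (Const 0) (Const 0)"
  let ?b = "Cond (Conj (Equal (Cell ''C'' (V ''s'')) (V ''s'')) (Equal (Cell ''D'' (V ''s'')) (Const 0))) cover_vertex Skip"
  have n: "s ''n'' 0 = n" using s by (simp add: stored_def)
  define I where "I k s' \<longleftrightarrow> forest s' \<and> (\<forall>u<k. covered (s' ''C'') (s' ''D'') u)" for k s'
  have put: "I k (s'(''s'' := f)) \<longleftrightarrow> I k s'" for k s' f by (simp add: I_def forest_def stored_def)
  have loop: "run B (For ''s'' ''n'' ?b) s1 (\<lambda>t s'. I n s' \<and> s' ''s'' 0 = n \<and> s' ''n'' 0 = n \<and>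
      t \<le> n * ((300 * (n * n) + 1000 * n + 1020) + 12) + 9)" if I0: "I 0 s1" for s1
  proof (rule run_For)
    show "I 0 (put s1 ''s'' 0)" using I0 put by simp
    show "s1 ''n'' 0 = n" using I0 by (simp add: I_def forest_def stored_def)
    fix k s' assume k: "k < n" "I k s'" "s' ''s'' 0 = k" "s' ''n'' 0 = n"
    let ?Q = "\<lambda>t s''. s'' ''s'' 0 = k \<and> s'' ''n'' 0 = n \<and> I (Suc k) (put s'' ''s'' (Suc k)) \<and> t \<le> 300 * (n * n) + 1000 * n + 1020"
    have fo: "forest s'" using k by (simp add: I_def)
    show "run B ?b s' ?Q"
    proof (cases "covered (s' ''C'') (s' ''D'') k")
      case True
      then have "I (Suc k) s'" using k(2) by (auto simp: I_def less_Suc_eq)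
      then show ?thesis using True k B1 put by (auto simp: run_Cond covered_def)
    next
      case False
      have "run B cover_vertex s' (\<lambda>t s''. ?Q (t + 17) s'')"
      proof (rule run_mono[OF run_cover_vertex[OF fo k(3,1) False nb[OF k(1)]]], elim conjE)
        fix t s'' assume 1: "t \<le> 300 * (n * n) + 1000 * n + 1000" "forest s''" "s'' ''s'' 0 = k"
          "\<forall>u<n. u = k \<or> covered (s' ''C'') (s' ''D'') u \<longrightarrow> covered (s'' ''C'') (s'' ''D'') u"
        have "I (Suc k) s''" using 1(2,4) k(1,2) by (auto simp: I_def less_Suc_eq)
        then show "?Q (t + 17) s''" using 1 put by (auto simp: forest_def stored_def)
      qed
      then show ?thesis using False k B1 by (simp add: run_Cond covered_def) (auto elim!: run_mono)
    qed
  qed (use B1 in auto)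
  have fill: "run B (Fill ''C'' ''i'' ''n'' ?true (V ''i'')) s
    (\<lambda>t s'. t \<le> n * 25 + 10 \<and> (agree {''C'', ''i''} s s' \<and> (\<forall>y<n. s' ''C'' y = y)))"
    using run_Fill[of s "''n''" n B "''i''" "''C''" ?true "\<lambda>_. True" "V ''i''" "\<lambda>k. k"] n B1
    by (auto elim!: run_mono)
  note pow = n_le_cube
  have pow3: "n * (n * n) = n ^ 3" by (simp add: power3_eq_cube)
  let ?F = "\<lambda>s'. forest s' \<and> (\<forall>u<n. covered (s' ''C'') (s' ''D'') u)"
  have loop': "run B (For ''s'' ''n'' ?b) s1 (\<lambda>t s'. t \<le> 3000 * n ^ 3 + 500 \<and> ?F s')" if I0: "I 0 s1" for s1
  proof (rule run_mono[OF loop[OF I0]])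
    fix t s' assume 2: "I n s' \<and> s' ''s'' 0 = n \<and> s' ''n'' 0 = n \<and> t \<le> n * ((300 * (n * n) + 1000 * n + 1020) + 12) + 9"
    have "n * ((300 * (n * n) + 1000 * n + 1020) + 12) + 9 = 300 * (n * (n * n)) + 1000 * (n * n) + 1032 * n + 9"
      by (simp add: algebra_simps)
    also have "\<dots> \<le> 3000 * n ^ 3 + 500" using pow unfolding pow3 by linarith
    finally show "t \<le> 3000 * n ^ 3 + 500 \<and> ?F s'" using 2 by (auto simp: I_def)
  qed
  have start: "I 0 (put s2 ''K'' 2)" if 2: "agree {''C'', ''D'', ''i''} s s2" "\<And>y. y < n \<Longrightarrow> s2 ''C'' y = y" "\<And>y. y < n \<Longrightarrow> s2 ''D'' y = 0" for s2
  proof -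
    have "leaves (s2 ''C'') y = {}" for y using 2(2) by (auto simp: leaves_def)
    then have "star (s2 ''C'') (s2 ''D'') 2" using 2(2,3) by (simp add: star_def)
    moreover have "optimal_bound 2" using n_pos no by (simp add: optimal_bound_def One_nat_def)
    moreover have "stored s2" using s stored_agree[OF 2(1)] by simp
    ultimately show ?thesis by (simp add: I_def forest_def stored_def)
  qed
  show ?thesis unfolding star_cover_prog_def
  proof (rule run_then[OF fill])
    fix s1 assume 1: "agree {''C'', ''i''} s s1 \<and> (\<forall>y<n. s1 ''C'' y = y)"
    show "run B (Fill ''D'' ''i'' ''n'' ?true (Const 0);; ''K'' ::= (Const 2);; For ''s'' ''n'' ?b) s1
      (\<lambda>t s'. t \<le> 4000 * n ^ 3 + 700 \<and> ?F s')"
    proof (rule run_then[OF run_clear])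
      fix s2 assume 2: "agree {''D'', ''i''} s1 s2 \<and> (\<forall>y<n. s2 ''D'' y = 0)"
      have "I 0 (put s2 ''K'' 2)" by (rule start) (use 1 2 in \<open>auto simp: agree_def\<close>)
      from loop'[OF this] show "run B (''K'' ::= (Const 2);; For ''s'' ''n'' ?b) s2 (\<lambda>t s'. t \<le> 3000 * n ^ 3 + 510 \<and> ?F s')"
        using B1 by (simp add: run_Seq) (auto elim!: run_mono)
    next
      show "n * 24 + 10 + (3000 * n ^ 3 + 510) \<le> 4000 * n ^ 3 + 700" using pow by linarith
    qed (use 1 n in \<open>auto simp: agree_def\<close>)
  next
    show "n * 25 + 10 + (4000 * n ^ 3 + 700) \<le> 5000 * n ^ 3 + 1000" using pow by linarith
  qed
qed

subsection \<open>The complete program\<close>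

text \<open>Zeros are written too, so the relevant part of \<open>cover\<close> is determined
  whatever it held before. The diagonal stays empty because fixed points stand for no edge.\<close>

definition emit :: "aname \<Rightarrow> com" where
  "emit A = For ''i'' ''n'' (For ''j'' ''n''
     (Cond (Conj (Equal (Cell A (V ''i'')) (V ''j'')) (Neg (Equal (V ''i'') (V ''j''))))
       (Assign ''cover'' (Plus (Times (V ''i'') (V ''n'')) (V ''j'')) (Const 1))
       (Assign ''cover'' (Plus (Times (V ''i'') (V ''n'')) (V ''j'')) (Const 0))))"

lemma run_emit:
  assumes s: "s ''n'' 0 = n" "A \<notin> {''i'', ''j'', ''n'', ''cover''}" "\<And>v. v < n \<Longrightarrow> s A v < n"
  shows "run B (emit A) s (\<lambda>t s'. t \<le> 100 * (n * n) + 100 * n + 10 \<and> output_edges n s' = {{v, s A v} | v. v < n \<and> s A v \<noteq> v})"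
proof -
  have B1: "0 < B" "1 < B" "n < B" using B_large by auto
  have nm [simp]: "A \<noteq> ''i''" "A \<noteq> ''j''" "A \<noteq> ''n''" "A \<noteq> ''cover''" using s(2) by auto
  let ?b = "Cond (Conj (Equal (Cell A (V ''i'')) (V ''j'')) (Neg (Equal (V ''i'') (V ''j''))))
       (Assign ''cover'' (Plus (Times (V ''i'') (V ''n'')) (V ''j'')) (Const 1))
       (Assign ''cover'' (Plus (Times (V ''i'') (V ''n'')) (V ''j'')) (Const 0))"
  define hit where "hit u w \<longleftrightarrow> s A u = w \<and> u \<noteq> w" for u w
  define I where "I i s' \<longleftrightarrow> agree {''i'', ''j'', ''cover''} s s' \<and>
    (\<forall>u<i. \<forall>w<n. s' ''cover'' (u * n + w) \<noteq> 0 \<longleftrightarrow> hit u w)" for i s'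
  have inner: "run B (For ''j'' ''n'' ?b) s1 (\<lambda>t s'. I (Suc i) s' \<and> s' ''i'' 0 = i \<and> t \<le> 42 * n + 9)"
    if 1: "I i s1" "i < n" "s1 ''i'' 0 = i" "s1 ''n'' 0 = n" for s1 i
  proof -
    define J where "J j s' \<longleftrightarrow> I i s' \<and> s' ''i'' 0 = i \<and> (\<forall>w<j. s' ''cover'' (i * n + w) \<noteq> 0 \<longleftrightarrow> hit i w)" for j s'
    have put: "J k (s'(''j'' := f)) \<longleftrightarrow> J k s'" for k s' f by (simp add: J_def I_def)
    have "run B (For ''j'' ''n'' ?b) s1 (\<lambda>t s'. J n s' \<and> s' ''j'' 0 = n \<and> s' ''n'' 0 = n \<and> t \<le> n * (30 + 12) + 9)"
    proof (rule run_For)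
      show "J 0 (put s1 ''j'' 0)" using 1 by (simp add: J_def I_def)
      fix k s' assume k: "k < n" "J k s'" "s' ''j'' 0 = k" "s' ''n'' 0 = n"
      have ag: "agree {''i'', ''j'', ''cover''} s s'" and i: "s' ''i'' 0 = i" using k by (auto simp: J_def I_def)
      have A: "s' A = s A" using agreeD[OF ag] by simp
      have f: "i * n < B" "i * n + k < B" using row_bound[OF 1(2)] k B_large by auto
      have upd: "J (Suc k) (s'(''cover'' := (s' ''cover'')(i * n + k := b)))" if b: "b \<noteq> 0 \<longleftrightarrow> hit i k" for b
      proof -
        have "u * n + w = i * n + k \<longleftrightarrow> u = i \<and> w = k" if "w < n" for u w
          using row_index_inj[OF that k(1), of u i] by auto
        then show ?thesis using k(1,2) b ag i by (auto simp: J_def I_def less_Suc_eq)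
      qed
      show "run B ?b s' (\<lambda>t s''. s'' ''j'' 0 = k \<and> s'' ''n'' 0 = n \<and> J (Suc k) (put s'' ''j'' (Suc k)) \<and> t \<le> 30)"
      proof (cases "hit i k")
        case True
        then show ?thesis using upd[of 1] k B1 f A i put by (simp add: run_Cond hit_def)
      next
        case False
        then show ?thesis using upd[of 0] k B1 f A i put by (auto simp: run_Cond hit_def)
      qed
    qed (use 1 B1 in auto)
    then show ?thesis by (rule run_mono) (auto simp: J_def I_def less_Suc_eq)
  qed
  have "run B (emit A) s (\<lambda>t s'. I n s' \<and> s' ''i'' 0 = n \<and> s' ''n'' 0 = n \<and> t \<le> n * ((42 * n + 9) + 12) + 9)"
    unfolding emit_def
  proof (rule run_For)
    show "I 0 (put s ''i'' 0)" by (simp add: I_def)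
    fix k s' assume k: "k < n" "I k s'" "s' ''i'' 0 = k" "s' ''n'' 0 = n"
    show "run B (For ''j'' ''n'' ?b) s' (\<lambda>t s''. s'' ''i'' 0 = k \<and> s'' ''n'' 0 = n \<and> I (Suc k) (put s'' ''i'' (Suc k)) \<and> t \<le> 42 * n + 9)"
    proof (rule run_mono[OF inner[OF k(2,1,3,4)]], elim conjE, intro conjI)
      fix t s'' assume 2: "I (Suc k) s''" "s'' ''i'' 0 = k" "t \<le> 42 * n + 9"
      then show "s'' ''i'' 0 = k" "t \<le> 42 * n + 9" "I (Suc k) (put s'' ''i'' (Suc k))" by (auto simp: I_def)
      show "s'' ''n'' 0 = n" using 2(1) s(1) by (auto simp: I_def agree_def)
    qed
  qed (use s B1 in auto)
  then show ?thesis
  proof (rule run_mono, elim conjE, intro conjI)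
    fix t s' assume 2: "I n s'" "t \<le> n * ((42 * n + 9) + 12) + 9"
    show "t \<le> 100 * (n * n) + 100 * n + 10" using 2(2) by (simp add: algebra_simps)
    have cov: "\<And>u w. u < n \<Longrightarrow> w < n \<Longrightarrow> s' ''cover'' (u * n + w) \<noteq> 0 \<longleftrightarrow> hit u w"
      using 2(1) by (simp add: I_def)
    have "output_edges n s' = {{u, w} | u w. u < n \<and> w < n \<and> hit u w}"
      unfolding output_edges_def using cov by (simp cong: conj_cong)
    also have "\<dots> = {{v, s A v} | v. v < n \<and> s A v \<noteq> v}" by (rule Collect_cong) (metis hit_def s(3))
    finally show "output_edges n s' = {{v, s A v} | v. v < n \<and> s A v \<noteq> v}" .
  qed
qed

section \<open>From lower bounds to optimality\<close>

text \<open>The family is padded with empty matchings.\<close>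

lemma matching_cover_mono:
  assumes "matching_cover A E j F" "j \<le> k"
  shows "matching_cover A E k F"
proof -
  obtain M where M: "\<forall>i<j. matching E (M i)" "F = (\<Union>i<j. M i)" "\<forall>v\<in>A. \<exists>e\<in>F. v \<in> e"
    using assms(1) unfolding matching_cover_def by blast
  let ?M = "\<lambda>i. if i < j then M i else {}"
  have "matching E {}" by (simp add: matching_def)
  then have "\<forall>i<k. matching E (?M i)" using M(1) by simp
  moreover have "F = (\<Union>i<k. ?M i)" proof -
    have "(\<Union>i<k. ?M i) = (\<Union>i\<in>{..<k} \<inter> {..<j}. M i)" by (auto split: if_splits)
    also have "{..<k} \<inter> {..<j} = {..<j}" using assms(2) by auto
    finally show ?thesis using M(2) by simp
  qed
  ultimately show ?thesis unfolding matching_cover_def using M(3) by (intro conjI exI[of _ ?M])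
qed

text \<open>By monotonicity in the number of matchings, refuting \<open>k - 1\<close> refutes every
  smaller number as well.\<close>

lemma optimal_matching_coverI:
  assumes "matching_cover A E k F" "k > 0" "\<And>F. \<not> matching_cover A E (k - 1) F"
  shows "optimal_matching_cover A E F"
proof -
  have "mc A E = k" unfolding mc_def
  proof (rule Least_equality)
    show "\<exists>F. matching_cover A E k F" using assms(1) by blast
    fix j assume "\<exists>F. matching_cover A E j F"
    then obtain F' where F': "matching_cover A E j F'" by blast
    show "k \<le> j"
    proof (rule ccontr)
      assume "\<not> k \<le> j"
      then have "j \<le> k - 1" by simp
      then show False using matching_cover_mono[OF F'] assms(3) by blast
    qed
  qed
  then show ?thesis using assms(1) by (simp add: optimal_matching_cover_def)
qed

text \<open>The test on \<open>n\<close> stops the program on the one-vertex graph, where the star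
  search would have no neighbour to attach its vertex to and no cover exists.\<close>

definition cover_prog :: com where
  "cover_prog = perfect;;
     Cond (Equal (V ''o'') (Const 1)) (emit ''m'')
       (Cond (Less (Const 1) (V ''n'')) (star_cover_prog;; emit ''C'') Skip)"

lemma run_cover_prog:
  assumes s: "stored s" and nb: "\<And>v. v < n \<Longrightarrow> n \<noteq> 1 \<Longrightarrow> \<exists>w. adj v w"
  shows "run B cover_prog s (\<lambda>t s'. t \<le> 30000 * n ^ 3 + 3000 \<and>
    (n \<noteq> 1 \<longrightarrow> optimal_matching_cover {..<n} E (output_edges n s')))"
proof -
  have B1: "0 < B" "1 < B" "n < B" using B_large by auto
  note pow = n_le_cube
  let ?O = "\<lambda>s'. n \<noteq> 1 \<longrightarrow> optimal_matching_cover {..<n} E (output_edges n s')"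
  show ?thesis unfolding cover_prog_def
  proof (rule run_then[OF run_perfect[OF s]])
    fix s1
    assume 1: "stored s1 \<and> (s1 ''o'' 0 = 1 \<and> mating (s1 ''m'') \<and> (\<forall>v<n. s1 ''m'' v \<noteq> v) \<or>
      s1 ''o'' 0 = 0 \<and> (\<forall>F. \<not> matching_cover {..<n} E 1 F))"
    then have st: "stored s1" and n: "s1 ''n'' 0 = n" by (auto simp: stored_def)
    show "run B (Cond (Equal (V ''o'') (Const 1)) (emit ''m'')
       (Cond (Less (Const 1) (V ''n'')) (star_cover_prog;; emit ''C'') Skip)) s1
       (\<lambda>t s'. t \<le> 6000 * n ^ 3 + 2000 \<and> ?O s')"
    proof (cases "s1 ''o'' 0 = 1")
      case True
      then have m: "mating (s1 ''m'')" "\<And>v. v < n \<Longrightarrow> s1 ''m'' v \<noteq> v" using 1 by auto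
      \<comment> \<open>The union of no matchings is empty and misses vertex 0, which exists as
        \<open>n\<close> is positive.\<close>
      have no0: "\<not> matching_cover {..<n} E (1 - 1) F" for F
        using n_pos by (auto simp: matching_cover_def intro!: exI[of _ "0 :: nat"])
      have "{{v, s1 ''m'' v} | v. v < n \<and> s1 ''m'' v \<noteq> v} = {{v, s1 ''m'' v} | v. v < n}"
        using m(2) by blast
      then have opt: "optimal_matching_cover {..<n} E {{v, s1 ''m'' v} | v. v < n \<and> s1 ''m'' v \<noteq> v}"
        using optimal_matching_coverI[OF perfect_matching_cover[OF m] _ no0] by simp
      have "run B (emit ''m'') s1 (\<lambda>t s'. t \<le> 100 * (n * n) + 100 * n + 10 \<and>
         output_edges n s' = {{v, s1 ''m'' v} | v. v < n \<and> s1 ''m'' v \<noteq> v})"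
        by (rule run_emit) (use n matingD[OF m(1)] in auto)
      then have "run B (emit ''m'') s1 (\<lambda>t s'. t \<le> 5000 * n ^ 3 + 500 \<and> ?O s')"
        by (rule run_weaken) (use opt pow in auto)
      then show ?thesis using True B1 by (simp add: run_Cond) (auto elim!: run_mono)
    next
      case False
      then have no: "\<And>F. \<not> matching_cover {..<n} E 1 F" using 1 by auto
      show ?thesis
      proof (cases "n = 1")
        case n1: True
        then show ?thesis using False B1 n by (simp add: run_Cond)
      next
        case n1: False
        have "run B (star_cover_prog;; emit ''C'') s1 (\<lambda>t s'. t \<le> 5500 * n ^ 3 + 1500 \<and> ?O s')"
        proof (rule run_then[OF run_star_cover_prog[OF st nb[OF _ n1] no]])
          fix s2 assume 2: "forest s2 \<and> (\<forall>u<n. covered (s2 ''C'') (s2 ''D'') u)"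
          define K where "K = s2 ''K'' 0"
          have f: "stored s2" "star (s2 ''C'') (s2 ''D'') K" "optimal_bound K" using 2 by (auto simp: forest_def K_def)
          have n2: "s2 ''n'' 0 = n" using f(1) by (simp add: stored_def)
          have opt: "optimal_matching_cover {..<n} E {{v, s2 ''C'' v} | v. v < n \<and> s2 ''C'' v \<noteq> v}"
            by (rule optimal_matching_coverI[OF star_cover[OF f(2)]]) (use 2 f(3) in \<open>auto simp: optimal_bound_def\<close>)
          have "run B (emit ''C'') s2 (\<lambda>t s'. t \<le> 100 * (n * n) + 100 * n + 10 \<and>
            output_edges n s' = {{v, s2 ''C'' v} | v. v < n \<and> s2 ''C'' v \<noteq> v})"
            by (rule run_emit) (use n2 starD(1)[OF f(2)] in auto)
          then show "run B (emit ''C'') s2 (\<lambda>t s'. t \<le> 200 * n ^ 3 + 10 \<and> ?O s')"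
            by (rule run_weaken) (use opt pow in auto)
        qed auto
        then show ?thesis using False n1 B1 n n_pos by (simp add: run_Cond) (auto elim!: run_mono)
      qed
    qed
  qed simp
qed

end

section \<open>Input memory and the final statement\<close>

lemma stored_input:
  assumes "ram_graph n E B"
  shows "ram_graph.stored n E (input_mem n E)"
proof -
  interpret ram_graph n E B by (rule assms)
  have "u * n + w < n * n" if "u < n" "w < n" for u w using row_bound[OF that(1)] that(2) by simp
  then show ?thesis by (auto simp: stored_def input_mem_def)
qed

lemma connected_neighbour:
  assumes "connected_graph A E" "v \<in> A" "A \<noteq> {v}"
  shows "\<exists>w. {v, w} \<in> E"
proof -
  obtain u where "u \<in> A" "u \<noteq> v" using assms by auto
  then have "(v, u) \<in> {(x, y). {x, y} \<in> E}\<^sup>*" "v \<noteq> u"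
    using assms by (auto simp: connected_graph_def)
  then show ?thesis by (auto elim: converse_rtranclE)
qed

theorem theorem1:
  "\<exists>(p :: com) (d :: nat) (T :: nat \<Rightarrow> nat).
     (\<lambda>n. real (T n)) \<in> O(\<lambda>n. real n ^ 3) \<and>
     (\<forall>(n :: nat) (E :: nat set set).
        simple_graph {..<n} E \<longrightarrow> connected_graph {..<n} E \<longrightarrow>
        (\<exists>t s. exec ((n + 2) ^ d) p (input_mem n E) t s \<and> t \<le> T n \<and>
           ((\<exists>k F. matching_cover {..<n} E k F) \<longrightarrow>
              optimal_matching_cover {..<n} E (output_edges n s))))"
proof (rule exI, rule exI, rule exI, intro conjI allI impI)
  let ?T = "\<lambda>n :: nat. 30000 * n ^ 3 + 3000"
  show "(\<lambda>n. real (?T n)) \<in> O(\<lambda>n. real n ^ 3)"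
  proof (rule bigoI)
    \<comment> \<open>The factor is the sum of 30000 and 3000, because \<open>n ^ 3\<close> is at
      least 1 for positive \<open>n\<close>.\<close>
    show "\<forall>\<^sub>F n in sequentially. norm (real (?T n)) \<le> 33000 * norm (real n ^ 3)"
      using eventually_ge_at_top[of 1]
    proof eventually_elim
      case (elim n)
      then have "(1 :: real) \<le> real n ^ 3" by (simp add: one_le_power)
      then show ?case by simp
    qed
  qed
  fix n :: nat and E :: "nat set set"
  assume G: "simple_graph {..<n} E" "connected_graph {..<n} E"
  have n: "n \<ge> 1" using G(2) by (cases n) (auto simp: connected_graph_def)
  \<comment> \<open>The exponent 2 is the choice of \<open>d\<close>: \<open>(n + 2) ^ 2\<close> is
    exactly the bound demanded by the locale.\<close>
  interpret ram_graph n E "(n + 2) ^ 2"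
    by unfold_locales (use G(1) n in \<open>auto simp: power2_eq_square algebra_simps\<close>)
  have nb: "\<exists>w. adj v w" if "v < n" "n \<noteq> 1" for v
  proof (rule connected_neighbour[OF G(2)])
    show "{..<n} \<noteq> {v}"
    proof
      assume "{..<n} = {v}"
      then have "card {..<n} = card {v}" by simp
      then show False using that by simp
    qed
  qed (use that in auto)
  have "run ((n + 2) ^ 2) cover_prog (input_mem n E) (\<lambda>t s'. t \<le> ?T n \<and>
    (n \<noteq> 1 \<longrightarrow> optimal_matching_cover {..<n} E (output_edges n s')))"
    by (rule run_cover_prog[OF stored_input[OF ram_graph_axioms] nb])
  then obtain t s where ts: "exec ((n + 2) ^ 2) cover_prog (input_mem n E) t s" "t \<le> ?T n"
    "n \<noteq> 1 \<longrightarrow> optimal_matching_cover {..<n} E (output_edges n s)"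
    by (elim runE) blast
  \<comment> \<open>A cover of a single vertex would contain an edge, whose two ends do not fit into
    one vertex.\<close>
  have "n \<noteq> 1" if ex: "\<exists>k F. matching_cover {..<n} E k F"
  proof
    assume n1: "n = 1"
    from ex obtain k F where "matching_cover {..<n} E k F" by blast
    then obtain M where F: "F = (\<Union>i<k. M i)" "\<forall>i<k. matching E (M i)" "\<forall>v\<in>{..<n}. \<exists>e\<in>F. v \<in> e"
      unfolding matching_cover_def by blast
    have "0 \<in> {..<n}" using n1 by simp
    then obtain e where "e \<in> F" using F(3) by blast
    then have "e \<in> E" using F(1,2) by (auto simp: matching_def)
    then obtain e where "e \<subseteq> {..<n}" "card e = 2" using G(1) by (auto simp: simple_graph_def)
    then show False using card_mono[of "{..<n}" e] n1 by simp
  qed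
  \<comment> \<open>The program constants refer to none of the locale parameters, so outside the
    locale \<open>cover_prog\<close> is one fixed program, the same for all \<open>n\<close> and
    \<open>E\<close>, as the order of quantifiers requires.\<close>
  then show "\<exists>t s. exec ((n + 2) ^ 2) ram_graph.cover_prog (input_mem n E) t s \<and> t \<le> ?T n \<and>
     ((\<exists>k F. matching_cover {..<n} E k F) \<longrightarrow> optimal_matching_cover {..<n} E (output_edges n s))"
    using ts by blast
qed

end
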